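(* Let $n\ge 2$, let $K\subset\mathbb{R}^n$ be a convex body, and let $\gamma\subset\mathbb{R}^n$ be any curve such that $K\subset \operatorname{co}(\gamma)$. Then $$ N(K)=nW_{n-1}(K)\le \frac{\pi^{\frac{n-1}{2}}}{2\,\Gamma\!\left(\frac{n+1}{2}\right)}\cdot \operatorname{length}(\gamma)+\frac{\pi^{\frac{n}{2}-1}}{\Gamma\!\left(\frac{n}{2}\right)}\cdot \operatorname{diam}(K), $$ where $\Gamma$ is the gamma function (the inequality being trivial if $\operatorname{length}(\gamma)=\infty$).
   Context: $\mathbb{R}^n$ carries the standard Euclidean metric $d$. A convex body is any nonempty compact convex subset of $\mathbb{R}^n$ (empty interior allowed). $\operatorname{co}(A)$ denotes the convex hull of $A$, and $\operatorname{diam}(K)=\max\{d(x,y): x,y\in K\}$. A curve is the image of a continuous map $\varphi:[a,b]\to\mathbb{R}^n$; its length is $\operatorname{length}(\gamma)=\sup\sum_{i=1}^m d(\varphi(t_{i-1}),\varphi(t_i))$ over all partitions $a=t_0<t_1<\dots<t_m=b$ (possibly $+\infty$). The quermassintegrals $W_0(K),\dots,W_n(K)$ are defined by the Steiner formula: for $\varepsilon\ge 0$, the volume of the outer parallel body $K_\varepsilon=\{x\in\mathbb{R}^n: d(K,x)\le\varepsilon\}$ satisfies $\operatorname{vol}(K_\varepsilon)=\sum_{k=0}^n \binom{n}{k} W_k(K)\,\varepsilon^k$. The norm of $K$ is $N(K):=nW_{n-1}(K)$; equivalently $N(K)=\int_{S^{n-1}} h(K,u)\,du=\frac12\int_{S^{n-1}}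 w(K,u)\,du$, where $h(K,u)=\sup\{(x,u):x\in K\}$ is the support function, $w(K,u)=h(K,u)+h(K,-u)$ is the width function, and $du$ is the standard surface measure on the unit sphere $S^{n-1}$. (For $n=2$, $N(K)$ is the perimeter of $K$.) *)

theory Defs
  imports "HOL-Analysis.Analysis"
begin

text \<open>Convex body: nonempty compact convex set (empty interior allowed).\<close>
definition convex_body :: "(real ^ 'n) set \<Rightarrow> bool" where
  "convex_body K \<longleftrightarrow> K \<noteq> {} \<and> compact K \<and> convex K"

definition parallel_body :: "(real ^ 'n) set \<Rightarrow> real \<Rightarrow> (real ^ 'n) set" where
  "parallel_body K \<epsilon> = {x. infdist x K \<le> \<epsilon>}"

text \<open>Quermassintegrals W_0,...,W_n, defined as the coefficients in the Steiner formula
  vol(K_eps) = sum_{k=0}^n (n choose k) W_k(K) eps^k  for all eps \<ge> 0  (n = CARD('n)).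
  The coefficient function is normalised to vanish for k > n, which makes it unique.\<close>
definition quermass :: "(real ^ 'n) set \<Rightarrow> nat \<Rightarrow> real" where
  "quermass K = (THE W. (\<forall>k > CARD('n). W k = 0) \<and>
     (\<forall>\<epsilon>\<ge>0. measure lebesgue (parallel_body K \<epsilon>) =
        (\<Sum>k\<le>CARD('n). real (CARD('n) choose k) * W k * \<epsilon> ^ k)))"

definition norm_body :: "(real ^ 'n) set \<Rightarrow> real" where
  "norm_body K = real CARD('n) * quermass K (CARD('n) - 1)"

definition curve_length :: "(real \<Rightarrow> 'a::metric_space) \<Rightarrow> real \<Rightarrow> real \<Rightarrow> ereal" where
  "curve_length \<phi> a b = (SUP (t, m) \<in> {(t :: nat \<Rightarrow> real, m :: nat). t 0 = a \<and> t m = b \<and>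
        (\<forall>i<m. t i < t (Suc i))}.
      ereal (\<Sum>i=1..m. dist (\<phi> (t (i - 1))) (\<phi> (t i))))"

end

theory Submission
  imports Defs "HOL-Probability.Distributions"
begin

text \<open>
By Steiner's formula, $\int \exp(-d(x, tK)^2)\,dx$ is a polynomial in $t$ whose coefficient of
$t$ is $N(K)\,\Gamma(\frac{n+1}{2})$. Since $d(x, tK)^2 \ge |x|^2 - 2 t\,h(K,x)$, letting
$t \to 0$ gives $N(K)\,\Gamma(\frac{n+1}{2}) \le 2 \int h(K,x)\, e^{-|x|^2}\,dx$, which replaces
integration over the sphere by Gaussian integration.

The planar case is an inequality for a finite set $F$ covered by the convex hull of a polygonal
path: the perimeter of $F$ is at most the length of the path plus the diameter of $F$. A shortest
such path with the fewest vertices is in convex position, its end edges touch $F$, and each end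
$p$ can be traded for a point $c$ on the end edge and a point $k$ of $F$ at a cost of at most
$|pc| - |ck|$; closing up the resulting path costs only a distance between two points of $F$.

For general $n$, the planar inequality holds for the projection to every plane, that is, the
function $h(F,x) - \frac14 \sum_i |(v_i - v_{i-1}, x)|$ has integral at most the diameter of $F$
over every great circle. Averaging over all great circles bounds its Gaussian integral, and
$\int |(v,x)|\, e^{-|x|^2}\,dx = \pi^{(n-1)/2}\, |v|$ turns the sum into the length of the path.
Finally $K$ is approximated by finite subsets $F$, each of which lies in the convex hull of
finitely many points of the curve.
\<close>

subsection \<open>Polygonal paths and support functions of finite sets\<close>

text \<open>Closing a path by the chord between its end points costs their distance, which can
  exceed the diameter of \<open>F\<close>; this obstacle is why the ends are analysed so closely.
  The cost of trading an end is spread over the directions by a correction function that may be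
  negative only where that end supports the hull, so the two ends do not interfere.

  \<open>quermass\<close> is a definite description, so \<open>norm_body\<close> has no usable value
  until Steiner's formula is known: for polytopes by cutting the parallel body into cells over the
  faces, then for all bodies by approximation.

  Constants: over the circle of directions the projections of a segment integrate to 4 times its
  length, whence the factor 1/4, which the factor 2 before the Gaussian integral turns into the 1/2
  in the coefficient of the length. The diameter is a bound for each great circle, so its
  coefficient is the area of the sphere divided by 2 pi.\<close>

fun plen :: "'a::metric_space list \<Rightarrow> real" where
  "plen [] = 0"
| "plen [x] = 0"
| "plen (x # y # zs) = dist x y + plen (y # zs)"

lemma plen_nonneg: "0 \<le> plen xs"
  by (induction xs rule: plen.induct) auto

lemma plen_append: "plen (xs @ y # zs) = plen (xs @ [y]) + plen (y # zs)"
proof (induction xs)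
  case (Cons x xs)
  then show ?case by (cases xs) auto
qed simp

lemma plen_append2: "plen (xs @ x # y # zs) = plen (xs @ [x]) + dist x y + plen (y # zs)"
  using plen_append[of xs x "y # zs"] by simp

lemma plen_rev: "plen (rev xs) = plen xs"
proof (induction xs rule: plen.induct)
  case (3 x y zs)
  then show ?case
    using plen_append[of "rev zs" y "[x]"] by (simp add: dist_commute)
qed auto

lemma dist_hd_last_le_plen: "zs \<noteq> [] \<Longrightarrow> dist (hd zs) (last zs) \<le> plen zs"
proof (induction zs rule: plen.induct)
  case (3 a b zs)
  then show ?case using dist_triangle[of a "last (b # zs)" b] by simp
qed auto

lemma dist_via_le_plen:
  assumes "x \<in> set zs"
  shows "dist (hd zs) x + dist x (last zs) \<le> plen zs"
proof -
  obtain as bs where zs: "zs = as @ x # bs" using assms by (auto simp: in_set_conv_decomp)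
  have "dist (hd (as @ [x])) (last (as @ [x])) \<le> plen (as @ [x])"
    "dist (hd (x # bs)) (last (x # bs)) \<le> plen (x # bs)"
    by (rule dist_hd_last_le_plen; simp)+
  moreover have "hd (as @ [x]) = hd zs" by (cases as) (auto simp: zs)
  ultimately show ?thesis using plen_append[of as x bs] by (simp add: zs)
qed

text \<open>The closed tour is cut by \<open>x\<close> and \<open>y\<close> into two arcs, each at
  least as long as the segment between them.\<close>

lemma twice_dist_le_closed_plen:
  assumes "x \<in> set zs" "y \<in> set zs"
  shows "2 * dist x y \<le> plen (zs @ [hd zs])"
proof -
  \<comment> \<open>The case in which \<open>y\<close> comes at or after the chosen occurrence of
    \<open>x\<close>; the other order follows from the symmetry of the distance.\<close>
  have *: "2 * dist x y \<le> plen (zs @ [hd zs])"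
    if zs: "zs = as @ x # bs" and y: "y \<in> set (x # bs)" for x y as bs
  proof -
    have "dist (hd (as @ [x])) (last (as @ [x])) \<le> plen (as @ [x])"
      by (rule dist_hd_last_le_plen) simp
    moreover have "hd (as @ [x]) = hd zs" by (cases as) (auto simp: zs)
    ultimately have 1: "dist (hd zs) x \<le> plen (as @ [x])" by simp
    have "dist (hd (x # bs @ [hd zs])) y + dist y (last (x # bs @ [hd zs])) \<le> plen (x # bs @ [hd zs])"
      by (rule dist_via_le_plen) (use y in auto)
    then have 2: "dist x y + dist y (hd zs) \<le> plen (x # bs @ [hd zs])" by simp
    have "plen (zs @ [hd zs]) = plen (as @ [x]) + plen (x # bs @ [hd zs])"
      using plen_append[of as x "bs @ [hd zs]"] by (simp add: zs)
    then show ?thesis using 1 2 dist_triangle[of x y "hd zs"] by (simp add: dist_commute)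
  qed
  obtain as bs where zs: "zs = as @ x # bs" using assms(1) by (auto simp: in_set_conv_decomp)
  show ?thesis
  proof (cases "y \<in> set (x # bs)")
    case True
    then show ?thesis using *[OF zs] by simp
  next
    case False
    then have "y \<in> set as" using assms(2) zs by auto
    then obtain cs ds where "as = cs @ y # ds" by (auto simp: in_set_conv_decomp)
    then have "zs = cs @ y # (ds @ x # bs)" using zs by simp
    from *[OF this, of x] show ?thesis by (simp add: dist_commute)
  qed
qed

text \<open>The support function of \<open>F\<close>, which is also that of its convex hull.\<close>

definition hmax :: "'a::real_inner set \<Rightarrow> 'a \<Rightarrow> real" where
  "hmax F u = Max ((\<lambda>x. x \<bullet> u) ` F)"

lemma hmax_ge: "finite F \<Longrightarrow> x \<in> F \<Longrightarrow> x \<bullet> u \<le> hmax F u"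
  by (auto simp: hmax_def intro: Max_ge)

lemma hmax_le_iff: "finite F \<Longrightarrow> F \<noteq> {} \<Longrightarrow> hmax F u \<le> c \<longleftrightarrow> (\<forall>x\<in>F. x \<bullet> u \<le> c)"
  by (auto simp: hmax_def)

lemma hmax_attained: "finite F \<Longrightarrow> F \<noteq> {} \<Longrightarrow> \<exists>x\<in>F. hmax F u = x \<bullet> u"
  using Max_in[of "(\<lambda>x. x \<bullet> u) ` F"] unfolding hmax_def by fastforce

lemma hull_inner_le:
  fixes u :: "'a::real_inner"
  assumes "y \<in> convex hull S" "\<And>x. x \<in> S \<Longrightarrow> x \<bullet> u \<le> c"
  shows "y \<bullet> u \<le> c"
proof -
  have "convex hull S \<subseteq> {x. x \<bullet> u \<le> c}"
    by (rule hull_minimal) (use assms(2) convex_halfspace_le[of u c] in \<open>auto simp: inner_commute\<close>)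
  then show ?thesis using assms(1) by auto
qed

lemma hmax_continuous: "finite F \<Longrightarrow> F \<noteq> {} \<Longrightarrow> continuous_on A (hmax F)"
proof (induction F rule: finite_ne_induct)
  case (singleton x)
  then show ?case by (simp add: hmax_def continuous_intros)
next
  case (insert x F)
  have "hmax (insert x F) = (\<lambda>u. max (x \<bullet> u) (hmax F u))"
    using insert by (auto simp: hmax_def fun_eq_iff)
  then show ?case using insert by (auto intro!: continuous_intros)
qed

lemma hmax_measurable [measurable]:
  fixes F :: "'a::euclidean_space set"
  shows "finite F \<Longrightarrow> F \<noteq> {} \<Longrightarrow> hmax F \<in> borel_measurable borel"
  by (rule borel_measurable_continuous_onI) (rule hmax_continuous)

subsection \<open>Integration over the unit circle\<close>

text \<open>Arc length on the unit circle, encoded as a finite Borel measure on the whole plane so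
  that rotations and reflections act on it through \<open>distr\<close>.\<close>

definition circ :: "complex measure" where
  "circ = distr (restrict_space lborel {0..<2*pi}) borel cis"

lemma cis_measurable [measurable]: "cis \<in> borel_measurable borel"
  by (intro borel_measurable_continuous_onI continuous_intros)

lemma sets_circ [simp, measurable_cong]: "sets circ = sets borel" by (simp add: circ_def)
lemma space_circ [simp]: "space circ = UNIV" by (simp add: circ_def)

lemma cis_measurable' [measurable]: "cis \<in> measurable (restrict_space lborel {0..<2*pi}) borel"
  by (rule measurable_restrict_space1) simp

lemma circ_total: "emeasure circ UNIV = ennreal (2*pi)"
  by (subst circ_def, subst emeasure_distr)
     (auto simp: emeasure_restrict_space space_restrict_space)

lemma finite_circ: "finite_measure circ"
  by (rule finite_measureI) (simp add: circ_total)

lemma AE_circ: "(AE u in circ. P u) \<longleftrightarrow> (AE t in lborel. t \<in> {0..<2*pi} \<longrightarrow> P (cis t))"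
  if [measurable]: "Measurable.pred borel P"
  unfolding circ_def by (subst AE_distr_iff) (auto simp: AE_restrict_space_iff)

lemma AE_circ_norm: "AE u in circ. norm u = 1"
  by (subst AE_circ) auto

lemma integral_circ:
  fixes f :: "complex \<Rightarrow> real"
  assumes [measurable]: "f \<in> borel_measurable borel"
  shows "(\<integral>u. f u \<partial>circ) = (\<integral>t. indicator {0..<2*pi} t * f (cis t) \<partial>lborel)"
  unfolding circ_def
  by (subst integral_distr) (auto simp: integral_restrict_space set_lebesgue_integral_def)

lemma integrable_circI:
  fixes f :: "complex \<Rightarrow> real"
  assumes [measurable]: "f \<in> borel_measurable borel" and "\<And>u. norm u = 1 \<Longrightarrow> \<bar>f u\<bar> \<le> C"
  shows "integrable circ f"
proof -
  interpret finite_measure circ by (rule finite_circ)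
  show ?thesis
    by (rule integrable_const_bound[where B = C]) (use assms(2) AE_circ_norm in \<open>auto elim!: eventually_mono\<close>)
qed

lemma integrable_circ_continuous:
  fixes f :: "complex \<Rightarrow> real"
  assumes "continuous_on UNIV f"
  shows "integrable circ f"
proof -
  have "compact (f ` sphere 0 1)"
    using assms by (intro compact_continuous_image) (auto intro: continuous_on_subset)
  then obtain C where "\<forall>x\<in>f ` sphere 0 1. norm x \<le> C"
    using compact_imp_bounded[of "f ` sphere 0 1"] unfolding bounded_iff by blast
  then have "\<And>u. norm u = 1 \<Longrightarrow> \<bar>f u\<bar> \<le> C" by auto
  then show ?thesis
    by (intro integrable_circI borel_measurable_continuous_onI assms) auto
qed

lemma nn_integral_circ:
  assumes [measurable]: "f \<in> borel_measurable borel"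
  shows "(\<integral>\<^sup>+u. f u \<partial>circ) = (\<integral>\<^sup>+t. f (cis t) * indicator {0..<2*pi} t \<partial>lborel)"
  unfolding circ_def
  by (subst nn_integral_distr) (auto simp: nn_integral_restrict_space)

text \<open>Rotation by the angle \<open>a\<close> moves the range of angles to [a, a + 2 pi); the
  overhang beyond 2 pi is brought back by one period.\<close>

lemma nn_integral_circ_mult:
  assumes [measurable]: "f \<in> borel_measurable borel" and e: "norm e = 1"
  shows "(\<integral>\<^sup>+u. f (e * u) \<partial>circ) = (\<integral>\<^sup>+u. f u \<partial>circ)"
proof -
  obtain a where a: "0 \<le> a" "a < 2*pi" "e = cis a"
    using Arg2pi[of e] e that[of "Arg2pi e"] by (auto simp: is_Arg_def cis_conv_exp)
  have "(\<integral>\<^sup>+u. f (e * u) \<partial>circ) = (\<integral>\<^sup>+t. f (cis (a + t)) * indicator {0..<2*pi} t \<partial>lborel)"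
    by (subst nn_integral_circ) (auto simp: a cis_mult)
  also have "\<dots> = (\<integral>\<^sup>+t. (\<lambda>s. f (cis s) * indicator {a..<a+2*pi} s) (a + 1 * t) \<partial>lborel)"
    by (intro nn_integral_cong) (auto simp: indicator_def)
  also have "\<dots> = (\<integral>\<^sup>+s. f (cis s) * indicator {a..<a+2*pi} s \<partial>lborel)"
    by (subst nn_integral_real_affine[where c=1 and t=a]) auto
  also have "\<dots> = (\<integral>\<^sup>+s. f (cis s) * indicator {a..<2*pi} s + f (cis s) * indicator {2*pi..<a+2*pi} s \<partial>lborel)"
    using a by (intro nn_integral_cong) (auto simp: indicator_def)
  also have "\<dots> = (\<integral>\<^sup>+s. f (cis s) * indicator {a..<2*pi} s \<partial>lborel) + (\<integral>\<^sup>+s. f (cis s) * indicator {2*pi..<a+2*pi} s \<partial>lborel)"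
    by (subst nn_integral_add) auto
  also have "(\<integral>\<^sup>+s. f (cis s) * indicator {2*pi..<a+2*pi} s \<partial>lborel)
      = (\<integral>\<^sup>+s. f (cis (2*pi + 1 * s)) * indicator {2*pi..<a+2*pi} (2*pi + 1 * s) \<partial>lborel)"
    by (subst nn_integral_real_affine[where c=1 and t="2*pi"]) auto
  also have "\<dots> = (\<integral>\<^sup>+s. f (cis s) * indicator {0..<a} s \<partial>lborel)"
    by (intro nn_integral_cong) (auto simp: indicator_def complex_eq_iff sin_add cos_add intro!: arg_cong[where f=f])
  also have "(\<integral>\<^sup>+s. f (cis s) * indicator {a..<2*pi} s \<partial>lborel) + (\<integral>\<^sup>+s. f (cis s) * indicator {0..<a} s \<partial>lborel)
     = (\<integral>\<^sup>+s. f (cis s) * indicator {a..<2*pi} s + f (cis s) * indicator {0..<a} s \<partial>lborel)"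
    by (subst nn_integral_add) auto
  also have "\<dots> = (\<integral>\<^sup>+t. f (cis t) * indicator {0..<2*pi} t \<partial>lborel)"
    using a by (intro nn_integral_cong) (auto simp: indicator_def)
  finally show ?thesis by (simp add: nn_integral_circ)
qed

lemma circ_mult: "norm e = 1 \<Longrightarrow> distr circ borel (\<lambda>u. e * u) = circ"
proof (rule measure_eqI)
  fix A assume e: "norm e = 1" and "A \<in> sets (distr circ borel (\<lambda>u. e * u))"
  then have [measurable]: "A \<in> sets borel" by simp
  have "emeasure (distr circ borel (\<lambda>u. e * u)) A = (\<integral>\<^sup>+u. indicator A u \<partial>distr circ borel (\<lambda>u. e * u))"
    by simp
  also have "\<dots> = (\<integral>\<^sup>+u. indicator A (e * u) \<partial>circ)"
    by (subst nn_integral_distr) auto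
  also have "\<dots> = emeasure circ A"
    using e by (subst nn_integral_circ_mult[of "indicator A"]) auto
  finally show "emeasure (distr circ borel (\<lambda>u. e * u)) A = emeasure circ A" .
qed simp

lemma circ_cnj: "distr circ borel cnj = circ"
proof (rule measure_eqI)
  fix A assume "A \<in> sets (distr circ borel cnj)"
  then have [measurable]: "A \<in> sets borel" by simp
  have [measurable]: "cnj \<in> borel_measurable borel"
    by (intro borel_measurable_continuous_onI continuous_intros)
  have cis_eq: "cis (t - 2*pi) = cis t" for t by (simp add: complex_eq_iff sin_diff cos_diff)
  have "emeasure (distr circ borel cnj) A = (\<integral>\<^sup>+u. indicator A u \<partial>distr circ borel cnj)"
    by simp
  also have "\<dots> = (\<integral>\<^sup>+t. indicator A (cis (- t)) * indicator {0..<2*pi} t \<partial>lborel)"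
    by (subst nn_integral_distr) (auto simp: nn_integral_circ cis_cnj)
  also have "\<dots> = (\<integral>\<^sup>+t. indicator A (cis (- (2*pi + (-1) * t))) * indicator {0..<2*pi} (2*pi + (-1) * t) \<partial>lborel)"
    by (subst nn_integral_real_affine[where c="-1" and t="2*pi"]) auto
  also have "\<dots> = (\<integral>\<^sup>+t. indicator A (cis t) * indicator {0<..2*pi} t \<partial>lborel)"
    by (intro nn_integral_cong) (auto simp: indicator_def cis_eq)
  \<comment> \<open>The reflection exchanges the closed and the open end of the interval of angles,
    so the integrands differ only at the two end points.\<close>
  also have "\<dots> = (\<integral>\<^sup>+t. indicator A (cis t) * indicator {0..<2*pi} t \<partial>lborel)"
  proof (rule nn_integral_cong_AE)
    have "AE t in lborel. t \<noteq> 0 \<and> t \<noteq> 2*pi"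
      using AE_lborel_singleton[of "0::real"] AE_lborel_singleton[of "2*pi"] by eventually_elim auto
    then show "AE t in lborel. (indicator A (cis t) * indicator {0<..2*pi} t :: ennreal) = indicator A (cis t) * indicator {0..<2*pi} t"
      by eventually_elim (auto simp: indicator_def)
  qed
  also have "\<dots> = emeasure circ A"
    by (subst nn_integral_circ[symmetric]) auto
  finally show "emeasure (distr circ borel cnj) A = emeasure circ A" .
qed simp

text \<open>An orthonormal frame of the plane arises from the standard one by a rotation, possibly
  after a reflection, and \<open>circ\<close> is invariant under both. This permits coordinates
  adapted to an edge of the path.\<close>

lemma integral_circ_frame:
  fixes f :: "complex \<Rightarrow> real"
  assumes [measurable]: "f \<in> borel_measurable borel" and e: "norm e = 1" and w: "w = \<i> * e \<or> w = - \<i> * e"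
  shows "(\<integral>u. f u \<partial>circ) = (\<integral>u. f (Re u *\<^sub>R e + Im u *\<^sub>R w) \<partial>circ)"
proof -
  have 1: "(\<integral>u. f u \<partial>circ) = (\<integral>u. f (e * u) \<partial>circ)"
    by (subst circ_mult[OF e, symmetric], subst integral_distr) auto
  have [measurable]: "cnj \<in> borel_measurable borel"
    by (intro borel_measurable_continuous_onI continuous_intros)
  have 2: "(\<integral>u. f (e * u) \<partial>circ) = (\<integral>u. f (e * cnj u) \<partial>circ)"
    by (subst circ_cnj[symmetric], subst integral_distr) auto
  have 3: "Re u *\<^sub>R e + Im u *\<^sub>R (\<i> * e) = e * u" "Re u *\<^sub>R e + Im u *\<^sub>R (- \<i> * e) = e * cnj u" for u
    by (auto simp: complex_eq_iff algebra_simps)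
  from w show ?thesis using 1 2 3 by auto
qed

lemma has_bochner_integral_cos:
  "a \<le> b \<Longrightarrow> has_bochner_integral lborel (\<lambda>t. cos (t::real) * indicator {a..b} t) (sin b - sin a)"
  by (rule has_bochner_integral_FTC_Icc_real) (auto intro!: derivative_eq_intros)

text \<open>The constant of Crofton's formula in the plane: a frame with first axis along
  \<open>z\<close> leaves the integral of |cos| over a period, to which each quarter period
  contributes 1.\<close>

lemma integral_circ_abs_inner: "(\<integral>u. \<bar>z \<bullet> u\<bar> \<partial>circ) = 4 * norm z"
proof (cases "z = 0")
  case False
  define e where "e = sgn z"
  have e: "norm e = 1" using False by (simp add: e_def norm_sgn)
  have z: "z = norm z *\<^sub>R e" using False by (simp add: e_def sgn_div_norm)
  have ze: "z \<bullet> e = norm z" by (subst z) (use e in \<open>simp add: dot_square_norm\<close>)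
  have zi: "z \<bullet> (\<i> * e) = 0" by (subst z) (simp only: inner_scaleR_left, simp add: inner_complex_def)
  have "(\<integral>u. \<bar>z \<bullet> u\<bar> \<partial>circ) = (\<integral>u. \<bar>z \<bullet> (Re u *\<^sub>R e + Im u *\<^sub>R (\<i> * e))\<bar> \<partial>circ)"
    by (rule integral_circ_frame) (auto simp: e)
  also have "\<dots> = (\<integral>u. norm z * \<bar>Re u\<bar> \<partial>circ)"
    by (simp add: inner_add_right ze zi abs_mult mult.commute)
  also have "\<dots> = norm z * (\<integral>u. \<bar>Re u\<bar> \<partial>circ)" by simp
  also have "(\<integral>u. \<bar>Re u\<bar> \<partial>circ) = (\<integral>t. indicator {0..<2*pi} t * \<bar>cos t\<bar> \<partial>lborel)"
    by (subst integral_circ) auto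
  also have "\<dots> = (\<integral>t. cos t * indicator {0..pi/2} t - cos t * indicator {pi/2..3*pi/2} t
      + cos t * indicator {3*pi/2..2*pi} t \<partial>lborel)"
  proof (rule integral_cong_AE)
    have "AE t in lborel. t \<noteq> pi/2 \<and> t \<noteq> 3*pi/2 \<and> t \<noteq> 2*pi"
      using AE_lborel_singleton[of "pi/2"] AE_lborel_singleton[of "3*pi/2"] AE_lborel_singleton[of "2*pi"]
      by eventually_elim auto
    then show "AE t in lborel. indicator {0..<2*pi} t * \<bar>cos t\<bar> =
      cos t * indicator {0..pi/2} t - cos t * indicator {pi/2..3*pi/2} t + cos t * indicator {3*pi/2..2*pi} t"
    proof eventually_elim
      case (elim t)
      have "cos t \<le> 0" if "pi/2 \<le> t" "t \<le> 3*pi/2"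
        using that cos_ge_zero[of "t - pi"] by (simp add: cos_diff)
      moreover have "0 \<le> cos t" if "0 \<le> t" "t \<le> pi/2" using that by (intro cos_ge_zero) auto
      moreover have "0 \<le> cos t" if "3*pi/2 \<le> t" "t \<le> 2*pi"
        using that cos_ge_zero[of "t - 2*pi"] by (simp add: cos_diff)
      ultimately show ?case using elim by (auto simp: indicator_def)
    qed
  qed auto
  also have "\<dots> = (sin (pi/2) - sin 0) - (sin (3*pi/2) - sin (pi/2)) + (sin (2*pi) - sin (3*pi/2))"
    by (intro has_bochner_integral_integral_eq has_bochner_integral_add has_bochner_integral_diff
        has_bochner_integral_cos) auto
  also have "\<dots> = 4"
    using sin_periodic_pi[of "pi/2"] by simp
  finally show ?thesis by simp
qed simp

lemma integral_circ_plen: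
  "integrable circ (\<lambda>u. plen (map (\<lambda>x. x \<bullet> u) xs)) \<and> (\<integral>u. plen (map (\<lambda>x. x \<bullet> u) xs) \<partial>circ) = 4 * plen xs"
proof (induction xs rule: plen.induct)
  case (3 x y zs)
  have i: "integrable circ (\<lambda>u. \<bar>(x - y) \<bullet> u\<bar>)"
    by (intro integrable_circ_continuous continuous_intros)
  have "plen (map (\<lambda>x. x \<bullet> u) (x # y # zs)) = \<bar>(x - y) \<bullet> u\<bar> + plen (map (\<lambda>x. x \<bullet> u) (y # zs))" for u
    by (simp add: dist_real_def inner_diff_left)
  then show ?case using i 3 integral_circ_abs_inner[of "x - y"] by (simp add: dist_norm)
qed auto

lemma integral_circ_minus:
  fixes f :: "complex \<Rightarrow> real"
  assumes [measurable]: "f \<in> borel_measurable borel"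
  shows "(\<integral>u. f (- u) \<partial>circ) = (\<integral>u. f u \<partial>circ)"
  using circ_mult[of "-1"] integral_distr[of "\<lambda>u. - 1 * u" circ borel f] by simp

lemma integrable_hmax_circ: "finite F \<Longrightarrow> F \<noteq> {} \<Longrightarrow> integrable circ (hmax F)"
  by (intro integrable_circ_continuous hmax_continuous)

text \<open>In every direction the closed polygon runs over its own width at least twice.
  Integration over the circle counts \<open>hmax\<close> twice in the width, by the symmetry under
  \<open>u \<mapsto> - u\<close>, and \<open>plen\<close> four times in the projected length, so the
  factors cancel.\<close>

lemma hmax_closed_polygon:
  assumes "zs \<noteq> []"
  shows "(\<integral>u. hmax (set zs) u \<partial>circ) \<le> plen (zs @ [hd zs])"
proof -
  let ?h = "hmax (set zs)"
  have [measurable]: "?h \<in> borel_measurable borel" using assms by (intro hmax_measurable) auto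
  have i: "integrable circ ?h" using assms by (intro integrable_hmax_circ) auto
  have i': "integrable circ (\<lambda>u. ?h (- u))"
    using assms by (intro integrable_circ_continuous continuous_on_compose2[OF hmax_continuous[of _ UNIV]] continuous_intros) auto
  have pt: "2 * (?h u + ?h (- u)) \<le> plen (map (\<lambda>x. x \<bullet> u) (zs @ [hd zs]))" for u
  proof -
    obtain x where x: "x \<in> set zs" "?h u = x \<bullet> u" using hmax_attained[of "set zs" u] assms by auto
    obtain y where y: "y \<in> set zs" "?h (- u) = y \<bullet> (- u)" using hmax_attained[of "set zs" "- u"] assms by auto
    have "2 * dist (x \<bullet> u) (y \<bullet> u) \<le> plen (map (\<lambda>x. x \<bullet> u) zs @ [hd (map (\<lambda>x. x \<bullet> u) zs)])"
      by (rule twice_dist_le_closed_plen) (use x y in auto)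
    moreover have "x \<bullet> u - y \<bullet> u \<le> dist (x \<bullet> u) (y \<bullet> u)" by (simp add: dist_real_def)
    ultimately show ?thesis using x y assms by (simp add: hd_map)
  qed
  have "(\<integral>u. 2 * (?h u + ?h (- u)) \<partial>circ) \<le> (\<integral>u. plen (map (\<lambda>x. x \<bullet> u) (zs @ [hd zs])) \<partial>circ)"
    by (rule integral_mono) (use i i' integral_circ_plen[of "zs @ [hd zs]"] pt in auto)
  then show ?thesis
    using i i' integral_circ_plen[of "zs @ [hd zs]"] integral_circ_minus[of ?h] by simp
qed

lemma plen_snoc: "xs \<noteq> [] \<Longrightarrow> plen (xs @ [y]) = plen xs + dist (last xs) y"
  by (induction xs rule: plen.induct) auto

lemma plen_remove: "plen (as @ bs) \<le> plen (as @ x # bs)"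
proof (induction as)
  case Nil
  then show ?case by (cases bs) auto
next
  case (Cons a as)
  show ?case
  proof (cases as)
    case Nil
    then show ?thesis using dist_triangle[of a _ x] by (cases bs) auto
  next
    case (Cons a' as')
    then show ?thesis using Cons.IH by simp
  qed
qed

lemma plen_sum: "plen xs = (\<Sum>i<length xs - 1. dist (xs ! i) (xs ! Suc i))"
proof (induction xs rule: plen.induct)
  case (3 x y zs)
  have "(\<Sum>i<Suc (length zs). dist ((x # y # zs) ! i) ((x # y # zs) ! Suc i))
    = dist x y + (\<Sum>i<length zs. dist ((y # zs) ! i) ((y # zs) ! Suc i))"
    by (subst sum.lessThan_Suc_shift) simp
  then show ?case using 3 by simp
qed auto

text \<open>Repeating the last vertex lets shorter lists compete with lists of a fixed number of
  vertices.\<close>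

lemma plen_pad: "xs \<noteq> [] \<Longrightarrow> plen (xs @ replicate n (last xs)) = plen xs"
proof (induction n)
  case (Suc n)
  have *: "replicate (Suc n) (last xs) = replicate n (last xs) @ [last xs]"
    by (simp add: replicate_append_same)
  obtain ys where ys: "xs @ replicate n (last xs) = ys @ [last xs]"
  proof (rule that[of "butlast (xs @ replicate n (last xs))"])
    have "last (xs @ replicate n (last xs)) = last xs" by (cases n) auto
    then show "xs @ replicate n (last xs) = butlast (xs @ replicate n (last xs)) @ [last xs]"
      using append_butlast_last_id[of "xs @ replicate n (last xs)"] Suc(2) by simp
  qed
  have "plen (xs @ replicate (Suc n) (last xs)) = plen (ys @ last xs # [last xs])"
    using ys by (simp only: * append_assoc[symmetric]) simp
  also have "\<dots> = plen (xs @ replicate n (last xs))" using plen_append[of ys "last xs" "[last xs]"] ys by simp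
  finally show ?case using Suc by simp
qed simp

subsection \<open>Shortest covering polygons\<close>

definition covers :: "'a::real_vector set \<Rightarrow> 'a list \<Rightarrow> bool" where
  "covers F xs \<longleftrightarrow> F \<subseteq> convex hull (set xs)"

text \<open>Taking the fewest vertices among the shortest paths makes every vertex an extreme point of the hull.\<close>
definition optimal :: "'a::real_normed_vector set \<Rightarrow> 'a list \<Rightarrow> bool" where
  "optimal F xs \<longleftrightarrow> covers F xs \<and> (\<forall>ys. covers F ys \<and> length ys \<le> length xs \<longrightarrow> plen xs \<le> plen ys)
     \<and> (\<forall>ys. covers F ys \<and> length ys < length xs \<longrightarrow> plen xs < plen ys)"

text \<open>Bolzano-Weierstrass one index at a time. The indexed form serves both vertices of paths
  and, later, coefficients of Steiner polynomials.\<close>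

lemma bounded_lists_convergent_subseq:
  fixes X :: "nat \<Rightarrow> nat \<Rightarrow> 'a::euclidean_space"
  assumes "\<And>k i. i < n \<Longrightarrow> norm (X k i) \<le> C"
  shows "\<exists>r l. strict_mono (r::nat\<Rightarrow>nat) \<and> (\<forall>i<n. (\<lambda>k. X (r k) i) \<longlonglongrightarrow> l i)"
  using assms
proof (induction n)
  case 0
  show ?case by (rule exI[of _ id]) (auto simp: strict_mono_def)
next
  case (Suc n)
  then obtain r l where r: "strict_mono (r::nat\<Rightarrow>nat)" "\<forall>i<n. (\<lambda>k. X (r k) i) \<longlonglongrightarrow> l i"
    by (metis less_Suc_eq)
  have "bounded (range (\<lambda>k. X (r k) n))" using Suc.prems by (auto simp: bounded_iff)
  then obtain a s where s: "strict_mono (s::nat\<Rightarrow>nat)" "((\<lambda>k. X (r k) n) \<circ> s) \<longlonglongrightarrow> a"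
    using bounded_imp_convergent_subsequence by metis
  show ?case
  proof (intro exI[of _ "r \<circ> s"] exI[of _ "l(n := a)"] conjI allI impI)
    show "strict_mono (r \<circ> s)" using r s by (simp add: strict_mono_o)
    fix i assume "i < Suc n"
    show "(\<lambda>k. X ((r \<circ> s) k) i) \<longlonglongrightarrow> (l(n := a)) i"
    proof (cases "i = n")
      case True then show ?thesis using s by (simp add: o_def)
    next
      case False
      then have "i < n" using \<open>i < Suc n\<close> by simp
      then show ?thesis using LIMSEQ_subseq_LIMSEQ[OF r(2)[rule_format] s(1), of i] False by (simp add: o_def)
    qed
  qed
qed

text \<open>A minimising sequence stays bounded: its paths have bounded length and their hulls all
  contain a fixed point of \<open>F\<close>. Hence the vertices converge along a subsequence, and
  the length passes to the limit.\<close>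

lemma exists_shortest_covering:
  fixes F :: "'a::euclidean_space set"
  assumes F: "F \<noteq> {}" and n: "n \<ge> 1" and ex: "\<exists>xs. covers F xs \<and> length xs = n"
  shows "\<exists>xs. covers F xs \<and> length xs = n \<and> (\<forall>ys. covers F ys \<and> length ys = n \<longrightarrow> plen xs \<le> plen ys)"
proof -
  let ?A = "{xs. covers F xs \<and> length xs = n}"
  define I where "I = Inf (plen ` ?A)"
  have ne: "?A \<noteq> {}" using ex by auto
  have bdd: "bdd_below (plen ` ?A)" by (intro bdd_belowI2[of _ 0]) (simp add: plen_nonneg)
  have "\<exists>xs\<in>?A. plen xs < I + 1 / real (Suc k)" for k
    using cInf_lessD[of "plen ` ?A" "I + 1 / real (Suc k)"] ne by (auto simp: I_def[symmetric])
  then have "\<forall>k. \<exists>xs. covers F xs \<and> length xs = n \<and> plen xs < I + 1 / real (Suc k)" by blast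
  then obtain X where "\<forall>k. covers F (X k) \<and> length (X k) = n \<and> plen (X k) < I + 1 / real (Suc k)"
    by (rule choice[THEN exE])
  then have X: "\<And>k. covers F (X k)" "\<And>k. length (X k) = n" "\<And>k. plen (X k) < I + 1 / real (Suc k)"
    by auto
  obtain x where x: "x \<in> F" using F by auto
  have I0: "0 \<le> I" unfolding I_def using ne plen_nonneg by (intro cInf_greatest) auto
  have bd: "norm (X k ! i) \<le> norm x + (I + 1)" if "i < n" for k i
  proof -
    have "set (X k) \<subseteq> cball (X k ! i) (I + 1)"
    proof
      fix y assume y: "y \<in> set (X k)"
      have "2 * dist (X k ! i) y \<le> plen (X k @ [hd (X k)])"
        by (rule twice_dist_le_closed_plen) (use y that X in auto)
      also have "\<dots> = plen (X k) + dist (last (X k)) (hd (X k))"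
        using y by (intro plen_snoc) auto
      also have "\<dots> \<le> 2 * plen (X k)" using dist_hd_last_le_plen[of "X k"] y by (cases "X k = []") (auto simp: dist_commute)
      finally have "dist (X k ! i) y \<le> plen (X k)" by simp
      moreover have "1 / real (Suc k) \<le> 1" by simp
      ultimately have "dist (X k ! i) y \<le> I + 1" using X(3)[of k] by linarith
      then show "y \<in> cball (X k ! i) (I + 1)" by simp
    qed
    then have "convex hull (set (X k)) \<subseteq> cball (X k ! i) (I + 1)" by (rule hull_minimal) auto
    then have "dist (X k ! i) x \<le> I + 1" using X(1)[of k] x by (auto simp: covers_def)
    then have "norm (X k ! i - x) \<le> I + 1" by (simp add: dist_norm)
    then show ?thesis using norm_triangle_sub[of "X k ! i" x] by linarith
  qed
  obtain r l where r: "strict_mono (r::nat\<Rightarrow>nat)" "\<And>i. i < n \<Longrightarrow> (\<lambda>k. X (r k) ! i) \<longlonglongrightarrow> l i"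
    using bounded_lists_convergent_subseq[of n "\<lambda>k i. X k ! i", OF bd] by blast
  define ls where "ls = map l [0..<n]"
  have ls: "length ls = n" "\<And>i. i < n \<Longrightarrow> ls ! i = l i" by (auto simp: ls_def)
  have "covers F ls"
    unfolding covers_def
  proof
    fix y assume y: "y \<in> F"
    show "y \<in> convex hull (set ls)"
    proof (rule ccontr)
      assume "y \<notin> convex hull (set ls)"
      then obtain a b where ab: "a \<bullet> y < b" "\<And>x. x \<in> convex hull (set ls) \<Longrightarrow> b < a \<bullet> x"
        using separating_hyperplane_closed_point[of "convex hull (set ls)" y]
        by (auto simp: finite_imp_compact_convex_hull compact_imp_closed)
      \<comment> \<open>Strict separation of \<open>y\<close> from the limit hull is an open
        condition on finitely many vertices, so it would already hold for some path of the sequence,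
        which covers \<open>y\<close>.\<close>
      have "\<forall>\<^sub>F k in sequentially. \<forall>i\<in>{..<n}. b < a \<bullet> (X (r k) ! i)"
      proof (rule eventually_ball_finite, simp, intro ballI)
        fix i assume "i \<in> {..<n}"
        then have "l i \<in> set ls" by (auto simp: ls_def)
        then have "b < a \<bullet> l i" by (intro ab(2) hull_inc)
        moreover have "(\<lambda>k. a \<bullet> (X (r k) ! i)) \<longlonglongrightarrow> a \<bullet> l i"
          using r(2) \<open>i \<in> {..<n}\<close> by (intro tendsto_intros) auto
        ultimately show "\<forall>\<^sub>F k in sequentially. b < a \<bullet> (X (r k) ! i)" by (rule order_tendstoD(1)[rotated])
      qed
      then obtain k where k: "\<And>i. i < n \<Longrightarrow> b < a \<bullet> (X (r k) ! i)" by (auto simp: eventually_sequentially)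
      have "y \<in> convex hull (set (X (r k)))" using X(1) y by (auto simp: covers_def)
      then have "y \<bullet> (- a) \<le> - b"
      proof (rule hull_inner_le)
        fix x assume "x \<in> set (X (r k))"
        then obtain i where "i < n" "x = X (r k) ! i" using X(2) by (auto simp: in_set_conv_nth)
        then have "b < a \<bullet> x" using k by simp
        then show "x \<bullet> (- a) \<le> - b" by (simp add: inner_commute)
      qed
      then show False using ab(1) by (simp add: inner_commute)
    qed
  qed
  moreover have "plen ls \<le> I"
  proof -
    have "(\<lambda>k. plen (X (r k))) \<longlonglongrightarrow> plen ls"
      unfolding plen_sum ls X(2)
      by (intro tendsto_sum tendsto_dist) (use ls r(2) in auto)
    moreover have "(\<lambda>k. I + 1 / real (Suc (r k))) \<longlonglongrightarrow> I + 0"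
    proof (intro tendsto_add tendsto_const)
      have "(\<lambda>k. 1 / real (Suc k)) \<longlonglongrightarrow> 0" by (rule LIMSEQ_Suc[OF lim_1_over_n])
      from LIMSEQ_subseq_LIMSEQ[OF this r(1)] show "(\<lambda>k. 1 / real (Suc (r k))) \<longlonglongrightarrow> 0" by (simp add: o_def)
    qed
    ultimately have "plen ls \<le> I + 0" by (rule LIMSEQ_le) (use X(3) in \<open>auto intro: less_imp_le\<close>)
    then show ?thesis by simp
  qed
  moreover have "I \<le> plen ys" if "covers F ys" "length ys = n" for ys
    unfolding I_def using that bdd by (intro cInf_lower) auto
  ultimately show ?thesis using ls(1) by (intro exI[of _ ls]) (auto intro: order_trans)
qed

lemma exists_optimal:
  fixes F :: "'a::euclidean_space set"
  assumes F: "F \<noteq> {}" and c: "covers F xs0"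
  shows "\<exists>xs. optimal F xs \<and> plen xs \<le> plen xs0"
proof -
  define N where "N = length xs0"
  have ne: "ys \<noteq> []" if "covers F ys" for ys using that F by (auto simp: covers_def)
  have "N \<ge> 1" using ne[OF c] by (cases xs0) (auto simp: N_def)
  then obtain zs where zs: "covers F zs" "length zs = N" "\<And>ys. covers F ys \<Longrightarrow> length ys = N \<Longrightarrow> plen zs \<le> plen ys"
    using exists_shortest_covering[OF F, of N] c by (auto simp: N_def)
  have min: "plen zs \<le> plen ys" if "covers F ys" "length ys \<le> N" for ys
  proof -
    have "covers F (ys @ replicate (N - length ys) (last ys))"
      using that(1) hull_mono[of "set ys" "set (ys @ replicate (N - length ys) (last ys))" convex]
      unfolding covers_def by fastforce
    from zs(3)[OF this] show ?thesis using that plen_pad[OF ne[OF that(1)]] by simp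
  qed
  \<comment> \<open>The least number of vertices with which the minimal length can be reached; a
    still shorter list is then strictly longer as a path.\<close>
  define P where "P n \<longleftrightarrow> (\<exists>xs. covers F xs \<and> length xs = n \<and> plen xs \<le> plen zs)" for n
  define n where "n = (LEAST n. P n)"
  have "P N" using zs by (auto simp: P_def)
  then have "P n" "n \<le> N" unfolding n_def by (auto intro: LeastI Least_le)
  then obtain xs where xs: "covers F xs" "length xs = n" "plen xs \<le> plen zs" by (auto simp: P_def)
  have "plen xs < plen ys" if "covers F ys" "length ys < n" for ys
  proof (rule ccontr)
    assume "\<not> plen xs < plen ys"
    then have "P (length ys)" using that xs by (auto simp: P_def)
    then show False using that not_less_Least[of "length ys" P] by (simp add: n_def)
  qed
  then have "optimal F xs"
    unfolding optimal_def using xs min \<open>n \<le> N\<close> by (meson order_trans)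
  moreover have "plen xs \<le> plen xs0" using xs min[OF c] by (simp add: N_def)
  ultimately show ?thesis by blast
qed

lemma optimal_rev: "optimal F xs \<Longrightarrow> optimal F (rev xs)"
  by (auto simp: optimal_def covers_def plen_rev)

text \<open>Such a vertex could be deleted: the hull stays the same and the triangle inequality
  keeps the length from growing, while the number of vertices drops, against the strict clause of
  \<open>optimal\<close>.\<close>

lemma optimal_not_in_hull:
  assumes "optimal F (as @ x # bs)"
  shows "x \<notin> convex hull (set (as @ bs))"
proof
  assume "x \<in> convex hull (set (as @ bs))"
  then have "set (as @ x # bs) \<subseteq> convex hull (set (as @ bs))" using hull_subset[of "set (as @ bs)" convex] by auto
  then have "convex hull (set (as @ x # bs)) \<subseteq> convex hull (set (as @ bs))" by (rule hull_minimal) auto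
  then have "covers F (as @ bs)" using assms by (auto simp: optimal_def covers_def)
  then have "plen (as @ x # bs) < plen (as @ bs)" using assms by (auto simp: optimal_def)
  then show False using plen_remove[of as bs x] by simp
qed

lemma optimal_distinct:
  assumes "optimal F xs" shows "distinct xs"
proof (rule ccontr)
  assume "\<not> distinct xs"
  then obtain as bs cs x where "xs = as @ [x] @ bs @ [x] @ cs" using not_distinct_decomp by blast
  then have "optimal F (as @ x # (bs @ x # cs))" using assms by simp
  from optimal_not_in_hull[OF this] show False by (auto intro: hull_inc)
qed

lemma optimal_extreme:
  assumes "optimal F xs" "x \<in> set xs" "S \<subseteq> set xs" "x \<notin> S" shows "x \<notin> convex hull S"
proof -
  obtain as bs where xs: "xs = as @ x # bs" using assms(2) by (auto simp: in_set_conv_decomp)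
  have "x \<notin> convex hull (set (as @ bs))" using optimal_not_in_hull assms(1) xs by blast
  moreover have "S \<subseteq> set (as @ bs)" using assms(3,4) xs by auto
  ultimately show ?thesis using hull_mono[of S "set (as @ bs)" convex] by blast
qed

section \<open>Determinants and convex position in the plane\<close>

definition crs :: "complex \<Rightarrow> complex \<Rightarrow> real" where
  "crs z w = Re z * Im w - Im z * Re w"

lemma crs_self [simp]: "crs z z = 0" by (simp add: crs_def)
lemma crs_zero [simp]: "crs z 0 = 0" "crs 0 z = 0" by (simp_all add: crs_def)
lemma crs_scale: "crs (a *\<^sub>R z) w = a * crs z w" "crs z (a *\<^sub>R w) = a * crs z w"
  by (simp_all add: crs_def algebra_simps)
lemma crs_add: "crs (x + y) w = crs x w + crs y w" "crs w (x + y) = crs w x + crs w y"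
  by (simp_all add: crs_def algebra_simps)
lemma crs_swap: "crs z w = - crs w z" by (simp add: crs_def)

lemma crs_eq_0_imp:
  assumes "crs u w = 0" "u \<noteq> 0" shows "w = ((w \<bullet> u) / (u \<bullet> u)) *\<^sub>R u"
proof -
  have "u \<bullet> u > 0" using assms by simp
  moreover have "(u \<bullet> u) *\<^sub>R w = (w \<bullet> u) *\<^sub>R u"
    using assms(1) unfolding complex_eq_iff crs_def inner_complex_def
    by (simp, algebra)
  ultimately show ?thesis
    by (metis divide_inverse_commute inverse_eq_divide less_numeral_extra(3) scaleR_scaleR scaleR_one left_inverse)
qed

text \<open>Cramer's rule.\<close>

lemma crs_basis:
  assumes "crs A B \<noteq> 0"
  shows "x = (crs x B / crs A B) *\<^sub>R A + (crs A x / crs A B) *\<^sub>R B"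
proof -
  have "crs A B *\<^sub>R x = crs x B *\<^sub>R A + crs A x *\<^sub>R B"
    unfolding complex_eq_iff crs_def by (simp, algebra)
  then have "inverse (crs A B) *\<^sub>R (crs A B *\<^sub>R x) = inverse (crs A B) *\<^sub>R (crs x B *\<^sub>R A + crs A x *\<^sub>R B)" by simp
  then show ?thesis using assms by (simp add: scaleR_add_right divide_inverse mult.commute)
qed

text \<open>A half-plane bounded by the line through \<open>P\<close> in the direction
  \<open>A\<close> is convex. The factor \<open>s\<close> chooses the side, so both orientations are
  treated at once.\<close>

lemma hull_crs_ge:
  assumes "y \<in> convex hull S" "\<And>x. x \<in> S \<Longrightarrow> 0 \<le> s * crs A (x - P)"
  shows "0 \<le> s * crs A (y - P)"
proof -
  have *: "s * crs A (x - P) = (P - x) \<bullet> (s *\<^sub>R (\<i> * (- A)))" for x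
    by (simp add: crs_def inner_complex_def algebra_simps)
  have "y \<bullet> (s *\<^sub>R (\<i> * (- A))) \<le> P \<bullet> (s *\<^sub>R (\<i> * (- A)))"
  proof (rule hull_inner_le[OF assms(1)])
    fix x assume "x \<in> S"
    then have "0 \<le> (P - x) \<bullet> (s *\<^sub>R (\<i> * (- A)))" using assms(2)[of x] * by metis
    then show "x \<bullet> (s *\<^sub>R (\<i> * (- A))) \<le> P \<bullet> (s *\<^sub>R (\<i> * (- A)))" by (simp only: inner_diff_left)
  qed
  then show ?thesis unfolding * by (simp only: inner_diff_left)
qed

lemma in_segment_outside:
  fixes x y :: complex
  shows "t > 1 \<Longrightarrow> y \<in> closed_segment x ((1 - t) *\<^sub>R x + t *\<^sub>R y)"
    and "t < 0 \<Longrightarrow> x \<in> closed_segment y ((1 - t) *\<^sub>R x + t *\<^sub>R y)"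
proof -
  assume t: "t > 1"
  have "y = (1 - 1/t) *\<^sub>R x + (1/t) *\<^sub>R ((1 - t) *\<^sub>R x + t *\<^sub>R y)"
    using t by (simp add: complex_eq_iff field_simps)
  then show "y \<in> closed_segment x ((1 - t) *\<^sub>R x + t *\<^sub>R y)"
    unfolding in_segment using t by (intro exI[of _ "1/t"]) auto
next
  assume t: "t < 0"
  define s where "s = 1/(1-t)"
  have s: "s * (1 - t) = 1" using t by (simp add: s_def)
  have "(1 - s) *\<^sub>R y + s *\<^sub>R ((1 - t) *\<^sub>R x + t *\<^sub>R y) = (s * (1 - t)) *\<^sub>R x + (1 - s * (1 - t)) *\<^sub>R y"
    by (simp add: algebra_simps)
  then have "x = (1 - 1/(1-t)) *\<^sub>R y + (1/(1-t)) *\<^sub>R ((1 - t) *\<^sub>R x + t *\<^sub>R y)"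
    unfolding s by (simp add: s_def)
  then show "x \<in> closed_segment y ((1 - t) *\<^sub>R x + t *\<^sub>R y)"
    unfolding in_segment using t by (intro exI[of _ "1/(1-t)"]) auto
qed

text \<open>Of three points on a line one lies between the other two, whereas every vertex is
  extreme.\<close>

lemma optimal_not_collinear:
  assumes o: "optimal F xs" and m: "x \<in> set xs" "y \<in> set xs" "z \<in> set xs" and d: "x \<noteq> y" "y \<noteq> z" "x \<noteq> z"
  shows "crs (y - x) (z - x) \<noteq> 0"
proof
  assume "crs (y - x) (z - x) = 0"
  then obtain t where "z - x = t *\<^sub>R (y - x)" using crs_eq_0_imp d by (metis right_minus_eq)
  then have z: "z = (1 - t) *\<^sub>R x + t *\<^sub>R y" by (simp add: algebra_simps)
  have n: "z \<notin> closed_segment x y" "y \<notin> closed_segment x z" "x \<notin> closed_segment y z"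
    using optimal_extreme[OF o m(3), of "{x, y}"] optimal_extreme[OF o m(2), of "{x, z}"]
      optimal_extreme[OF o m(1), of "{y, z}"] m d by (auto simp: segment_convex_hull)
  consider "0 \<le> t \<and> t \<le> 1" | "t > 1" | "t < 0" by linarith
  then show False
  proof cases
    case 1
    then show ?thesis using n(1) z by (auto simp: in_segment)
  next
    case 2
    then show ?thesis using n(2) z in_segment_outside(1)[of t y x] by simp
  next
    case 3
    then show ?thesis using n(3) z in_segment_outside(2)[of t x y] by simp
  qed
qed

text \<open>Uncrossing two edges of the path by reversing the part between them shortens it.\<close>
lemma optimal_no_crossing:
  assumes o: "optimal F (pre @ P # Q # ys @ a # b # zs)"
  shows "crs (Q - P) (a - P) * crs (Q - P) (b - P) > 0"
proof (rule ccontr)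
  let ?xs = "pre @ P # Q # ys @ a # b # zs"
  assume neg: "\<not> crs (Q - P) (a - P) * crs (Q - P) (b - P) > 0"
  have d: "distinct ?xs" using o by (rule optimal_distinct)
  let ?A = "crs (Q - P) (a - P)" and ?B = "crs (Q - P) (b - P)"
  have nA: "?A \<noteq> 0" and nB: "?B \<noteq> 0"
    using optimal_not_collinear[OF o, of P Q a] optimal_not_collinear[OF o, of P Q b] d by auto
  have AB: "?A * ?B < 0" using neg nA nB by (simp add: not_less less_le)
  \<comment> \<open>The parameter at which the segment from \<open>a\<close> to \<open>b\<close>
    meets the line through \<open>P\<close> and \<open>Q\<close>; the determinants at its two ends
    have opposite signs.\<close>
  define t where "t = ?A / (?A - ?B)"
  have AB': "?A - ?B \<noteq> 0" using AB by (auto simp: mult_less_0_iff)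
  have t: "0 < t" "t < 1" using AB by (auto simp: t_def mult_less_0_iff divide_simps)
  define z where "z = (1 - t) *\<^sub>R a + t *\<^sub>R b"
  have "crs (Q - P) (z - P) = (1 - t) * ?A + t * ?B"
  proof -
    have "z - P = (1 - t) *\<^sub>R (a - P) + t *\<^sub>R (b - P)" by (simp add: z_def algebra_simps)
    then show ?thesis by (simp only: crs_add crs_scale)
  qed
  also have "\<dots> = 0" using AB' by (simp add: t_def field_simps)
  finally have z0: "crs (Q - P) (z - P) = 0" .
  have PQ: "P \<noteq> Q" using d by auto
  define q where "q = ((z - P) \<bullet> (Q - P)) / ((Q - P) \<bullet> (Q - P))"
  have q: "z = P + q *\<^sub>R (Q - P)" using crs_eq_0_imp[OF z0] PQ by (simp add: q_def algebra_simps)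
  have zq: "z = (1 - q) *\<^sub>R P + q *\<^sub>R Q" using q by (simp add: algebra_simps)
  have zab: "z \<in> closed_segment a b" using t by (auto simp: z_def in_segment intro!: exI[of _ t])
  have zhull: "z \<in> convex hull {x, a, b}" for x
    using zab hull_mono[of "{a,b}" "{x,a,b}" convex] by (auto simp: segment_convex_hull)
  \<comment> \<open>If the crossing lay outside the segment from \<open>P\<close> to
    \<open>Q\<close>, then \<open>P\<close> or \<open>Q\<close> would lie between it and the other
    one, hence in the hull of three other vertices.\<close>
  have q0: "0 \<le> q"
  proof (rule ccontr)
    assume "\<not> 0 \<le> q"
    then have q': "q < 0" by simp
    have "P \<in> closed_segment Q z" using in_segment_outside(2)[OF q', of P Q] zq by simp
    then have "P \<in> convex hull {Q, a, b}"
      using closed_segment_subset_convex_hull[OF hull_inc[of Q "{Q, a, b}" convex] zhull[of Q]] by auto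
    moreover have "P \<notin> convex hull {Q, a, b}" by (rule optimal_extreme[OF o]) (use d in auto)
    ultimately show False by simp
  qed
  have q1: "q \<le> 1"
  proof (rule ccontr)
    assume "\<not> q \<le> 1"
    then have q': "q > 1" by simp
    have "Q \<in> closed_segment P z" using in_segment_outside(1)[OF q', of Q P] zq by simp
    then have "Q \<in> convex hull {P, a, b}"
      using closed_segment_subset_convex_hull[OF hull_inc[of P "{P, a, b}" convex] zhull[of P]] by auto
    moreover have "Q \<notin> convex hull {P, a, b}" by (rule optimal_extreme[OF o]) (use d in auto)
    ultimately show False by simp
  qed
  have zPQ: "z \<in> closed_segment P Q"
    unfolding in_segment using q q0 q1 by (intro exI[of _ q]) (auto simp: algebra_simps)
  have 1: "dist P Q = dist P z + dist z Q" "dist a b = dist a z + dist z b"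
    using zPQ zab by (auto simp: between_mem_segment[symmetric] between)
  have "z \<noteq> P"
  proof
    assume "z = P"
    then have "P \<in> convex hull {a, b}" using zab by (simp add: segment_convex_hull)
    then show False using optimal_extreme[OF o, of P "{a,b}"] d by auto
  qed
  have "z \<noteq> Q"
  proof
    assume "z = Q"
    then have "Q \<in> convex hull {a, b}" using zab by (simp add: segment_convex_hull)
    then show False using optimal_extreme[OF o, of Q "{a,b}"] d by auto
  qed
  \<comment> \<open>Strictness matters: the uncrossed path has the same number of vertices, so it
    must be strictly shorter to contradict optimality. Equality would put \<open>a\<close> on the
    line through \<open>P\<close> and \<open>Q\<close>.\<close>
  have "dist P a < dist P z + dist z a"
  proof (rule ccontr)
    assume "\<not> ?thesis"
    then have "dist P a = dist P z + dist z a" using dist_triangle[of P a z] by simp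
    then have "z \<in> closed_segment P a" by (simp add: between_mem_segment[symmetric] between)
    then obtain r where r: "z = (1 - r) *\<^sub>R P + r *\<^sub>R a" by (auto simp: in_segment)
    have zr: "z - P = r *\<^sub>R (a - P)" unfolding r by (simp add: algebra_simps)
    then have "r * ?A = 0" using z0 by (simp only: zr crs_scale)
    then have "r = 0" using nA by simp
    then show False using r \<open>z \<noteq> P\<close> by simp
  qed
  then have less: "dist P a + dist Q b < dist P Q + dist a b"
    using 1 dist_triangle[of Q b z] by (simp add: dist_commute)
  let ?new = "pre @ P # a # rev ys @ Q # b # zs"
  have "plen (a # rev ys @ [Q]) = plen (Q # ys @ [a])"
    using plen_rev[of "Q # ys @ [a]"] by simp
  moreover have "plen ?new = plen (pre @ [P]) + dist P a + (plen (a # rev ys @ [Q]) + dist Q b + plen (b # zs))"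
    using plen_append2[of pre P a "rev ys @ Q # b # zs"] plen_append2[of "a # rev ys" Q b zs] by simp
  moreover have "plen ?xs = plen (pre @ [P]) + dist P Q + (plen (Q # ys @ [a]) + dist a b + plen (b # zs))"
    using plen_append2[of pre P Q "ys @ a # b # zs"] plen_append2[of "Q # ys" a b zs] by simp
  ultimately have "plen ?new < plen ?xs" using less by simp
  moreover have "covers F ?new"
  proof -
    have "set ?new = set ?xs" by auto
    then show ?thesis using o by (simp only: optimal_def covers_def)
  qed
  ultimately show False using o by (auto simp: optimal_def)
qed

text \<open>No later edge crosses the line of \<open>P\<close> and \<open>Q\<close>, so the side is
  passed on from each vertex to the next.\<close>

lemma optimal_one_side:
  assumes o: "optimal F (pre @ P # Q # x # rest)"
  shows "\<forall>y\<in>set (x # rest). crs (Q - P) (x - P) * crs (Q - P) (y - P) > 0"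
proof -
  have d: "distinct (pre @ P # Q # x # rest)" using o by (rule optimal_distinct)
  have x0: "crs (Q - P) (x - P) \<noteq> 0"
    using optimal_not_collinear[OF o, of P Q x] d by auto
  have "crs (Q - P) (x - P) * crs (Q - P) (y - P) > 0" if "x # rest = ys @ y # zs" for ys y zs
    using that
  proof (induction ys arbitrary: y zs rule: rev_induct)
    case Nil
    then show ?case using x0 by (auto simp: zero_less_mult_iff)
  next
    case (snoc a ys)
    have "crs (Q - P) (x - P) * crs (Q - P) (a - P) > 0"
      using snoc.IH[of a "y # zs"] snoc.prems by simp
    moreover have "crs (Q - P) (a - P) * crs (Q - P) (y - P) > 0"
      by (rule optimal_no_crossing[of F pre P Q ys a y zs]) (use o snoc.prems in simp)
    ultimately show ?case by (auto simp: zero_less_mult_iff)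
  qed
  then show ?thesis by (metis split_list)
qed

text \<open>The determinant is a signed distance from the line of the edge, nonnegative on
  \<open>V\<close>. A convex combination on which it is not positive has all its weight where it
  vanishes, that is on \<open>P\<close> and \<open>A\<close>.\<close>

lemma zero_in_edge:
  assumes V: "finite V" "P \<in> V" "A \<in> V" and y: "y \<in> convex hull V"
    and pos: "\<And>x. x \<in> V \<Longrightarrow> x \<noteq> P \<Longrightarrow> x \<noteq> A \<Longrightarrow> 0 < s * crs (A - P) (x - P)"
    and y0: "s * crs (A - P) (y - P) \<le> 0"
  shows "y \<in> closed_segment P A"
proof -
  obtain l where l: "\<forall>x\<in>V. 0 \<le> l x" "sum l V = 1" "(\<Sum>x\<in>V. l x *\<^sub>R x) = y"
    using y V(1) by (auto simp: convex_hull_finite)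
  let ?g = "\<lambda>x. s * crs (A - P) (x - P)"
  have lin: "?g x = x \<bullet> (s *\<^sub>R (\<i> * (A - P))) - P \<bullet> (s *\<^sub>R (\<i> * (A - P)))" for x
    by (simp add: crs_def inner_complex_def algebra_simps)
  have "?g y = (\<Sum>x\<in>V. l x * ?g x)"
  proof -
    have "(\<Sum>x\<in>V. l x * ?g x) = (\<Sum>x\<in>V. l x * (x \<bullet> (s *\<^sub>R (\<i> * (A - P))))) - sum l V * (P \<bullet> (s *\<^sub>R (\<i> * (A - P))))"
      unfolding lin by (simp only: right_diff_distrib sum_subtractf sum_distrib_right)
    also have "(\<Sum>x\<in>V. l x * (x \<bullet> (s *\<^sub>R (\<i> * (A - P))))) = y \<bullet> (s *\<^sub>R (\<i> * (A - P)))"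
      unfolding l(3)[symmetric] by (simp only: inner_sum_left inner_scaleR_left)
    finally show ?thesis unfolding lin l(2) by simp
  qed
  moreover have nn: "0 \<le> l x * ?g x" if "x \<in> V" for x
    using that pos[of x] l(1) by (cases "x = P \<or> x = A") auto
  ultimately have "(\<Sum>x\<in>V. l x * ?g x) = 0" using y0 sum_nonneg[of V "\<lambda>x. l x * ?g x", OF nn] by linarith
  then have z: "l x * ?g x = 0" if "x \<in> V" for x using sum_nonneg_eq_0_iff[OF V(1), of "\<lambda>x. l x * ?g x"] nn that by auto
  have l0: "l x = 0" if "x \<in> V" "x \<noteq> P" "x \<noteq> A" for x using z[OF that(1)] pos[OF that] by auto
  have "sum l V = sum l {P, A}" "(\<Sum>x\<in>V. l x *\<^sub>R x) = (\<Sum>x\<in>{P,A}. l x *\<^sub>R x)"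
    by (intro sum.mono_neutral_right; use V l0 in force)+
  then have "y \<in> convex hull {P, A}"
    using l V by (auto simp: convex_hull_finite intro!: exI[of _ l])
  then show ?thesis by (simp add: segment_convex_hull)
qed

text \<open>\<open>A\<close> and \<open>B\<close> are the neighbours of \<open>P\<close> on the
  boundary of the hull. The finitely many points of \<open>F\<close> avoid the edge to
  \<open>A\<close>, hence keep a positive distance from its line, and \<open>P\<close> may slide
  towards \<open>B\<close> by less than this margin without uncovering them.\<close>

lemma replace_vertex:
  assumes V: "finite V" "P \<in> V" "A \<in> V" "B \<in> V" "A \<noteq> P" "B \<noteq> P"
    and D: "0 < s * crs (A - P) (B - P)"
    and pos: "\<And>x. x \<in> V \<Longrightarrow> x \<noteq> P \<Longrightarrow> x \<noteq> A \<Longrightarrow> 0 < s * crs (A - P) (x - P)"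
    and neg: "\<And>x. x \<in> V \<Longrightarrow> s * crs (B - P) (x - P) \<le> 0"
    and F: "finite F" "F \<subseteq> convex hull V" "F \<inter> closed_segment P A = {}"
  shows "\<exists>e0>0. e0 \<le> 1 \<and> (\<forall>e. 0 < e \<and> e < e0 \<longrightarrow> F \<subseteq> convex hull (insert (P + e *\<^sub>R (B - P)) (V - {P})))"
proof -
  define D' where "D' = crs (A - P) (B - P)"
  have D': "D' \<noteq> 0" using D by (auto simp: D'_def)
  \<comment> \<open>The coefficient of \<open>B - P\<close> when \<open>y - P\<close> is written in
    the basis \<open>A - P\<close>, \<open>B - P\<close>. Its minimum over \<open>F\<close>, capped
    at 1, is the admissible displacement.\<close>
  define g where "g y = crs (A - P) (y - P) / D'" for y
  have sgn: "x / D' > 0 \<longleftrightarrow> s * x > 0" "x / D' \<ge> 0 \<longleftrightarrow> s * x \<ge> 0" for x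
    using D by (auto simp: D'_def zero_less_divide_iff zero_less_mult_iff zero_le_divide_iff zero_le_mult_iff)
  have gpos: "g y > 0" if "y \<in> F" for y
  proof (rule ccontr)
    assume "\<not> g y > 0"
    then have "s * crs (A - P) (y - P) \<le> 0" using sgn(1) by (auto simp: g_def not_less)
    then have "y \<in> closed_segment P A" using zero_in_edge[OF V(1-3) _ pos] F(2) that by auto
    then show False using F(3) that by auto
  qed
  define e0 where "e0 = Min (insert 1 (g ` F))"
  have e0: "0 < e0" "e0 \<le> 1" "\<And>y. y \<in> F \<Longrightarrow> e0 \<le> g y"
    using gpos F(1) by (auto simp: e0_def)
  have main: "y \<in> convex hull (insert (P + e *\<^sub>R (B - P)) (V - {P}))" if y: "y \<in> F" and e: "0 < e" "e < e0" for y e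
  proof -
    let ?H = "convex hull (insert (P + e *\<^sub>R (B - P)) (V - {P}))"
    have "y \<in> convex hull (insert P (V - {P}))" using F(2) y V(2) by (simp add: insert_absorb subset_iff)
    moreover have "V - {P} \<noteq> {}" using V by auto
    ultimately obtain a b z where ab: "0 \<le> a" "0 \<le> b" "a + b = 1" "z \<in> convex hull (V - {P})" "y = a *\<^sub>R P + b *\<^sub>R z"
      by (subst (asm) convex_hull_insert) blast+
    have zV: "z \<in> convex hull V" using ab(4) hull_mono[of "V - {P}" V convex] by auto
    define \<alpha> \<beta> where "\<alpha> = crs (z - P) (B - P) / D'" and "\<beta> = crs (A - P) (z - P) / D'"
    have z: "z - P = \<alpha> *\<^sub>R (A - P) + \<beta> *\<^sub>R (B - P)"
      unfolding \<alpha>_def \<beta>_def D'_def by (rule crs_basis) (use D' in \<open>simp add: D'_def\<close>)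
    have "0 \<le> - s * crs (B - P) (z - P)"
      by (rule hull_crs_ge[OF zV]) (use neg in auto)
    then have "0 \<le> s * crs (z - P) (B - P)" using crs_swap[of "z - P" "B - P"] by simp
    then have al: "0 \<le> \<alpha>" using sgn(2) by (simp add: \<alpha>_def)
    have yP: "y - P = b *\<^sub>R (z - P)" using ab by (simp add: algebra_simps) (metis scaleR_add_left scaleR_one)
    then have gy: "g y = b * \<beta>" by (simp add: g_def \<beta>_def crs_scale)
    then have be: "e < b * \<beta>" using e0(3)[OF y] e by simp
    have b1: "b \<le> 1" using ab by simp
    have b0: "0 < b" using be e ab(2) by (cases "b = 0") auto
    have be0: "0 < \<beta>" using be e b0 by (metis less_trans zero_less_mult_pos)
    have "b * \<beta> \<le> \<beta>" using b1 be0 by simp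
    then have eb: "e < \<beta>" using be by simp
    \<comment> \<open>The contribution of \<open>P\<close> to \<open>y\<close> has to be supplied by
      the new vertex. To this end an amount \<delta> of the weight of \<open>z\<close> is exchanged
      for weights on \<open>A\<close> and on the new vertex, according to the expansion of
      \<open>z - P\<close>; this leaves the point fixed for every \<delta>, and the stated value
      makes the weights sum to 1.\<close>
    define \<delta> where "\<delta> = (1 - b) / (\<beta> / e + \<alpha> - 1)"
    have den: "\<beta> / e + \<alpha> - 1 > 0" 
    proof -
      have "1 < \<beta> / e" using eb e by simp
      then show ?thesis using al by linarith
    qed
    have d0: "0 \<le> \<delta>" using den b1 by (simp add: \<delta>_def)
    have dd: "\<delta> * (\<beta> / e + \<alpha> - 1) = 1 - b" using den by (simp add: \<delta>_def)
    have "1 \<le> b * (\<beta> / e + \<alpha>)"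
    proof -
      have "1 \<le> b * \<beta> / e" using be e by simp
      moreover have "0 \<le> b * \<alpha>" using b0 al by simp
      ultimately show ?thesis by (simp add: distrib_left)
    qed
    then have "1 - b \<le> b * (\<beta> / e + \<alpha> - 1)" by (simp add: algebra_simps)
    then have db: "\<delta> \<le> b" using den by (simp add: \<delta>_def divide_le_eq)
    have mem: "z \<in> ?H" "A \<in> ?H" "P + e *\<^sub>R (B - P) \<in> ?H"
      using ab(4) hull_mono[of "V - {P}" "insert (P + e *\<^sub>R (B - P)) (V - {P})" convex] V
      by (auto intro: hull_inc)
    have "(b - \<delta>) *\<^sub>R z + (\<delta> * \<alpha>) *\<^sub>R A + (\<delta> * \<beta> / e) *\<^sub>R (P + e *\<^sub>R (B - P)) \<in> ?H"
    proof -
      have sum1: "(b - \<delta>) + \<delta> * \<alpha> + \<delta> * \<beta> / e = 1"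
        using dd by (simp add: algebra_simps)
      have nn: "0 \<le> b - \<delta>" "0 \<le> \<delta> * \<alpha>" "0 \<le> \<delta> * \<beta> / e" using db d0 al be0 e by auto
      have "(\<Sum>i<3. [b - \<delta>, \<delta> * \<alpha>, \<delta> * \<beta> / e] ! i *\<^sub>R [z, A, P + e *\<^sub>R (B - P)] ! i) \<in> ?H"
        using mem nn sum1 by (intro convex_sum) (auto simp: eval_nat_numeral less_Suc_eq)
      then show ?thesis by (simp add: eval_nat_numeral)
    qed
    moreover have "(b - \<delta>) *\<^sub>R z + (\<delta> * \<alpha>) *\<^sub>R A + (\<delta> * \<beta> / e) *\<^sub>R (P + e *\<^sub>R (B - P)) = y"
    proof -
      have sum1: "(b - \<delta>) + \<delta> * \<alpha> + \<delta> * \<beta> / e = 1"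
        using dd by (simp add: algebra_simps)
      have "(b - \<delta>) *\<^sub>R z + (\<delta> * \<alpha>) *\<^sub>R A + (\<delta> * \<beta> / e) *\<^sub>R (P + e *\<^sub>R (B - P))
        = ((b - \<delta>) + \<delta> * \<alpha> + \<delta> * \<beta> / e) *\<^sub>R P + (b - \<delta>) *\<^sub>R (z - P) + \<delta> *\<^sub>R (\<alpha> *\<^sub>R (A - P) + \<beta> *\<^sub>R (B - P))"
        using e by (simp add: scaleR_add_right scaleR_add_left scaleR_diff_right scaleR_diff_left)
      also have "\<dots> = P + b *\<^sub>R (z - P)"
        unfolding sum1 z[symmetric] by (simp add: algebra_simps)
      also have "\<dots> = y" using yP by (simp add: algebra_simps)
      finally show ?thesis .
    qed
    ultimately show ?thesis by simp
  qed
  show ?thesis using e0 main by blast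
qed

section \<open>Integrals over normal cones\<close>

lemma integral_circ_quadrant:
  "(\<integral>u. (if Re u \<le> 0 \<and> Im u \<le> 0 then Re u else 0) \<partial>circ) = -1"
proof -
  have "(\<integral>u. (if Re u \<le> 0 \<and> Im u \<le> 0 then Re u else 0) \<partial>circ)
     = (\<integral>t. indicator {0..<2*pi} t * (if cos t \<le> 0 \<and> sin t \<le> 0 then cos t else 0) \<partial>lborel)"
    by (subst integral_circ) (auto cong: if_cong)
  also have "\<dots> = (\<integral>t. cos t * indicator {pi..3*pi/2} t \<partial>lborel)"
  proof (rule integral_cong_AE)
    have "AE t in lborel. t \<noteq> pi/2 \<and> t \<noteq> 0 \<and> t \<noteq> 3*pi/2"
      using AE_lborel_singleton[of "pi/2"] AE_lborel_singleton[of "0::real"] AE_lborel_singleton[of "3*pi/2"]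
      by eventually_elim auto
    then show "AE t in lborel. indicator {0..<2*pi} t * (if cos t \<le> 0 \<and> sin t \<le> 0 then cos t else 0)
        = cos t * indicator {pi..3*pi/2} t"
    proof eventually_elim
      case (elim t)
      have "sin t > 0" if "0 < t" "t < pi" using that by (rule sin_gt_zero)
      moreover have "cos t > 0" if "3*pi/2 < t" "t < 2*pi"
        using that cos_gt_zero_pi[of "t - 2*pi"] by (simp add: cos_diff)
      moreover have "cos t \<le> 0" if "pi \<le> t" "t \<le> 3*pi/2"
        using that cos_ge_zero[of "t - pi"] by (simp add: cos_diff)
      moreover have "sin t \<le> 0" if "pi \<le> t" "t \<le> 3*pi/2"
        using that sin_ge_zero[of "t - pi"] by (simp add: sin_diff)
      ultimately show ?case using elim by (auto simp: indicator_def not_le)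
    qed
  qed auto
  also have "\<dots> = sin (3*pi/2) - sin pi"
    by (intro has_bochner_integral_integral_eq has_bochner_integral_cos) auto
  also have "\<dots> = -1" using sin_periodic_pi[of "pi/2"] by simp
  finally show ?thesis .
qed

text \<open>The region consists of the directions making no acute angle with (1,0) or (v1,v2). With
  \<theta> the angle between these two vectors it is the arc from pi/2 + \<theta> to 3 pi/2, on
  which the integrand is \<open>- r * cos (t - \<theta>)\<close>.\<close>

lemma integral_circ_cone:
  assumes v: "0 \<le> v1" "0 < v2"
  shows "(\<integral>u. (if Re u \<le> 0 \<and> Re u * v1 + Im u * v2 \<le> 0 then - (Re u * v1 + Im u * v2) else 0) \<partial>circ)
     = sqrt (v1\<^sup>2 + v2\<^sup>2) + v1"
proof -
  define r \<theta> where "r = sqrt (v1\<^sup>2 + v2\<^sup>2)" and "\<theta> = arccos (v1 / r)"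
  have r: "r > 0" using v by (simp add: r_def sum_power2_gt_zero_iff)
  have r2: "r\<^sup>2 = v1\<^sup>2 + v2\<^sup>2" by (simp add: r_def)
  have v1r: "v1 < r" using v by (metis r_def real_less_rsqrt less_add_same_cancel1 zero_less_power)
  have c: "cos \<theta> = v1 / r" unfolding \<theta>_def using v v1r r by (intro cos_arccos) (auto simp: field_simps)
  have \<theta>0: "0 < \<theta>" "\<theta> \<le> pi/2"
    using v1r v r arccos_lt_bounded[of "v1/r"] arccos_le_pi2[of "v1/r"] by (auto simp: \<theta>_def field_simps)
  have "(sin \<theta>)\<^sup>2 = (v2 / r)\<^sup>2"
  proof -
    have "v2\<^sup>2 = r\<^sup>2 - v1\<^sup>2" using r2 by simp
    then show ?thesis using r by (simp add: sin_squared_eq c power_divide diff_divide_distrib)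
  qed
  moreover have "0 \<le> sin \<theta>" using \<theta>0 by (intro sin_ge_zero) auto
  ultimately have sn: "sin \<theta> = v2 / r" using v r by (metis divide_nonneg_pos less_imp_le power2_eq_imp_eq)
  have comb: "cos t * v1 + sin t * v2 = r * cos (t - \<theta>)" for t
    using r by (simp add: cos_diff c sn field_simps)
  have "(\<integral>u. (if Re u \<le> 0 \<and> Re u * v1 + Im u * v2 \<le> 0 then - (Re u * v1 + Im u * v2) else 0) \<partial>circ)
     = (\<integral>t. indicator {0..<2*pi} t * (if cos t \<le> 0 \<and> r * cos (t - \<theta>) \<le> 0 then - (r * cos (t - \<theta>)) else 0) \<partial>lborel)"
    by (subst integral_circ) (auto simp: comb cong: if_cong)
  also have "\<dots> = (\<integral>t. - r * (cos (t - \<theta>) * indicator {pi/2+\<theta>..3*pi/2} t) \<partial>lborel)"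
  proof (rule integral_cong_AE)
    have "AE t in lborel. t \<noteq> 3*pi/2 \<and> t \<noteq> pi/2+\<theta>"
      using AE_lborel_singleton[of "pi/2 + \<theta>"] AE_lborel_singleton[of "3*pi/2"]
      by eventually_elim auto
    then show "AE t in lborel. indicator {0..<2*pi} t * (if cos t \<le> 0 \<and> r * cos (t - \<theta>) \<le> 0 then - (r * cos (t - \<theta>)) else 0)
        = - r * (cos (t - \<theta>) * indicator {pi/2+\<theta>..3*pi/2} t)"
    proof eventually_elim
      case (elim t)
      have "cos (t - \<theta>) > 0" if "0 \<le> t" "t < pi/2 + \<theta>" "\<not> cos t > 0"
      proof (rule cos_gt_zero_pi)
        show "t - \<theta> < pi/2" using that by simp
        show "- (pi/2) < t - \<theta>"
        proof (rule ccontr)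
          assume "\<not> - (pi/2) < t - \<theta>"
          then have "t = 0" using \<theta>0 that by simp
          then show False using that by simp
        qed
      qed
      moreover have "cos t > 0" if "3*pi/2 < t" "t < 2*pi"
        using that cos_gt_zero_pi[of "t - 2*pi"] by (simp add: cos_diff)
      moreover have "cos t \<le> 0" if "pi/2+\<theta> \<le> t" "t \<le> 3*pi/2"
        using that \<theta>0 cos_ge_zero[of "t - pi"] by (simp add: cos_diff)
      moreover have "cos (t - \<theta>) \<le> 0" if "pi/2+\<theta> \<le> t" "t \<le> 3*pi/2"
        using that \<theta>0 cos_ge_zero[of "t - \<theta> - pi"] by (simp add: cos_diff[of "t - \<theta>" pi])
      ultimately show ?case using elim r \<theta>0 by (auto simp: indicator_def not_le mult_le_0_iff)
    qed
  qed auto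
  also have "\<dots> = - r * (sin (3*pi/2 - \<theta>) - sin (pi/2 + \<theta> - \<theta>))"
    by (intro has_bochner_integral_integral_eq has_bochner_integral_mult_right has_bochner_integral_FTC_Icc_real)
       (use \<theta>0 in \<open>auto intro!: derivative_eq_intros\<close>)
  also have "\<dots> = r + v1"
  proof -
    have "3*pi/2 - \<theta> = (pi/2 - \<theta>) + pi" by simp
    then have "sin (3*pi/2 - \<theta>) = - cos \<theta>" by (simp only: sin_periodic_pi) (simp add: sin_diff)
    then show ?thesis using r c by (simp add: algebra_simps)
  qed
  finally show ?thesis by (simp add: r_def)
qed

section \<open>The ends of a shortest path\<close>

lemma hull_insert_absorb:
  assumes "p \<in> convex hull S" "V \<subseteq> insert p S"
  shows "convex hull V \<subseteq> convex hull S"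
  by (rule hull_minimal) (use assms in \<open>auto intro: hull_inc\<close>)

text \<open>Here \<open>s\<close> is the other neighbour of \<open>p\<close> on the boundary of the hull. If no point of \<open>F\<close> lay
  on the edge, then \<open>p\<close> could be slid towards \<open>s\<close> without uncovering \<open>F\<close>, and minimality forces a
  right angle at \<open>p\<close>; in that case sliding \<open>v\<close> towards \<open>w\<close>, or exchanging \<open>p\<close> and \<open>v\<close>, shortens the path.\<close>
lemma optimal_first_edge_touches:
  assumes o: "optimal F (p # v # w # rest)" and F: "finite F" "F \<noteq> {}"
    and side: "\<And>x. x \<in> set (w # rest) \<Longrightarrow> 0 < \<sigma> * crs (v - p) (x - p)"
    and s: "s \<in> set (w # rest)" "\<And>x. x \<in> set (p # v # w # rest) \<Longrightarrow> \<sigma> * crs (s - p) (x - p) \<le> 0"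
    and acute: "0 \<le> (v - p) \<bullet> (s - p)"
  shows "F \<inter> closed_segment p v \<noteq> {}"
proof
  let ?xs = "p # v # w # rest"
  assume empty: "F \<inter> closed_segment p v = {}"
  have d: "distinct ?xs" using o by (rule optimal_distinct)
  have cov: "F \<subseteq> convex hull (set ?xs)" using o by (simp add: optimal_def covers_def)
  have min: "plen ?xs \<le> plen ys" if "covers F ys" "length ys \<le> length ?xs" for ys
    using o that by (auto simp: optimal_def)
  have sp: "s \<noteq> p" "s \<noteq> v" using s(1) d by auto
  have D: "0 < \<sigma> * crs (v - p) (s - p)" using side s(1) by simp
  obtain e0 where e0: "e0 > 0" "\<And>e. 0 < e \<Longrightarrow> e < e0 \<Longrightarrow> F \<subseteq> convex hull (insert (p + e *\<^sub>R (s - p)) (set ?xs - {p}))"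
    using replace_vertex[of "set ?xs" p v s \<sigma> F] D side s F(1) cov empty d sp by auto
  have right: "(v - p) \<bullet> (s - p) = 0"
  proof (rule ccontr)
    assume "(v - p) \<bullet> (s - p) \<noteq> 0"
    then have pos: "(v - p) \<bullet> (s - p) > 0" using acute by simp
    define S where "S = (s - p) \<bullet> (s - p)"
    have S: "S > 0" using sp by (simp add: S_def)
    \<comment> \<open>Sliding \<open>p\<close> by \<open>e\<close> lowers the squared length of the
      first edge by \<open>e * (2 * ((v - p) \<bullet> (s - p)) - e * S)\<close>, which is positive
      under the second bound; the first bound keeps \<open>F\<close> covered.\<close>
    define e where "e = min (e0 / 2) ((v - p) \<bullet> (s - p) / S)"
    have e: "0 < e" "e < e0" "e * S \<le> (v - p) \<bullet> (s - p)"
      using e0(1) pos S by (auto simp: e_def min_def field_simps)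
    have "covers F ((p + e *\<^sub>R (s - p)) # v # w # rest)"
      using e0(2)[OF e(1,2)] hull_mono[of "insert (p + e *\<^sub>R (s - p)) (set ?xs - {p})" "set ((p + e *\<^sub>R (s - p)) # v # w # rest)" convex]
      by (auto simp: covers_def)
    from min[OF this] have "dist p v \<le> dist (p + e *\<^sub>R (s - p)) v" by simp
    then have "norm (v - p) \<le> norm ((v - p) - e *\<^sub>R (s - p))" by (simp add: dist_norm norm_minus_commute algebra_simps)
    then have "(v - p) \<bullet> (v - p) \<le> ((v - p) - e *\<^sub>R (s - p)) \<bullet> ((v - p) - e *\<^sub>R (s - p))" by (simp add: norm_le)
    also have "\<dots> = (v - p) \<bullet> (v - p) - 2 * e * ((v - p) \<bullet> (s - p)) + e * (e * S)"
      by (simp add: inner_diff_left inner_diff_right inner_commute S_def algebra_simps)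
    finally have "2 * e * ((v - p) \<bullet> (s - p)) \<le> e * (e * S)" by simp
    then have "2 * ((v - p) \<bullet> (s - p)) \<le> e * S" using e(1) by (simp add: mult.assoc mult.left_commute)
    then show False using e(3) pos by simp
  qed
  have pw: "crs (w - v) (p - v) \<noteq> 0" using optimal_not_collinear[OF o, of v w p] d by auto
  have pv_swap: "crs (p - v) (x - v) = - crs (v - p) (x - p)" for x by (simp add: crs_def algebra_simps)
  show False
  proof (cases "\<forall>x\<in>set rest. 0 < crs (w - v) (p - v) * crs (w - v) (x - v)")
    \<comment> \<open>All vertices lie on one side of the line through \<open>v\<close> and
      \<open>w\<close>, so the neighbours of \<open>v\<close> on the boundary of the hull are
      \<open>p\<close> and \<open>w\<close>. Sliding \<open>v\<close> towards \<open>w\<close> is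
      then allowed and strictly cuts the corner at \<open>v\<close>.\<close>
    case True
    let ?t = "crs (p - v) (w - v)"
    have tp: "?t = - crs (w - v) (p - v)" by (rule crs_swap)
    have "0 < ?t * crs (p - v) (x - v)" if "x \<in> set ?xs" "x \<noteq> v" "x \<noteq> p" for x
    proof -
      have "0 < \<sigma> * crs (v - p) (x - p)" "0 < \<sigma> * crs (v - p) (w - p)" using side that by auto
      then show ?thesis unfolding pv_swap by (auto simp: zero_less_mult_iff)
    qed
    moreover have "?t * crs (w - v) (x - v) \<le> 0" if "x \<in> set ?xs" for x
    proof (cases "x \<in> set rest")
      case True2: True
      then show ?thesis using True unfolding tp by (auto intro: less_imp_le)
    next
      case False
      then show ?thesis using that unfolding tp by (auto simp: power2_eq_square[symmetric])
    qed
    moreover have "F \<inter> closed_segment v p = {}" using empty by (simp add: closed_segment_commute)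
    ultimately obtain e1 where e1: "e1 > 0" "e1 \<le> 1"
      "\<And>e. 0 < e \<Longrightarrow> e < e1 \<Longrightarrow> F \<subseteq> convex hull (insert (v + e *\<^sub>R (w - v)) (set ?xs - {v}))"
      using replace_vertex[of "set ?xs" v p w ?t F] pw tp F(1) cov d
      by (auto simp: zero_less_mult_iff linorder_neq_iff)
    define e where "e = e1 / 2"
    have e: "0 < e" "e < e1" "e < 1" using e1 by (auto simp: e_def)
    let ?v = "v + e *\<^sub>R (w - v)"
    have "covers F (p # ?v # w # rest)"
      using e1(3)[OF e(1,2)] hull_mono[of "insert ?v (set ?xs - {v})" "set (p # ?v # w # rest)" convex]
      by (auto simp: covers_def)
    from min[OF this] have le: "dist p v + dist v w \<le> dist p ?v + dist ?v w" by simp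
    have "?v - w = (1 - e) *\<^sub>R (v - w)" by (simp add: algebra_simps)
    then have vw: "dist ?v w = (1 - e) * dist v w" using e by (simp add: dist_norm)
    have vv: "dist v ?v = e * dist v w" using e by (simp add: dist_norm norm_minus_commute)
    have "dist p ?v \<noteq> dist p v + dist v ?v"
    proof
      assume "dist p ?v = dist p v + dist v ?v"
      then have "v \<in> closed_segment p ?v" by (simp add: between_mem_segment[symmetric] between)
      then have "v \<in> convex hull {p, w}"
      proof -
        obtain r where r: "0 \<le> r" "r \<le> 1" "v = (1 - r) *\<^sub>R p + r *\<^sub>R ?v"
          using \<open>v \<in> closed_segment p ?v\<close> by (auto simp: in_segment)
        have "(1 - r) *\<^sub>R (p - v) + (r * e) *\<^sub>R (w - v) = 0"
          using r(3) by (simp add: algebra_simps)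
        then have "crs (w - v) ((1 - r) *\<^sub>R (p - v) + (r * e) *\<^sub>R (w - v)) = 0" by simp
        then have "(1 - r) * crs (w - v) (p - v) = 0" by (simp only: crs_add crs_scale) simp
        then have "r = 1" using pw by simp
        then have "e *\<^sub>R (w - v) = 0" using r(3) by simp
        then show ?thesis using e d by auto
      qed
      then show False using optimal_extreme[OF o, of v "{p, w}"] d by auto
    qed
    then have "dist p ?v < dist p v + dist v ?v" using dist_triangle[of p ?v v] by simp
    then show False using le vw vv by (simp add: algebra_simps)
  next
    case False
    then obtain x where x: "x \<in> set rest" "\<not> 0 < crs (w - v) (p - v) * crs (w - v) (x - v)" by auto
    have xs: "crs (w - v) (p - v) * crs (w - v) (y - v) < 0" if "y \<in> set rest" for y
    proof -
      obtain z zs where rest: "rest = z # zs" using x(1) by (cases rest) auto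
      have "optimal F ([p] @ v # w # z # zs)" using o rest by simp
      from optimal_one_side[OF this] have "0 < crs (w - v) (z - v) * crs (w - v) (x - v)" "0 < crs (w - v) (z - v) * crs (w - v) (y - v)"
        using x(1) that rest by auto
      then show ?thesis using x(2) pw by (auto simp: zero_less_mult_iff mult_less_0_iff not_less linorder_neq_iff)
    qed
    \<comment> \<open>If \<open>s\<close> came after \<open>w\<close>, then \<open>w\<close>, being
      outside the triangle of \<open>p\<close>, \<open>v\<close> and \<open>s\<close>, would lie
      beyond the line through \<open>v\<close> and \<open>s\<close> as seen from \<open>p\<close>.
      This puts \<open>p\<close> and \<open>s\<close> on the same side of the line through
      \<open>v\<close> and \<open>w\<close>, against \<open>xs\<close>.\<close>
    have "w = s"
    proof (rule ccontr)
      assume "w \<noteq> s"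
      then have sr: "s \<in> set rest" using s(1) by auto
      define D' where "D' = crs (v - p) (s - p)"
      have D'0: "D' \<noteq> 0" using D by (auto simp: D'_def)
      define \<alpha> \<beta> where "\<alpha> = crs (w - p) (s - p) / D'" and "\<beta> = crs (v - p) (w - p) / D'"
      have w: "w - p = \<alpha> *\<^sub>R (v - p) + \<beta> *\<^sub>R (s - p)"
        unfolding \<alpha>_def \<beta>_def D'_def by (rule crs_basis) (use D'0 in \<open>simp add: D'_def\<close>)
      have "0 \<le> \<sigma> * crs (w - p) (s - p)" using s(2)[of w] crs_swap[of "w - p" "s - p"] by simp
      then have al: "0 \<le> \<alpha>" using D by (auto simp: \<alpha>_def D'_def zero_le_divide_iff zero_less_mult_iff zero_le_mult_iff)
      have be: "0 < \<beta>" using side[of w] D by (auto simp: \<beta>_def D'_def zero_less_divide_iff zero_less_mult_iff)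
      have ab: "\<alpha> + \<beta> > 1"
      proof (rule ccontr)
        assume "\<not> \<alpha> + \<beta> > 1"
        moreover have "w = (1 - \<alpha> - \<beta>) *\<^sub>R p + \<alpha> *\<^sub>R v + \<beta> *\<^sub>R s" using w by (simp add: algebra_simps)
        ultimately have "w \<in> convex hull {p, v, s}"
          unfolding convex_hull_3 mem_Collect_eq using al be
          by (intro exI[of _ "1 - \<alpha> - \<beta>"] exI[of _ \<alpha>] exI[of _ \<beta>]) auto
        moreover have "w \<notin> convex hull {p, v, s}"
          by (rule optimal_extreme[OF o]) (use d s(1) \<open>w \<noteq> s\<close> in auto)
        ultimately show False by simp
      qed
      have wv: "w - v = (\<alpha> - 1) *\<^sub>R (v - p) + \<beta> *\<^sub>R (s - p)" using w by (simp add: algebra_simps)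
      have pvv: "p - v = (-1) *\<^sub>R (v - p)" and svv: "s - v = (-1) *\<^sub>R (v - p) + (s - p)" by auto
      have "crs (w - v) (p - v) = \<beta> * D'"
        unfolding wv pvv crs_add crs_scale D'_def using crs_swap[of "s - p" "v - p"] by simp
      moreover have "crs (w - v) (s - v) = (\<alpha> + \<beta> - 1) * D'"
        unfolding wv svv crs_add crs_scale D'_def using crs_swap[of "s - p" "v - p"] by (simp add: algebra_simps)
      ultimately have "crs (w - v) (p - v) * crs (w - v) (s - v) = \<beta> * (\<alpha> + \<beta> - 1) * D'\<^sup>2"
        by (simp add: power2_eq_square)
      also have "\<dots> > 0" using be ab D'0 by simp
      finally show False using xs[OF sr] by simp
    qed
    \<comment> \<open>The exchange keeps the vertex set and replaces the edge from \<open>v\<close>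
      to \<open>w\<close> by the one from \<open>p\<close> to \<open>w\<close>. Because of the right
      angle at \<open>p\<close> this trades a hypotenuse for a leg.\<close>
    have "covers F (v # p # w # rest)" using cov by (simp add: covers_def insert_commute)
    from min[OF this] have "dist p v + dist v w \<le> dist v p + dist p w" by simp
    then have "dist v w \<le> dist p w" by (simp add: dist_commute)
    moreover have "(dist v w)\<^sup>2 = (dist v p)\<^sup>2 + (dist p w)\<^sup>2"
    proof -
      have "(dist v w)\<^sup>2 = ((v - p) - (w - p)) \<bullet> ((v - p) - (w - p))" by (simp add: dist_norm power2_norm_eq_inner)
      also have "\<dots> = (v - p) \<bullet> (v - p) + (w - p) \<bullet> (w - p)"
        using right \<open>w = s\<close> by (simp add: inner_diff_left inner_diff_right inner_commute)
      finally show ?thesis by (simp add: dist_norm power2_norm_eq_inner norm_minus_commute[of p w])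
    qed
    moreover have "(dist v w)\<^sup>2 \<le> (dist p w)\<^sup>2" using calculation(1) by (intro power_mono) auto
    ultimately have "(dist v p)\<^sup>2 \<le> 0" by simp
    then show False using d by auto
  qed
qed

text \<open>Let \<open>e\<close> be the direction from \<open>p\<close> to its other neighbour on the boundary of the hull and \<open>f\<close> the
  unit normal of \<open>e\<close> on the side of \<open>v\<close>. The point \<open>k\<close> of \<open>F\<close> is the one with least \<open>e\<close>-coordinate \<open>m\<close>, and
  \<open>c\<close> is the point of the edge with the same \<open>f\<close>-coordinate as \<open>k\<close>. The correction \<open>B u\<close> is \<open>(p - c) \<bullet> u\<close>
  on the normal cone of the hull at \<open>p\<close> plus \<open>m * (u \<bullet> e)\<close> on the quadrant opposite to \<open>e\<close> and \<open>f\<close>.\<close>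
lemma optimal_end:
  assumes o: "optimal F (p # v # w # rest)" and F: "finite F" "F \<noteq> {}"
  defines "V \<equiv> set (p # v # w # rest)"
  shows "\<exists>c k B. c \<in> closed_segment p v \<and> k \<in> F \<and> integrable circ B \<and>
     (\<integral>u. B u \<partial>circ) \<le> dist p c - dist c k \<and>
     (\<forall>u. (\<forall>x\<in>V. x \<bullet> u \<le> p \<bullet> u) \<longrightarrow> hmax F u \<le> c \<bullet> u + B u) \<and>
     (\<forall>u. \<not> (\<forall>x\<in>V. x \<bullet> u \<le> p \<bullet> u) \<longrightarrow> 0 \<le> B u)"
proof -
  let ?xs = "p # v # w # rest"
  have d: "distinct ?xs" using o by (rule optimal_distinct)
  have cov: "F \<subseteq> convex hull V" using o by (simp add: optimal_def covers_def V_def)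
  have min: "plen ?xs \<le> plen ys" if "covers F ys" "length ys \<le> length ?xs" for ys
    using o that by (auto simp: optimal_def)
  define \<sigma> where "\<sigma> = sgn (crs (v - p) (w - p))"
  have w0: "crs (v - p) (w - p) \<noteq> 0" using optimal_not_collinear[OF o, of p v w] d by auto
  have \<sigma>: "\<sigma> = 1 \<or> \<sigma> = -1" using w0 by (auto simp: \<sigma>_def sgn_if)
  have side: "0 < \<sigma> * crs (v - p) (x - p)" if "x \<in> set (w # rest)" for x
    using optimal_one_side[of F "[]" p v w rest] o that
    by (auto simp: \<sigma>_def sgn_if zero_less_mult_iff)
  \<comment> \<open>The cotangent of the angle at \<open>p\<close> between \<open>v\<close> and
    \<open>x\<close>. Its minimiser spans the largest angle with \<open>v\<close>, so it is the
    other neighbour of \<open>p\<close> on the boundary of the hull.\<close>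
  define q where "q x = ((x - p) \<bullet> (v - p)) / (\<sigma> * crs (v - p) (x - p))" for x
  obtain s where s: "s \<in> set (w # rest)" "\<And>x. x \<in> set (w # rest) \<Longrightarrow> q s \<le> q x"
    using arg_min_if_finite[of "set (w # rest)" q] by (metis List.finite_set list.distinct(1) not_le_imp_less set_empty)
  have frac: "a * d \<le> c * b" if "a / b \<le> c / d" "0 < b" "0 < d" for a b c d :: real
    using that by (simp add: field_simps)
  have sside: "\<sigma> * crs (s - p) (x - p) \<le> 0" if "x \<in> V" for x
  proof -
    consider "x = p" | "x = v" | "x \<in> set (w # rest)" using \<open>x \<in> V\<close> by (auto simp: V_def)
    then show ?thesis
    proof cases
      case 2
      then show ?thesis using side[OF s(1)] crs_swap[of "s - p" "v - p"] by simp
    next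
      case 3
      have "q s \<le> q x" using s(2) 3 by simp
      then have "((s - p) \<bullet> (v - p)) * (\<sigma> * crs (v - p) (x - p)) \<le> ((x - p) \<bullet> (v - p)) * (\<sigma> * crs (v - p) (s - p))"
        using frac[OF _ side[OF s(1)] side[OF 3]] unfolding q_def by blast
      moreover have "((s - p) \<bullet> (v - p)) * (\<sigma> * crs (v - p) (x - p)) - ((x - p) \<bullet> (v - p)) * (\<sigma> * crs (v - p) (s - p))
         = (\<sigma> * crs (s - p) (x - p)) * ((v - p) \<bullet> (v - p))"
        unfolding crs_def inner_complex_def by algebra
      ultimately have "(\<sigma> * crs (s - p) (x - p)) * ((v - p) \<bullet> (v - p)) \<le> 0" by simp
      moreover have "(v - p) \<bullet> (v - p) > 0" using d by auto
      ultimately show ?thesis by (simp add: mult_le_0_iff)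
    qed auto
  qed
  have sp: "s \<noteq> p" "s \<noteq> v" using s(1) d by auto
  \<comment> \<open>At an obtuse angle \<open>p\<close> could move away from \<open>s\<close>, along
    their common line, to the foot of the perpendicular from \<open>v\<close>. The first edge gets
    shorter, and the new hull contains the old one.\<close>
  have acute: "0 \<le> (v - p) \<bullet> (s - p)"
  proof (rule ccontr)
    assume neg: "\<not> 0 \<le> (v - p) \<bullet> (s - p)"
    define S where "S = (s - p) \<bullet> (s - p)"
    have S: "S > 0" using sp by (simp add: S_def)
    define e where "e = - ((v - p) \<bullet> (s - p)) / S"
    have e: "e > 0" "e * S = - ((v - p) \<bullet> (s - p))" using neg S by (auto simp: e_def divide_less_0_iff not_le)
    let ?p = "p - e *\<^sub>R (s - p)"
    define d where "d = 1/(1+e)"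
    have d: "d * (1 + e) = 1" "0 < d" using e by (auto simp: d_def)
    then have d': "1 - d * e = d" by (simp add: algebra_simps)
    have "(1 - d * e) *\<^sub>R ?p + (d * e) *\<^sub>R s = (d * (1 + e)) *\<^sub>R p"
      unfolding d' by (simp add: algebra_simps)
    then have "p = (1 - d * e) *\<^sub>R ?p + (d * e) *\<^sub>R s" unfolding d by simp
    moreover have "0 \<le> d * e" "d * e \<le> 1" using d d' e by auto
    ultimately have "p \<in> closed_segment ?p s" unfolding in_segment by blast
    then have "p \<in> convex hull (set (?p # v # w # rest))"
      using closed_segment_subset_convex_hull[of ?p "set (?p # v # w # rest)" s] s(1) by (auto intro: hull_inc)
    then have "convex hull V \<subseteq> convex hull (set (?p # v # w # rest))"
      by (rule hull_insert_absorb) (auto simp: V_def)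
    then have "covers F (?p # v # w # rest)" using cov by (simp add: covers_def)
    from min[OF this] have "dist p v \<le> dist ?p v" by simp
    then have "norm (v - p) \<le> norm ((v - p) + e *\<^sub>R (s - p))" by (simp add: dist_norm norm_minus_commute algebra_simps)
    then have "(v - p) \<bullet> (v - p) \<le> ((v - p) + e *\<^sub>R (s - p)) \<bullet> ((v - p) + e *\<^sub>R (s - p))" by (simp add: norm_le)
    also have "\<dots> = (v - p) \<bullet> (v - p) + 2 * e * ((v - p) \<bullet> (s - p)) + e * (e * S)"
      by (simp add: inner_add_left inner_add_right inner_commute S_def algebra_simps)
    finally have "0 \<le> e * ((v - p) \<bullet> (s - p))" unfolding e(2) by (simp add: algebra_simps)
    then show False using e neg by (simp add: zero_le_mult_iff)
  qed
  have touch: "F \<inter> closed_segment p v \<noteq> {}"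
    by (rule optimal_first_edge_touches[OF o F side s(1) _ acute]) (use sside in \<open>auto simp: V_def\<close>)
  define e where "e = sgn (s - p)"
  define f where "f = (- \<sigma>) *\<^sub>R (\<i> * e)"
  have ne: "norm e = 1" using sp by (simp add: e_def norm_sgn)
  have f: "f = \<i> * e \<or> f = - \<i> * e" using \<sigma> by (auto simp: f_def)
  have ee: "e \<bullet> e = 1" "f \<bullet> f = 1" "e \<bullet> f = 0"
    using ne f by (auto simp: dot_square_norm norm_mult inner_complex_def)
  have es: "s - p = norm (s - p) *\<^sub>R e" using sp by (simp add: e_def sgn_div_norm)
  have ns: "norm (s - p) > 0" using sp by simp
  have decomp: "z = (z \<bullet> e) *\<^sub>R e + (z \<bullet> f) *\<^sub>R f" for z
  proof -
    have e1: "Re e * Re e + Im e * Im e = 1" using ee(1) by (simp add: inner_complex_def)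
    have "(z \<bullet> e) *\<^sub>R e + (z \<bullet> f) *\<^sub>R f = (z \<bullet> e) *\<^sub>R e + (z \<bullet> (\<i> * e)) *\<^sub>R (\<i> * e)" using f by auto
    also have "\<dots> = z" unfolding complex_eq_iff inner_complex_def using e1 by (simp, algebra)
    finally show ?thesis by simp
  qed
  have frame: "z \<bullet> u = (z \<bullet> e) * (u \<bullet> e) + (z \<bullet> f) * (u \<bullet> f)" for z u
  proof -
    have "z \<bullet> u = ((z \<bullet> e) *\<^sub>R e + (z \<bullet> f) *\<^sub>R f) \<bullet> u" using decomp[of z] by simp
    then show ?thesis by (simp add: inner_add_left inner_commute[of u])
  qed
  have crsf: "(a \<bullet> e) * (b \<bullet> f) - (a \<bullet> f) * (b \<bullet> e) = - \<sigma> * crs a b" for a b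
  proof -
    have e1: "Re e * Re e + Im e * Im e = 1" using ee(1) by (simp add: inner_complex_def)
    have "(a \<bullet> e) * (b \<bullet> (\<i> * e)) - (a \<bullet> (\<i> * e)) * (b \<bullet> e) = crs a b"
      unfolding crs_def inner_complex_def using e1 by (simp, algebra)
    then show ?thesis by (simp add: f_def algebra_simps)
  qed
  have efs: "- \<sigma> * crs e z = z \<bullet> f" for z using crsf[of e z] ee by (simp add: inner_commute)
  define v1 v2 where "v1 = (v - p) \<bullet> e" and "v2 = (v - p) \<bullet> f"
  have v1: "v1 \<ge> 0"
    using acute es ns by (metis inner_scaleR_right less_eq_real_def mult_less_cancel_left_pos not_le v1_def mult_zero_right)
  have xf: "0 \<le> (x - p) \<bullet> f" if "x \<in> V" for x
  proof -
    have "0 \<le> - \<sigma> * crs (s - p) (x - p)" using sside[OF that] by simp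
    also have "\<dots> = norm (s - p) * ((x - p) \<bullet> f)" by (subst es) (simp add: crs_scale efs[symmetric])
    finally show ?thesis using ns by (simp add: zero_le_mult_iff)
  qed
  have v2: "v2 > 0"
  proof -
    have "0 < - \<sigma> * crs (s - p) (v - p)" using side[OF s(1)] crs_swap[of "s - p" "v - p"] by simp
    also have "\<dots> = norm (s - p) * ((v - p) \<bullet> f)" by (subst es) (simp add: crs_scale efs[symmetric])
    finally show ?thesis using ns by (simp add: zero_less_mult_iff v2_def)
  qed
  have below: "v1 * ((x - p) \<bullet> f) \<le> v2 * ((x - p) \<bullet> e)" if "x \<in> V" for x
  proof -
    have "0 \<le> \<sigma> * crs (v - p) (x - p)" using that side[of x] by (cases "x = p \<or> x = v") (auto simp: V_def)
    then show ?thesis using crsf[of "v - p" "x - p"] by (simp add: v1_def v2_def)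
  qed
  have xe: "0 \<le> (x - p) \<bullet> e" if "x \<in> V" for x
  proof -
    have "0 \<le> v2 * ((x - p) \<bullet> e)" using below[OF that] xf[OF that] v1 by (meson mult_nonneg_nonneg order_trans)
    then show ?thesis using v2 by (simp add: zero_le_mult_iff)
  qed
  have Ff: "0 \<le> (y - p) \<bullet> f" if "y \<in> F" for y
  proof -
    have "y \<bullet> (- f) \<le> p \<bullet> (- f)"
      by (rule hull_inner_le[of _ V]) (use that cov xf in \<open>auto simp: inner_diff_left\<close>)
    then show ?thesis by (simp add: inner_diff_left)
  qed
  have Fb: "v1 * ((y - p) \<bullet> f) \<le> v2 * ((y - p) \<bullet> e)" if "y \<in> F" for y
  proof -
    have "y \<bullet> (v1 *\<^sub>R f - v2 *\<^sub>R e) \<le> p \<bullet> (v1 *\<^sub>R f - v2 *\<^sub>R e)"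
      by (rule hull_inner_le[of _ V]) (use that cov below in \<open>auto simp: inner_diff_left inner_diff_right algebra_simps\<close>)
    then show ?thesis by (simp add: inner_diff_left inner_diff_right algebra_simps)
  qed
  obtain z where z: "z \<in> F" "z \<in> closed_segment p v" using touch by auto
  then obtain \<tau> where \<tau>: "0 \<le> \<tau>" "\<tau> \<le> 1" "z - p = \<tau> *\<^sub>R (v - p)" by (auto simp: in_segment algebra_simps)
  obtain k0 where k0: "k0 \<in> F" "\<And>y. y \<in> F \<Longrightarrow> (k0 - p) \<bullet> e \<le> (y - p) \<bullet> e"
    using arg_min_if_finite[of F "\<lambda>y. (y - p) \<bullet> e"] F by (metis not_le_imp_less)
  \<comment> \<open>\<open>c\<close> has to lie on the edge, so \<open>k\<close> may not be higher
    than \<open>v\<close> in the direction \<open>f\<close>. If \<open>v1 = 0\<close>, a point of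
    \<open>F\<close> on the edge already has the least \<open>e\<close>-coordinate. Otherwise such a
    point bounds the least \<open>e\<close>-coordinate by \<open>v1\<close>, and the line through
    \<open>p\<close> and \<open>v\<close> then bounds the height.\<close>
  obtain k where k: "k \<in> F" "\<And>y. y \<in> F \<Longrightarrow> (k - p) \<bullet> e \<le> (y - p) \<bullet> e" "(k - p) \<bullet> f \<le> v2"
  proof (cases "v1 = 0")
    case True
    have ze: "(z - p) \<bullet> e = 0" "(z - p) \<bullet> f \<le> v2" using \<tau> True v2 by (auto simp: v1_def v2_def mult_left_le_one_le)
    have "0 \<le> (y - p) \<bullet> e" if "y \<in> F" for y using Fb[OF that] v2 True by (simp add: zero_le_mult_iff)
    then show ?thesis using that[of z] z ze by auto
  next
    case False
    then have v1': "v1 > 0" using v1 by simp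
    have "(k0 - p) \<bullet> e \<le> \<tau> * v1" using k0(2)[OF z(1)] \<tau>(3) by (simp add: v1_def)
    also have "\<dots> \<le> v1" using \<tau> v1 by (simp add: mult_left_le_one_le)
    finally have "v1 * ((k0 - p) \<bullet> f) \<le> v2 * v1" using Fb[OF k0(1)] v2 by (meson less_imp_le mult_left_mono order_trans)
    then have "(k0 - p) \<bullet> f \<le> v2" using v1' by (simp add: mult.commute)
    then show ?thesis using that[of k0] k0 by auto
  qed
  define m k2 \<kappa> where "m = (k - p) \<bullet> e" and "k2 = (k - p) \<bullet> f" and "\<kappa> = k2 / v2"
  have kap: "0 \<le> \<kappa>" "\<kappa> \<le> 1" using Ff[OF k(1)] k(3) v2 by (auto simp: \<kappa>_def k2_def)
  define c where "c = p + \<kappa> *\<^sub>R (v - p)"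
  have c: "c \<in> closed_segment p v" unfolding in_segment c_def using kap by (intro exI[of _ \<kappa>]) (auto simp: algebra_simps)
  have m0: "\<kappa> * v1 \<le> m" using Fb[OF k(1)] v2 by (simp add: \<kappa>_def m_def k2_def field_simps)
  have dck: "dist c k = m - \<kappa> * v1"
  proof -
    have "k - c = (m - \<kappa> * v1) *\<^sub>R e"
    proof -
      have "k - c = (k - p) - \<kappa> *\<^sub>R (v - p)" by (simp add: c_def)
      also have "\<dots> = (m - \<kappa> * v1) *\<^sub>R e + (k2 - \<kappa> * v2) *\<^sub>R f"
        by (subst decomp[of "k - p"], subst decomp[of "v - p"])
           (simp add: m_def k2_def v1_def v2_def algebra_simps)
      also have "k2 - \<kappa> * v2 = 0" using v2 by (simp add: \<kappa>_def)
      finally show ?thesis by simp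
    qed
    then show ?thesis using m0 ne by (simp add: dist_norm norm_minus_commute[of c k])
  qed
  have dpc: "dist p c = \<kappa> * sqrt (v1\<^sup>2 + v2\<^sup>2)"
  proof -
    have "(v - p) \<bullet> (v - p) = v1\<^sup>2 + v2\<^sup>2" using frame[of "v - p" "v - p"] by (simp add: v1_def v2_def power2_eq_square)
    then have "norm (v - p) = sqrt (v1\<^sup>2 + v2\<^sup>2)" by (simp add: norm_eq_sqrt_inner)
    then show ?thesis using kap by (simp add: c_def dist_norm)
  qed
  define B where "B u = (if u \<bullet> e \<le> 0 \<and> u \<bullet> (v - p) \<le> 0 then (p - c) \<bullet> u else 0)
      + (if u \<bullet> e \<le> 0 \<and> u \<bullet> f \<le> 0 then m * (u \<bullet> e) else 0)" for u
  have [measurable]: "B \<in> borel_measurable borel" unfolding B_def by measurable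
  have intB: "integrable circ B"
  proof (rule integrable_circI)
    fix u :: complex assume u: "norm u = 1"
    have "\<bar>(p - c) \<bullet> u\<bar> \<le> norm (p - c)" "\<bar>u \<bullet> e\<bar> \<le> 1"
      using Cauchy_Schwarz_ineq2[of "p - c" u] Cauchy_Schwarz_ineq2[of u e] u ne by auto
    then have "\<bar>m * (u \<bullet> e)\<bar> \<le> \<bar>m\<bar>" by (simp add: abs_mult mult_left_le)
    then show "\<bar>B u\<bar> \<le> norm (p - c) + \<bar>m\<bar>" using \<open>\<bar>(p - c) \<bullet> u\<bar> \<le> norm (p - c)\<close>
      unfolding B_def by (auto intro: order_trans[OF abs_triangle_ineq])
  qed simp
  have "(\<integral>u. B u \<partial>circ) = (\<integral>u. B (Re u *\<^sub>R e + Im u *\<^sub>R f) \<partial>circ)"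
    by (rule integral_circ_frame[OF _ ne f]) simp
  also have "\<dots> = (\<integral>u. \<kappa> * (if Re u \<le> 0 \<and> Re u * v1 + Im u * v2 \<le> 0 then - (Re u * v1 + Im u * v2) else 0)
      + m * (if Re u \<le> 0 \<and> Im u \<le> 0 then Re u else 0) \<partial>circ)"
  proof (rule Bochner_Integration.integral_cong)
    fix u :: complex
    have 1: "(Re u *\<^sub>R e + Im u *\<^sub>R f) \<bullet> e = Re u" "(Re u *\<^sub>R e + Im u *\<^sub>R f) \<bullet> f = Im u"
      using ee by (simp_all add: inner_add_left inner_commute[of f e])
    have 2: "(Re u *\<^sub>R e + Im u *\<^sub>R f) \<bullet> (v - p) = Re u * v1 + Im u * v2"
      by (simp add: inner_add_left v1_def v2_def inner_commute[of e "v - p"] inner_commute[of f "v - p"])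
    have 3: "(p - c) \<bullet> (Re u *\<^sub>R e + Im u *\<^sub>R f) = - \<kappa> * (Re u * v1 + Im u * v2)"
      unfolding 2[symmetric] by (simp add: c_def inner_commute[of _ "v - p"])
    show "B (Re u *\<^sub>R e + Im u *\<^sub>R f) = \<kappa> * (if Re u \<le> 0 \<and> Re u * v1 + Im u * v2 \<le> 0 then - (Re u * v1 + Im u * v2) else 0)
      + m * (if Re u \<le> 0 \<and> Im u \<le> 0 then Re u else 0)"
      unfolding B_def 1 2 3 by (auto simp: algebra_simps)
  qed simp
  \<comment> \<open>The cone contributes \<open>\<kappa>\<close> times the length of the first edge,
    which is the distance from \<open>p\<close> to \<open>c\<close>, and the remainder
    \<open>\<kappa> * v1 - m\<close> is minus the distance from \<open>c\<close> to
    \<open>k\<close>.\<close>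
  also have "\<dots> = \<kappa> * (sqrt (v1\<^sup>2 + v2\<^sup>2) + v1) + m * (-1)"
  proof -
    have i1: "integrable circ (\<lambda>u. if Re u \<le> 0 \<and> Re u * v1 + Im u * v2 \<le> 0 then - (Re u * v1 + Im u * v2) else 0)"
    proof (rule integrable_circI)
      fix u :: complex assume u: "norm u = 1"
      have "\<bar>Re u\<bar> \<le> 1" "\<bar>Im u\<bar> \<le> 1" using abs_Re_le_cmod[of u] abs_Im_le_cmod[of u] u by auto
      then have "\<bar>Re u * v1\<bar> \<le> v1" "\<bar>Im u * v2\<bar> \<le> v2" using v1 v2 by (auto simp: abs_mult mult_left_le_one_le)
      then show "\<bar>if Re u \<le> 0 \<and> Re u * v1 + Im u * v2 \<le> 0 then - (Re u * v1 + Im u * v2) else 0\<bar> \<le> v1 + v2"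
        by (auto simp: abs_le_iff)
    qed simp
    have i2: "integrable circ (\<lambda>u. if Re u \<le> 0 \<and> Im u \<le> 0 then Re u else 0)"
    proof (rule integrable_circI[where C=1])
      fix u :: complex assume "norm u = 1"
      then show "\<bar>if Re u \<le> 0 \<and> Im u \<le> 0 then Re u else 0\<bar> \<le> 1" using abs_Re_le_cmod[of u] by auto
    qed simp
    show ?thesis
      using i1 i2 integral_circ_cone[OF v1 v2] integral_circ_quadrant by simp
  qed
  finally have val: "(\<integral>u. B u \<partial>circ) = dist p c - dist c k" by (simp add: dck dpc algebra_simps)
  \<comment> \<open>Here \<open>u\<close> lies in the normal cone at \<open>p\<close>, so the first
    part of \<open>B\<close> restores \<open>p \<bullet> u\<close>. If moreover
    \<open>u \<bullet> f \<le> 0\<close>, the second part is justified because points of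
    \<open>F\<close> have \<open>e\<close>-coordinate at least \<open>m\<close> and nonnegative
    \<open>f\<close>-coordinate relative to \<open>p\<close>.\<close>
  have up: "hmax F u \<le> c \<bullet> u + B u" if u: "\<forall>x\<in>V. x \<bullet> u \<le> p \<bullet> u" for u
  proof -
    have "s \<in> V" "v \<in> V" using s(1) by (auto simp: V_def)
    then have sv: "(s - p) \<bullet> u \<le> 0" "(v - p) \<bullet> u \<le> 0" using u by (auto simp: inner_diff_left)
    then have ue: "u \<bullet> e \<le> 0" using es ns by (metis inner_commute inner_scaleR_left mult_le_0_iff not_le)
    have uv: "u \<bullet> (v - p) \<le> 0" using sv by (simp add: inner_commute)
    have Bu: "c \<bullet> u + B u = p \<bullet> u + (if u \<bullet> f \<le> 0 then m * (u \<bullet> e) else 0)"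
      unfolding B_def using ue uv by (simp add: inner_diff_left)
    have "y \<bullet> u \<le> c \<bullet> u + B u" if "y \<in> F" for y
    proof (cases "u \<bullet> f \<le> 0")
      case True
      have "(y - p) \<bullet> u = ((y - p) \<bullet> e) * (u \<bullet> e) + ((y - p) \<bullet> f) * (u \<bullet> f)" by (rule frame)
      also have "\<dots> \<le> m * (u \<bullet> e) + 0"
      proof (rule add_mono)
        show "((y - p) \<bullet> e) * (u \<bullet> e) \<le> m * (u \<bullet> e)"
          using k(2)[OF that] ue by (intro mult_right_mono_neg) (auto simp: m_def)
        show "((y - p) \<bullet> f) * (u \<bullet> f) \<le> 0" using Ff[OF that] True by (simp add: mult_le_0_iff)
      qed
      finally show ?thesis using Bu True by (simp add: inner_diff_left)
    next
      case False
      have "y \<bullet> u \<le> p \<bullet> u" by (rule hull_inner_le[of _ V]) (use that cov u in auto)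
      then show ?thesis using Bu False by simp
    qed
    then show ?thesis using F by (simp add: hmax_le_iff)
  qed
  \<comment> \<open>The hull lies in the quadrant at \<open>p\<close> spanned by \<open>e\<close>
    and \<open>f\<close>, so \<open>p\<close> is maximal in every direction of the opposite
    quadrant. Off the normal cone the term with \<open>m\<close> is therefore absent, and the other
    one is nonnegative.\<close>
  have lo: "0 \<le> B u" if u: "\<not> (\<forall>x\<in>V. x \<bullet> u \<le> p \<bullet> u)" for u
  proof -
    have "\<not> (u \<bullet> e \<le> 0 \<and> u \<bullet> f \<le> 0)"
    proof
      assume neg: "u \<bullet> e \<le> 0 \<and> u \<bullet> f \<le> 0"
      have "x \<bullet> u \<le> p \<bullet> u" if "x \<in> V" for x
      proof -
        have "(x - p) \<bullet> u \<le> 0" unfolding frame[of "x - p" u]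
          using neg xe[OF that] xf[OF that] by (intro add_nonpos_nonpos mult_nonneg_nonpos) auto
        then show ?thesis by (simp add: inner_diff_left)
      qed
      then show False using u by auto
    qed
    moreover have "(p - c) \<bullet> u = - \<kappa> * (u \<bullet> (v - p))" by (simp add: c_def inner_commute)
    ultimately show ?thesis unfolding B_def using kap by (auto simp: mult_nonneg_nonpos)
  qed
  show ?thesis using c k(1) intB val up lo by (intro exI[of _ c] exI[of _ k] exI[of _ B]) auto
qed

section \<open>The planar inequality for finite sets\<close>

lemma AE_circ_inner_nonzero:
  assumes "z \<noteq> 0" shows "AE u in circ. z \<bullet> u \<noteq> 0"
proof -
  define e where "e = sgn z"
  have e: "norm e = 1" "z = norm z *\<^sub>R e" using assms by (auto simp: e_def norm_sgn sgn_div_norm)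
  have e1: "Re e * Re e + Im e * Im e = 1" using e(1) by (metis cmod_power2 one_power2 power2_eq_square)
  have ze: "z \<bullet> (e * u) = norm z * Re u" for u
  proof -
    have "e \<bullet> (e * u) = Re u" unfolding inner_complex_def using e1 by (simp, algebra)
    then show ?thesis by (subst e(2)) (simp only: inner_scaleR_left)
  qed
  have "AE t in lborel. t \<in> {0..<2*pi} \<longrightarrow> cos t \<noteq> 0"
  proof -
    have "AE t in lborel. t \<noteq> pi/2 \<and> t \<noteq> 3*pi/2"
      using AE_lborel_singleton[of "pi/2"] AE_lborel_singleton[of "3*pi/2"] by eventually_elim auto
    then show ?thesis
    proof eventually_elim
      case (elim t)
      have "cos t > 0" if "0 \<le> t" "t < pi/2" using that by (intro cos_gt_zero_pi) auto
      moreover have "cos t < 0" if "pi/2 < t" "t < 3*pi/2"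
        using that cos_gt_zero_pi[of "t - pi"] by (simp add: cos_diff)
      moreover have "cos t > 0" if "3*pi/2 < t" "t < 2*pi"
        using that cos_gt_zero_pi[of "t - 2*pi"] by (simp add: cos_diff)
      ultimately show ?case using elim by (auto simp: linorder_neq_iff not_less)
    qed
  qed
  then have "AE u in circ. Re u \<noteq> 0" by (subst AE_circ) auto
  then have "AE u in circ. z \<bullet> (e * u) \<noteq> 0" using assms by (simp add: ze)
  then have "AE u in distr circ borel (\<lambda>u. e * u). z \<bullet> u \<noteq> 0"
    by (subst AE_distr_iff) auto
  then show ?thesis unfolding circ_mult[OF e(1)] .
qed

lemma hmax_mono_hull:
  assumes "finite F" "F \<noteq> {}" "finite G" "F \<subseteq> convex hull G"
  shows "hmax F u \<le> hmax G u"
proof -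
  have "y \<bullet> u \<le> hmax G u" if "y \<in> F" for y
    by (rule hull_inner_le[of _ G]) (use assms that in \<open>auto intro: hmax_ge\<close>)
  then show ?thesis using assms by (simp add: hmax_le_iff)
qed

theorem perimeter_le_plen_plus_diameter:
  fixes F :: "complex set"
  assumes F: "finite F" "F \<noteq> {}" and cov: "F \<subseteq> convex hull (set xs0)"
  shows "(\<integral>u. hmax F u \<partial>circ) \<le> plen xs0 + diameter F"
proof -
  obtain xs where o: "optimal F xs" and le: "plen xs \<le> plen xs0"
    using exists_optimal[OF F(2), of xs0] cov by (auto simp: covers_def)
  have covx: "F \<subseteq> convex hull (set xs)" using o by (simp add: optimal_def covers_def)
  have dF: "dist x y \<le> diameter F" if "x \<in> F" "y \<in> F" for x y
    using diameter_bounded_bound[OF finite_imp_bounded[OF F(1)] that] .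
  have dF0: "0 \<le> diameter F" using dF F(2) by (metis dist_self ex_in_conv)
  have "(\<integral>u. hmax F u \<partial>circ) \<le> plen xs + diameter F"
  proof -
    consider "xs = []" | p where "xs = [p]" | p q where "xs = [p, q]" | p v w rest where "xs = p # v # w # rest"
      by (metis list.exhaust)
    then show ?thesis
    proof cases
      case 1
      then show ?thesis using covx F by simp
    next
      case 2
      have "(\<integral>u. hmax F u \<partial>circ) \<le> (\<integral>u. hmax (set [p]) u \<partial>circ)"
        using F covx 2 by (intro integral_mono integrable_hmax_circ hmax_mono_hull) auto
      also have "\<dots> \<le> plen ([p] @ [hd [p]])" by (rule hmax_closed_polygon) simp
      finally show ?thesis using dF0 2 by simp
    next
      \<comment> \<open>\<open>F\<close> lies on a segment, so its perimeter is twice the distance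
        of its extreme points \<open>a\<close> and \<open>b\<close>: one copy is paid by the path
        and the other by the diameter.\<close>
      case 3
      have "F \<subseteq> closed_segment p q" using covx 3 by (simp add: segment_convex_hull)
      then have "\<forall>x\<in>F. \<exists>t. 0 \<le> t \<and> t \<le> 1 \<and> x = p + t *\<^sub>R (q - p)"
        by (force simp: in_segment algebra_simps)
      then obtain \<tau> where \<tau>: "\<And>x. x \<in> F \<Longrightarrow> 0 \<le> \<tau> x" "\<And>x. x \<in> F \<Longrightarrow> \<tau> x \<le> 1" "\<And>x. x \<in> F \<Longrightarrow> x = p + \<tau> x *\<^sub>R (q - p)"
        by metis
      obtain a where a: "a \<in> F" "\<And>y. y \<in> F \<Longrightarrow> \<tau> a \<le> \<tau> y"
        using arg_min_if_finite[of F \<tau>] F by (metis not_le_imp_less)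
      obtain b where b: "b \<in> F" "\<And>y. y \<in> F \<Longrightarrow> \<tau> y \<le> \<tau> b"
        using arg_min_if_finite[of F "\<lambda>x. - \<tau> x"] F by (metis neg_less_iff_less not_le_imp_less)
      have "y \<in> closed_segment a b" if "y \<in> F" for y
      proof -
        have lin: "linear (\<lambda>t. t *\<^sub>R (q - p))" by (simp add: linear_iff scaleR_add_left)
        have "\<tau> y \<in> closed_segment (\<tau> a) (\<tau> b)" using a(2)[OF that] b(2)[OF that] by (simp add: closed_segment_eq_real_ivl)
        then have "(\<lambda>t. t *\<^sub>R (q - p)) (\<tau> y) \<in> closed_segment (\<tau> a *\<^sub>R (q - p)) (\<tau> b *\<^sub>R (q - p))"
          using closed_segment_linear_image[OF lin, of "\<tau> a" "\<tau> b"] by blast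
        then have "p + \<tau> y *\<^sub>R (q - p) \<in> closed_segment (p + \<tau> a *\<^sub>R (q - p)) (p + \<tau> b *\<^sub>R (q - p))"
          using closed_segment_translation[of p "\<tau> a *\<^sub>R (q - p)" "\<tau> b *\<^sub>R (q - p)"] by blast
        then show ?thesis using \<tau>(3) a(1) b(1) that by metis
      qed
      then have "F \<subseteq> convex hull (set [a, b])" by (auto simp: segment_convex_hull)
      then have "(\<integral>u. hmax F u \<partial>circ) \<le> (\<integral>u. hmax (set [a, b]) u \<partial>circ)"
        using F by (intro integral_mono integrable_hmax_circ hmax_mono_hull) auto
      also have "\<dots> \<le> plen ([a, b] @ [hd [a, b]])" by (rule hmax_closed_polygon) simp
      also have "\<dots> = 2 * dist a b" by (simp add: dist_commute)
      finally have 1: "(\<integral>u. hmax F u \<partial>circ) \<le> 2 * dist a b" .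
      have "b - a = (\<tau> b - \<tau> a) *\<^sub>R (q - p)" using \<tau>(3)[OF a(1)] \<tau>(3)[OF b(1)] by (metis add_diff_cancel_left scaleR_left_diff_distrib)
      then have "dist a b = \<bar>\<tau> b - \<tau> a\<bar> * dist p q" by (simp add: dist_norm norm_minus_commute[of a b] norm_minus_commute[of p q])
      also have "\<dots> \<le> 1 * dist p q" using \<tau>(1,2)[OF a(1)] \<tau>(1,2)[OF b(1)] by (intro mult_right_mono) auto
      finally show ?thesis using 1 dF[OF a(1) b(1)] 3 by simp
    next
      case 4
      have d: "distinct xs" using o by (rule optimal_distinct)
      have "Suc (Suc (Suc 0)) \<le> length (rev xs)" using 4 by simp
      then obtain q w' v' rest' where rv: "rev xs = q # w' # v' # rest'"
        unfolding Suc_le_length_iff by blast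
      have r: "optimal F (q # w' # v' # rest')" using optimal_rev[OF o] rv by simp
      obtain c k B where p_end: "c \<in> closed_segment p v" "k \<in> F" "integrable circ B" "(\<integral>u. B u \<partial>circ) \<le> dist p c - dist c k"
        "\<And>u. (\<forall>x\<in>set xs. x \<bullet> u \<le> p \<bullet> u) \<Longrightarrow> hmax F u \<le> c \<bullet> u + B u"
        "\<And>u. \<not> (\<forall>x\<in>set xs. x \<bullet> u \<le> p \<bullet> u) \<Longrightarrow> 0 \<le> B u"
        using optimal_end[of F p v w rest] o F 4 by blast
      have setr: "set (q # w' # v' # rest') = set xs" using rv by (metis set_rev)
      obtain c' k' B' where q_end: "c' \<in> closed_segment q w'" "k' \<in> F" "integrable circ B'" "(\<integral>u. B' u \<partial>circ) \<le> dist q c' - dist c' k'"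
        "\<And>u. (\<forall>x\<in>set xs. x \<bullet> u \<le> q \<bullet> u) \<Longrightarrow> hmax F u \<le> c' \<bullet> u + B' u"
        "\<And>u. \<not> (\<forall>x\<in>set xs. x \<bullet> u \<le> q \<bullet> u) \<Longrightarrow> 0 \<le> B' u"
        using optimal_end[OF r F] unfolding setr by blast
      define ms where "ms = butlast (tl xs)"
      have ms: "xs = p # ms @ [q]" "ms \<noteq> []" "hd ms = v" "last ms = w'"
      proof -
        have "last xs = q" using rv by (metis list.sel(1) hd_rev)
        then show 1: "xs = p # ms @ [q]" using 4 append_butlast_last_id[of "tl xs"] by (simp add: ms_def)
        show 2: "ms \<noteq> []" "hd ms = v" using 4 by (auto simp: ms_def)
        have "q # rev ms @ [p] = q # w' # v' # rest'" using 1 rv by simp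
        then have "hd (rev ms) = w'" using 2(1) by (metis hd_append2 list.inject list.sel(1) rev_is_Nil_conv)
        then show "last ms = w'" by (simp add: hd_rev)
      qed
      have pq: "p \<noteq> q" using d ms by auto
      let ?G = "set (c # ms @ [c'])"
      \<comment> \<open>For almost every direction \<open>p\<close> and \<open>q\<close> are not
        both maximal, so at most one of \<open>B u\<close> and \<open>B' u\<close> can be negative,
        and that one comes with the estimate at its own end. If neither end is maximal, an inner
        vertex supports the hull.\<close>
      have pt: "hmax F u \<le> hmax ?G u + (B u + B' u)" if u: "(p - q) \<bullet> u \<noteq> 0" for u
      proof -
        have c: "c \<bullet> u \<le> hmax ?G u" "c' \<bullet> u \<le> hmax ?G u" by (auto intro: hmax_ge)
        have npq: "\<not> ((\<forall>x\<in>set xs. x \<bullet> u \<le> p \<bullet> u) \<and> (\<forall>x\<in>set xs. x \<bullet> u \<le> q \<bullet> u))"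
        proof
          assume a: "(\<forall>x\<in>set xs. x \<bullet> u \<le> p \<bullet> u) \<and> (\<forall>x\<in>set xs. x \<bullet> u \<le> q \<bullet> u)"
          have "p \<in> set xs" "q \<in> set xs" using ms by auto
          then have "p \<bullet> u = q \<bullet> u" using a by (intro antisym) auto
          then show False using u by (simp add: inner_diff_left)
        qed
        consider "\<forall>x\<in>set xs. x \<bullet> u \<le> p \<bullet> u" | "\<forall>x\<in>set xs. x \<bullet> u \<le> q \<bullet> u"
          | "\<not> (\<forall>x\<in>set xs. x \<bullet> u \<le> p \<bullet> u)" "\<not> (\<forall>x\<in>set xs. x \<bullet> u \<le> q \<bullet> u)" by blast
        then show ?thesis
        proof cases
          case 1
          then have "0 \<le> B' u" using npq q_end(6) by blast
          then show ?thesis using p_end(5)[OF 1] c by linarith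
        next
          case 2
          then have "0 \<le> B u" using npq p_end(6) by blast
          then show ?thesis using q_end(5)[OF 2] c by linarith
        next
          case 3
          obtain x where x: "x \<in> set xs" "hmax (set xs) u = x \<bullet> u" using hmax_attained[of "set xs" u] ms by auto
          have mx: "\<forall>y\<in>set xs. y \<bullet> u \<le> x \<bullet> u" using x(2) hmax_ge[of "set xs" _ u] by auto
          then have "x \<noteq> p" "x \<noteq> q" using 3 by auto
          then have "x \<in> ?G" using x(1) ms by auto
          then have "hmax (set xs) u \<le> hmax ?G u" using x(2) hmax_ge[of ?G x u] by auto
          moreover have "hmax F u \<le> hmax (set xs) u" using hmax_mono_hull[OF F _ covx] by simp
          ultimately show ?thesis using p_end(6)[OF 3(1)] q_end(6)[OF 3(2)] by linarith
        qed
      qed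
      have iG: "integrable circ (hmax ?G)" by (intro integrable_hmax_circ) auto
      have "(\<integral>u. hmax F u \<partial>circ) \<le> (\<integral>u. hmax ?G u + (B u + B' u) \<partial>circ)"
      proof (rule integral_mono_AE)
        have "AE u in circ. (p - q) \<bullet> u \<noteq> 0" using pq by (intro AE_circ_inner_nonzero) simp
        then show "AE u in circ. hmax F u \<le> hmax ?G u + (B u + B' u)" by eventually_elim (rule pt)
        show "integrable circ (hmax F)" using F by (rule integrable_hmax_circ)
        show "integrable circ (\<lambda>u. hmax ?G u + (B u + B' u))" using iG p_end(3) q_end(3) by auto
      qed
      also have "\<dots> = (\<integral>u. hmax ?G u \<partial>circ) + ((\<integral>u. B u \<partial>circ) + (\<integral>u. B' u \<partial>circ))"
        using iG p_end(3) q_end(3) by simp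
      finally have 1: "(\<integral>u. hmax F u \<partial>circ) \<le> (\<integral>u. hmax ?G u \<partial>circ) + (dist p c - dist c k) + (dist q c' - dist c' k')"
        using p_end(4) q_end(4) by linarith
      \<comment> \<open>The detours to \<open>k\<close> and \<open>k'\<close> cost the distances
        from \<open>c\<close> and \<open>c'\<close>, exactly the amounts that the two end
        corrections give back; only the closing edge between \<open>k'\<close> and \<open>k\<close>
        remains.\<close>
      let ?Z = "k # c # ms @ [c', k']"
      have "(\<integral>u. hmax ?G u \<partial>circ) \<le> (\<integral>u. hmax (set ?Z) u \<partial>circ)"
        using iG by (intro integral_mono integrable_hmax_circ hmax_mono_hull) (auto intro: hull_inc)
      also have "\<dots> \<le> plen (?Z @ [hd ?Z])" by (rule hmax_closed_polygon) simp
      also have "\<dots> = dist k c + (dist c (hd ms) + (plen ms + (dist (last ms) c' + (dist c' k' + dist k' k))))"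
      proof -
        have "plen (ms @ [c', k', k]) = plen ms + (dist (last ms) c' + (dist c' k' + dist k' k))"
          using plen_snoc[of "ms @ [c', k']" k] plen_snoc[of "ms @ [c']" k'] plen_snoc[OF ms(2), of c'] by simp
        moreover have "plen (c # ms @ [c', k', k]) = dist c (hd ms) + plen (ms @ [c', k', k])"
          using ms(2) by (cases ms) auto
        ultimately show ?thesis by simp
      qed
      finally have 2: "(\<integral>u. hmax ?G u \<partial>circ) \<le> dist k c + (dist c v + (plen ms + (dist w' c' + (dist c' k' + dist k' k))))"
        using ms by simp
      have 3: "plen xs = dist p v + plen ms + dist w' q"
      proof -
        have "plen (ms @ [q]) = plen ms + dist (last ms) q" using ms(2) by (rule plen_snoc)
        moreover have "plen (p # ms @ [q]) = dist p (hd ms) + plen (ms @ [q])" using ms(2) by (cases ms) auto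
        ultimately show ?thesis using ms by simp
      qed
      have "dist p v = dist p c + dist c v" "dist q w' = dist q c' + dist c' w'"
        using p_end(1) q_end(1) by (auto simp: between_mem_segment[symmetric] between)
      then show ?thesis using 1 2 3 dF[OF p_end(2) q_end(2)]
        by (simp add: dist_commute)
    qed
  qed
  then show ?thesis using le by simp
qed

subsection \<open>Steiner formula\<close>

text \<open>The library computes the volume of linear images only for well-ordered index types.\<close>

lemma measure_linear_factor:
  fixes f :: "real^'n \<Rightarrow> real^'n"
  assumes "linear f"
  shows "\<exists>c. \<forall>S\<in>lmeasurable. f ` S \<in> lmeasurable \<and> measure lebesgue (f ` S) = c * measure lebesgue S"
proof -
  define Q where "Q f \<longleftrightarrow> (\<exists>c. \<forall>S\<in>lmeasurable. f ` S \<in> lmeasurable \<and> measure lebesgue (f ` S) = c * measure lebesgue S)"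
    for f :: "real^'n \<Rightarrow> real^'n"
  have "Q f"
proof (rule induct_linear_elementary[OF assms, where P = Q])
  fix f g :: "real^'n \<Rightarrow> real^'n" assume "Q f" "Q g"
  then obtain c d where cd: "\<forall>S\<in>lmeasurable. f ` S \<in> lmeasurable \<and> measure lebesgue (f ` S) = c * measure lebesgue S"
    "\<forall>S\<in>lmeasurable. g ` S \<in> lmeasurable \<and> measure lebesgue (g ` S) = d * measure lebesgue S" unfolding Q_def by blast
  then show "Q (f \<circ> g)" unfolding Q_def image_comp[symmetric]
    by (intro exI[of _ "c * d"] ballI) (simp only: mult.assoc simp_thms)
next
  fix f :: "real^'n \<Rightarrow> real^'n" and i assume 2: "linear f" "\<And>x. f x $ i = 0"
  have "\<not> surj f"
  proof
    assume "surj f"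
    from surjD[OF this, of "axis i 1"] obtain x where "axis i 1 = f x" by blast
    then have "axis i (1::real) $ i = f x $ i" by (rule arg_cong)
    then show False using 2(2)[of x] by (simp add: axis_def)
  qed
  then have "\<not> inj f" using 2(1) linear_injective_imp_surjective by blast
  then have "negligible (f ` S)" for S using 2(1) negligible_linear_singular_image by blast
  then show "Q f" unfolding Q_def by (intro exI[of _ 0]) (simp add: negligible_iff_measure)
next
  fix c :: "'n \<Rightarrow> real"
  show "Q (\<lambda>x. \<chi> i. c i * x $ i)" unfolding Q_def
    by (intro exI[of _ "\<bar>prod c UNIV\<bar>"] ballI conjI measurable_stretch measure_stretch)
next
  fix m n :: 'n assume "m \<noteq> n"
  let ?h = "\<lambda>x::real^'n. \<chi> i. x $ Transposition.transpose m n i"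
  have lin: "linear ?h" by (rule linearI) (simp_all add: vec_eq_iff)
  have inv: "?h (?h x) = x" for x by (simp add: vec_eq_iff)
  have box: "?h ` cbox a b = cbox (?h a) (?h b)" for a b
  proof (intro equalityI subsetI)
    fix y assume "y \<in> cbox (?h a) (?h b)"
    then have y: "a $ Transposition.transpose m n i \<le> y $ i \<and> y $ i \<le> b $ Transposition.transpose m n i" for i
      by (simp add: mem_box_cart)
    have "?h y \<in> cbox a b" unfolding mem_box_cart
    proof
      fix i show "a $ i \<le> ?h y $ i \<and> ?h y $ i \<le> b $ i"
        using y[of "Transposition.transpose m n i"] by simp
    qed
    then show "y \<in> ?h ` cbox a b" using inv[of y, symmetric] by (rule rev_image_eqI)
  qed (auto simp: mem_box_cart)
  have "measure lebesgue (?h ` cbox a b) = 1 * measure lebesgue (cbox a b)" for a b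
  proof (cases "cbox a b = {}")
    case False
    then have "cbox (?h a) (?h b) \<noteq> {}" using box by (metis image_is_empty)
    moreover have "(\<Prod>i\<in>UNIV. b $ Transposition.transpose m n i - a $ Transposition.transpose m n i) = (\<Prod>i\<in>UNIV. b $ i - a $ i)"
      by (rule prod.reindex_bij_betw[of "Transposition.transpose m n" UNIV UNIV "\<lambda>i. b $ i - a $ i"]) simp
    ultimately show ?thesis unfolding box using False by (simp add: content_cbox_cart)
  qed simp
  note box_eq = this
  show "Q ?h" unfolding Q_def
  proof (intro exI[of _ 1] ballI)
    fix S :: "(real^'n) set" assume "S \<in> lmeasurable"
    from measure_linear_sufficient[OF lin this box_eq]
    show "?h ` S \<in> lmeasurable \<and> measure lebesgue (?h ` S) = 1 * measure lebesgue S" by (metis (no_types))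
  qed
next
  fix m n :: 'n assume 5: "m \<noteq> n"
  let ?h = "\<lambda>x::real^'n. \<chi> i. if i = m then x$m + x$n else x$i"
  have lin: "linear ?h" by (rule linearI) (simp_all add: vec_eq_iff algebra_simps)
  have "measure lebesgue (?h ` cbox a b) = 1 * measure lebesgue (cbox a b)" for a b
  proof (cases "cbox a b = {}")
    case False
    \<comment> \<open>The formula for sheared boxes wants a nonnegative lower bound in the
      coordinate \<open>n\<close>; a translation makes this bound 0.\<close>
    define w :: "real^'n" where "w = axis n (- (a $ n))"
    have ne: "cbox (w + a) (w + b) \<noteq> {}" using False cbox_translation[of w a b] by (metis image_is_empty)
    have w: "0 \<le> (w + a) $ n" by (simp add: w_def axis_def)
    have "?h ` cbox (w + a) (w + b) = (+) (?h w) ` (?h ` cbox a b)"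
      unfolding cbox_translation image_comp by (rule image_cong) (simp_all add: linear_add[OF lin] o_def)
    then have "measure lebesgue (?h ` cbox a b) = measure lebesgue (?h ` cbox (w + a) (w + b))"
      by (simp only: measure_translation)
    also have "\<dots> = measure lebesgue (cbox (w + a) (w + b))"
      by (rule measure_shear_interval[OF 5 ne w])
    also have "\<dots> = measure lebesgue (cbox a b)" unfolding cbox_translation by (rule measure_translation)
    finally show ?thesis by simp
  qed simp
  note box_eq = this
  show "Q ?h" unfolding Q_def
  proof (intro exI[of _ 1] ballI)
    fix S :: "(real^'n) set" assume "S \<in> lmeasurable"
    from measure_linear_sufficient[OF lin this box_eq]
    show "?h ` S \<in> lmeasurable \<and> measure lebesgue (?h ` S) = 1 * measure lebesgue S" by (metis (no_types))
  qed
qed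
  then show ?thesis unfolding Q_def .
qed

text \<open>The volume factor can be read off from one set: the unit ball is mapped to itself and
  has positive volume.\<close>

lemma measure_orthogonal:
  fixes f :: "real^'n \<Rightarrow> real^'n"
  assumes f: "orthogonal_transformation f" and S: "S \<in> lmeasurable"
  shows "f ` S \<in> lmeasurable" "measure lebesgue (f ` S) = measure lebesgue S"
proof -
  obtain c where c: "\<forall>S\<in>lmeasurable. f ` S \<in> lmeasurable \<and> measure lebesgue (f ` S) = c * measure lebesgue S"
    using measure_linear_factor[OF orthogonal_transformation_linear[OF f]] by blast
  have "f ` ball 0 1 = ball 0 1"
    using image_orthogonal_transformation_ball[OF f, of 0 1] linear_0[OF orthogonal_transformation_linear[OF f]] by simp
  then have "measure lebesgue (ball (0::real^'n) 1) = c * measure lebesgue (ball (0::real^'n) 1)"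
    using c by (metis lmeasurable_ball)
  then have "c = 1" using content_ball_pos[of 1 "0::real^'n"] by simp
  then show "f ` S \<in> lmeasurable" "measure lebesgue (f ` S) = measure lebesgue S" using c S by auto
qed

text \<open>Conjugation with an orthogonal map that takes a coordinate axis to \<open>b\<close>
  turns \<open>R\<close> into the stretching of one coordinate.\<close>

lemma measure_scale_direction:
  fixes b :: "real^'n"
  assumes b: "norm b = 1" and S: "S \<in> lmeasurable" and t: "0 \<le> t"
  defines "R \<equiv> (\<lambda>y. y + (t - 1) *\<^sub>R ((y \<bullet> b) *\<^sub>R b))"
  shows "R ` S \<in> lmeasurable" "measure lebesgue (R ` S) = t * measure lebesgue S"
proof -
  obtain i :: 'n where True by auto
  let ?a = "axis i 1 :: real^'n"
  obtain f where f: "orthogonal_transformation f" "f ?a = b"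
    using orthogonal_transformation_exists[of ?a b] b by auto
  have linf: "linear f" using f(1) by (rule orthogonal_transformation_linear)
  define g where "g = inv f"
  have g: "orthogonal_transformation g" using f(1) by (simp add: g_def orthogonal_transformation_inv)
  have fg: "f (g y) = y" for y using f(1) by (simp add: g_def orthogonal_transformation_surj surj_f_inv_f)
  let ?D = "\<lambda>y::real^'n. \<chi> k. (if k = i then t else 1) * y $ k"
  have R: "R (f y) = f (?D y)" for y
  proof -
    have "f y \<bullet> f ?a = y \<bullet> ?a" using f(1) by (simp only: orthogonal_transformation_def)
    then have "f y \<bullet> b = y $ i" by (simp add: f(2) inner_axis)
    then have "R (f y) = f (y + (t - 1) *\<^sub>R ((y $ i) *\<^sub>R ?a))"
      by (simp only: R_def linear_add[OF linf] linear_scale[OF linf] f(2))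
    also have "y + (t - 1) *\<^sub>R ((y $ i) *\<^sub>R ?a) = ?D y"
      by (simp add: vec_eq_iff axis_def algebra_simps)
    finally show ?thesis .
  qed
  have "R ` S = R ` (f ` (g ` S))" by (simp add: image_image fg)
  also have "\<dots> = f ` (?D ` (g ` S))" by (simp only: image_image R)
  finally have RS: "R ` S = f ` (?D ` (g ` S))" .
  have gS: "g ` S \<in> lmeasurable" "measure lebesgue (g ` S) = measure lebesgue S"
    using measure_orthogonal[OF g S] by auto
  have DS: "?D ` (g ` S) \<in> lmeasurable" "measure lebesgue (?D ` (g ` S)) = t * measure lebesgue S"
    using measurable_stretch[OF gS(1), of "\<lambda>k. if k = i then t else 1"]
      measure_stretch[OF gS(1), of "\<lambda>k. if k = i then t else 1"] gS(2) t by auto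
  show "R ` S \<in> lmeasurable" "measure lebesgue (R ` S) = t * measure lebesgue S"
    using measure_orthogonal[OF f(1) DS(1)] DS(2) RS by auto
qed

lemma linear_scale_set:
  fixes B :: "'a::real_inner set"
  shows "linear (\<lambda>y. y + (t - 1) *\<^sub>R (\<Sum>b\<in>B. (y \<bullet> b) *\<^sub>R b))"
proof -
  have "linear (\<lambda>y. (y \<bullet> b) *\<^sub>R b)" for b :: 'a
    by (simp add: linear_iff inner_add_left scaleR_add_left)
  then show ?thesis
    by (intro linear_compose_add linear_compose_scale_right linear_compose_sum) (auto simp: linear_iff)
qed

text \<open>Scaling in one direction of \<open>B\<close> leaves the components along the others
  unchanged, so \<open>M B\<close> is a composition of scalings in single directions.\<close>

lemma measure_scale_set:
  fixes B :: "(real^'n) set"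
  assumes "finite B" "pairwise orthogonal B" "\<And>b. b \<in> B \<Longrightarrow> norm b = 1" and t: "0 \<le> t" and S: "S \<in> lmeasurable"
  defines "M \<equiv> (\<lambda>B y. y + (t - 1) *\<^sub>R (\<Sum>b\<in>B. (y \<bullet> b) *\<^sub>R b))"
  shows "M B ` S \<in> lmeasurable \<and> measure lebesgue (M B ` S) = t ^ card B * measure lebesgue S"
  using assms(1-3)
proof (induction B rule: finite_induct)
  case empty
  then show ?case using S by (simp add: M_def)
next
  case (insert b B)
  have orth: "b' \<bullet> b = 0" if "b' \<in> B" for b'
    using insert.prems(1) insert.hyps(2) that by (auto simp: pairwise_insert orthogonal_def)
  have "M (insert b B) y = M B y + (t - 1) *\<^sub>R ((M B y \<bullet> b) *\<^sub>R b)" for y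
  proof -
    have "(\<Sum>b'\<in>B. (y \<bullet> b') *\<^sub>R b') \<bullet> b = 0" using orth by (simp add: inner_sum_left)
    then show ?thesis
      using insert.hyps by (simp add: M_def inner_add_left algebra_simps)
  qed
  then have "M (insert b B) ` S = (\<lambda>y. y + (t - 1) *\<^sub>R ((y \<bullet> b) *\<^sub>R b)) ` (M B ` S)"
    by (simp add: image_image)
  moreover have "M B ` S \<in> lmeasurable" "measure lebesgue (M B ` S) = t ^ card B * measure lebesgue S"
    using insert by (auto simp: pairwise_insert)
  ultimately show ?case
    using measure_scale_direction[of b "M B ` S" t] insert.prems(2)[of b] t insert.hyps by simp
qed

lemma orthonormal_sum_span:
  fixes B :: "'a::euclidean_space set"
  assumes "finite B" "pairwise orthogonal B" "\<And>b. b \<in> B \<Longrightarrow> norm b = 1" "x \<in> span B"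
  shows "(\<Sum>b\<in>B. (x \<bullet> b) *\<^sub>R b) = x"
proof -
  let ?y = "x - (\<Sum>b\<in>B. (x \<bullet> b) *\<^sub>R b)"
  have "?y \<in> span B" by (intro span_diff assms(4) span_sum span_scale) (rule span_base)
  moreover have "orthogonal ?y b" if "b \<in> B" for b
  proof -
    have "(\<Sum>b'\<in>B. (x \<bullet> b') *\<^sub>R b') \<bullet> b = (\<Sum>b'\<in>B. (x \<bullet> b') * (b' \<bullet> b))" by (simp add: inner_sum_left)
    also have "\<dots> = (\<Sum>b'\<in>B. if b' = b then x \<bullet> b else 0)"
    proof (rule sum.cong)
      fix b' assume "b' \<in> B"
      then show "(x \<bullet> b') * (b' \<bullet> b) = (if b' = b then x \<bullet> b else 0)"
        using assms(2,3) that by (auto simp: pairwise_def orthogonal_def dot_square_norm)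
    qed simp
    also have "\<dots> = x \<bullet> b" using assms(1) that by simp
    finally show ?thesis by (simp add: orthogonal_def inner_diff_left)
  qed
  ultimately have "orthogonal ?y ?y" using orthogonal_to_span by blast
  then show ?thesis by (simp add: orthogonal_def)
qed

section \<open>Cells of the parallel body over the faces\<close>

lemma infdist_closest_point:
  assumes "closed S" "S \<noteq> {}"
  shows "infdist x S = dist x (closest_point S x)"
  by (simp add: infdist_eq_setdist setdist_closest_point[OF assms])

text \<open>The relative interiors of the nonempty faces of a polytope partition it, so these cells
  partition its parallel body.\<close>

definition face_cell :: "(real^'n) set \<Rightarrow> (real^'n) set \<Rightarrow> real \<Rightarrow> (real^'n) set" where
  "face_cell P F \<epsilon> = {x. infdist x P \<le> \<epsilon> \<and> closest_point P x \<in> rel_interior F}"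

text \<open>The nearest point is characterised by \<open>(x - ?p) \<bullet> (z - ?p) \<le> 0\<close>
  for all \<open>z\<close> in \<open>P\<close>, and this condition is preserved when
  \<open>x - ?p\<close> is multiplied by a nonnegative factor.\<close>

lemma closest_point_ray:
  fixes P :: "'a::euclidean_space set"
  assumes P: "closed P" "convex P" "P \<noteq> {}" and t: "t \<ge> 0"
  shows "closest_point P (closest_point P x + t *\<^sub>R (x - closest_point P x)) = closest_point P x"
proof -
  let ?p = "closest_point P x"
  have pin: "?p \<in> P" using P by (simp add: closest_point_in_set)
  have "dist (?p + t *\<^sub>R (x - ?p)) ?p \<le> dist (?p + t *\<^sub>R (x - ?p)) z" if "z \<in> P" for z
  proof -
    have "(x - ?p) \<bullet> (z - ?p) \<le> 0" using closest_point_dot[OF P(2,1) that] .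
    then have "0 \<le> 2 * (t * ((x - ?p) \<bullet> (?p - z)))"
      using t by (simp add: inner_diff_right)
    then have "(t *\<^sub>R (x - ?p)) \<bullet> (t *\<^sub>R (x - ?p)) \<le>
      (t *\<^sub>R (x - ?p)) \<bullet> (t *\<^sub>R (x - ?p)) + 2 * ((t *\<^sub>R (x - ?p)) \<bullet> (?p - z)) + (?p - z) \<bullet> (?p - z)"
      by (simp only: inner_scaleR_left) simp
    also have "\<dots> = (t *\<^sub>R (x - ?p) + (?p - z)) \<bullet> (t *\<^sub>R (x - ?p) + (?p - z))"
      by (simp only: inner_add_left inner_add_right inner_commute[of "?p - z" "t *\<^sub>R (x - ?p)"])
    finally have "(t *\<^sub>R (x - ?p)) \<bullet> (t *\<^sub>R (x - ?p)) \<le> (t *\<^sub>R (x - ?p) + (?p - z)) \<bullet> (t *\<^sub>R (x - ?p) + (?p - z))" .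
    then have "norm (t *\<^sub>R (x - ?p)) \<le> norm (t *\<^sub>R (x - ?p) + (?p - z))" by (simp only: norm_le)
    then show ?thesis by (simp add: dist_norm algebra_simps)
  qed
  then show ?thesis using closest_point_unique[OF P(2,1) pin] by metis
qed

lemma face_cell_sets:
  assumes P: "compact P" "convex P" "P \<noteq> {}" and F: "closed F"
  shows "face_cell P F \<epsilon> \<in> lmeasurable"
proof -
  have [measurable]: "closest_point P \<in> borel_measurable borel"
    using P by (intro borel_measurable_continuous_onI continuous_on_closest_point) (auto simp: compact_imp_closed)
  have "rel_interior F = F - rel_frontier F"
    using F rel_interior_subset[of F] by (auto simp: rel_frontier_def)
  then have [measurable]: "rel_interior F \<in> sets borel" using F closed_rel_frontier[of F] by auto
  have [measurable]: "(\<lambda>x. infdist x P) \<in> borel_measurable borel"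
    by (intro borel_measurable_continuous_onI continuous_intros)
  have "face_cell P F \<epsilon> \<in> sets borel" unfolding face_cell_def by measurable
  moreover have "bounded (face_cell P F \<epsilon>)"
  proof -
    obtain r where r: "\<And>y. y \<in> P \<Longrightarrow> norm y \<le> r" using compact_imp_bounded[OF P(1)] by (auto simp: bounded_iff)
    have "norm x \<le> \<epsilon> + r" if "x \<in> face_cell P F \<epsilon>" for x
    proof -
      have "dist x (closest_point P x) \<le> \<epsilon>" using that P by (simp add: face_cell_def infdist_closest_point compact_imp_closed)
      moreover have "norm (closest_point P x) \<le> r" using P by (intro r closest_point_in_set) (auto simp: compact_imp_closed)
      ultimately show ?thesis using norm_triangle_sub[of x "closest_point P x"] by (simp add: dist_norm)
    qed
    then show ?thesis unfolding bounded_iff by blast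
  qed
  ultimately show ?thesis by (simp add: bounded_set_imp_lmeasurable)
qed

text \<open>The cell is the image of the cell for \<open>\<epsilon> = 1\<close> under scaling by \<open>\<epsilon>\<close> about \<open>F\<close> in the directions
  orthogonal to \<open>F\<close>.\<close>
lemma measure_face_cell:
  fixes P :: "(real^'n) set"
  assumes P: "compact P" "convex P" "P \<noteq> {}" and F: "F face_of P" "F \<noteq> {}"
  shows "\<exists>j\<le>CARD('n). \<forall>\<epsilon>\<ge>0. measure lebesgue (face_cell P F \<epsilon>) = measure lebesgue (face_cell P F 1) * \<epsilon> ^ j"
proof -
  have clP: "closed P" using P by (simp add: compact_imp_closed)
  have cF: "convex F" using F(1) by (rule face_of_imp_convex)
  have clF: "closed F" using face_of_imp_closed[OF P(2) clP F(1)] .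
  have FP: "F \<subseteq> P" using F(1) by (rule face_of_imp_subset)
  let ?\<pi> = "closest_point P"
  have "rel_interior F \<noteq> {}" using cF F(2) by (simp add: rel_interior_eq_empty)
  then obtain z0 where z0: "z0 \<in> rel_interior F" by auto
  have z0F: "z0 \<in> F" using z0 rel_interior_subset by blast
  \<comment> \<open>The directions of \<open>F\<close>. Scaling happens in their orthogonal
    complement, and the dimension of that complement becomes the exponent.\<close>
  define D where "D = span ((\<lambda>x. x - z0) ` F)"
  obtain B where B: "B \<subseteq> D\<^sup>\<bottom>" "pairwise orthogonal B" "\<And>x. x \<in> B \<Longrightarrow> norm x = 1"
    "independent B" "card B = dim (D\<^sup>\<bottom>)" "span B = D\<^sup>\<bottom>"
    using orthonormal_basis_subspace[OF subspace_orthogonal_comp] by metis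
  have finB: "finite B" using B(4) by (rule independent_imp_finite)
  have cardB: "card B \<le> CARD('n)" using B(5) dim_subset_UNIV_cart[of "D\<^sup>\<bottom>"] by simp
  define A where "A t y = y + (t - 1) *\<^sub>R (\<Sum>b\<in>B. (y \<bullet> b) *\<^sub>R b)" for t and y :: "real^'n"
  have linA: "linear (A t)" for t unfolding A_def by (rule linear_scale_set)
  have AD: "A t d = d" if "d \<in> D" for t d
  proof -
    have "d \<bullet> b = 0" if "b \<in> B" for b
      using B(1) that \<open>d \<in> D\<close> by (auto simp: orthogonal_comp_def orthogonal_def)
    then show ?thesis by (simp add: A_def)
  qed
  have AN: "A t y = t *\<^sub>R y" if "y \<in> D\<^sup>\<bottom>" for t y
    using orthonormal_sum_span[OF finB B(2,3), of y] that B(6) by (simp add: A_def algebra_simps)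
  have perp: "x - ?\<pi> x \<in> D\<^sup>\<bottom>" if "?\<pi> x \<in> rel_interior F" for x
  proof -
    have piF: "?\<pi> x \<in> F" using that rel_interior_subset by blast
    \<comment> \<open>The nearest point is in the relative interior, so the segment from
      \<open>y\<close> to it can be prolonged inside \<open>F\<close>. The variational inequality
      then holds in both directions.\<close>
    have 0: "(x - ?\<pi> x) \<bullet> (y - ?\<pi> x) = 0" if "y \<in> F" for y
    proof (rule antisym)
      show "(x - ?\<pi> x) \<bullet> (y - ?\<pi> x) \<le> 0" using closest_point_dot[OF P(2) clP] FP that by blast
      obtain e where e: "e > 1" "(1 - e) *\<^sub>R y + e *\<^sub>R ?\<pi> x \<in> F"
        using convex_rel_interior_iff[OF cF F(2), of "?\<pi> x"] \<open>?\<pi> x \<in> rel_interior F\<close> \<open>y \<in> F\<close> by blast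
      have "(x - ?\<pi> x) \<bullet> ((1 - e) *\<^sub>R y + e *\<^sub>R ?\<pi> x - ?\<pi> x) \<le> 0"
        using closest_point_dot[OF P(2) clP] FP e(2) by blast
      also have "(1 - e) *\<^sub>R y + e *\<^sub>R ?\<pi> x - ?\<pi> x = (1 - e) *\<^sub>R (y - ?\<pi> x)" by (simp add: algebra_simps)
      finally have "(1 - e) * ((x - ?\<pi> x) \<bullet> (y - ?\<pi> x)) \<le> 0" by simp
      then show "0 \<le> (x - ?\<pi> x) \<bullet> (y - ?\<pi> x)" using e(1) by (simp add: mult_le_0_iff)
    qed
    have "orthogonal (x - ?\<pi> x) d" if "d \<in> (\<lambda>x. x - z0) ` F" for d
    proof -
      obtain y where y: "y \<in> F" "d = y - z0" using \<open>d \<in> (\<lambda>x. x - z0) ` F\<close> by blast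
      have "(x - ?\<pi> x) \<bullet> d = (x - ?\<pi> x) \<bullet> (y - ?\<pi> x) - (x - ?\<pi> x) \<bullet> (z0 - ?\<pi> x)"
        by (simp add: y(2) inner_diff_right)
      then show ?thesis using 0[OF y(1)] 0[OF z0F] by (simp add: orthogonal_def)
    qed
    then have "\<And>d. d \<in> D \<Longrightarrow> orthogonal (x - ?\<pi> x) d" unfolding D_def using orthogonal_to_span by blast
    then show ?thesis by (auto simp: orthogonal_comp_def orthogonal_commute)
  qed
  define T where "T t x = z0 + A t (x - z0)" for t x
  have Tx: "T t x = ?\<pi> x + t *\<^sub>R (x - ?\<pi> x)" if "?\<pi> x \<in> rel_interior F" for t x
  proof -
    have "?\<pi> x - z0 \<in> D" unfolding D_def using that rel_interior_subset by (intro span_base) blast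
    then have "A t ((?\<pi> x - z0) + (x - ?\<pi> x)) = (?\<pi> x - z0) + t *\<^sub>R (x - ?\<pi> x)"
      using AD AN perp[OF that] by (simp only: linear_add[OF linA])
    then show ?thesis by (simp add: T_def)
  qed
  have inf: "infdist x P = dist x (?\<pi> x)" for x using infdist_closest_point[OF clP P(3)] .
  have img: "face_cell P F \<epsilon> = T \<epsilon> ` face_cell P F 1" if e: "\<epsilon> \<ge> 0" for \<epsilon>
  proof (intro equalityI subsetI)
    fix x assume "x \<in> T \<epsilon> ` face_cell P F 1"
    then obtain y where y: "y \<in> face_cell P F 1" "x = T \<epsilon> y" by auto
    have yr: "?\<pi> y \<in> rel_interior F" "dist y (?\<pi> y) \<le> 1" using y(1) by (auto simp: face_cell_def inf)
    have x: "x = ?\<pi> y + \<epsilon> *\<^sub>R (y - ?\<pi> y)" using y(2) Tx[OF yr(1)] by simp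
    have px: "?\<pi> x = ?\<pi> y" unfolding x by (rule closest_point_ray[OF clP P(2,3) e])
    have "dist x (?\<pi> x) = \<epsilon> * dist y (?\<pi> y)" unfolding px by (subst x) (use e in \<open>simp add: dist_norm\<close>)
    also have "\<dots> \<le> \<epsilon>" using yr(2) e by (simp add: mult_left_le)
    finally show "x \<in> face_cell P F \<epsilon>" using yr(1) px by (simp add: face_cell_def inf)
  next
    fix x assume "x \<in> face_cell P F \<epsilon>"
    then have xr: "?\<pi> x \<in> rel_interior F" "dist x (?\<pi> x) \<le> \<epsilon>" by (auto simp: face_cell_def inf)
    show "x \<in> T \<epsilon> ` face_cell P F 1"
    proof (cases "\<epsilon> = 0")
      case True
      then have "?\<pi> x = x" using xr(2) by simp
      then show ?thesis using Tx[OF xr(1), of \<epsilon>] xr True by (intro image_eqI[of _ _ x]) (auto simp: face_cell_def inf)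
    next
      case False
      then have e': "\<epsilon> > 0" using e by simp
      define y where "y = ?\<pi> x + (1/\<epsilon>) *\<^sub>R (x - ?\<pi> x)"
      have py: "?\<pi> y = ?\<pi> x" unfolding y_def using e' by (intro closest_point_ray[OF clP P(2,3)]) simp
      have "dist y (?\<pi> y) = dist x (?\<pi> x) / \<epsilon>" unfolding py by (subst y_def) (use e' in \<open>simp add: dist_norm\<close>)
      also have "\<dots> \<le> 1" using xr(2) e' by simp
      finally have "y \<in> face_cell P F 1" using xr(1) py by (simp add: face_cell_def inf)
      moreover have "T \<epsilon> y = x"
        using Tx[of y \<epsilon>] py xr(1) e' by (simp add: y_def)
      ultimately show ?thesis by blast
    qed
  qed
  have meas1: "face_cell P F 1 \<in> lmeasurable" by (rule face_cell_sets[OF P clF])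
  have "measure lebesgue (face_cell P F \<epsilon>) = measure lebesgue (face_cell P F 1) * \<epsilon> ^ card B" if e: "\<epsilon> \<ge> 0" for \<epsilon>
  proof -
    have "T \<epsilon> ` face_cell P F 1 = (+) z0 ` (A \<epsilon> ` ((\<lambda>x. x - z0) ` face_cell P F 1))"
      by (simp add: T_def image_image)
    then have "measure lebesgue (face_cell P F \<epsilon>) = measure lebesgue (A \<epsilon> ` ((\<lambda>x. x - z0) ` face_cell P F 1))"
      using img[OF e] by (simp only: measure_translation)
    also have "\<dots> = \<epsilon> ^ card B * measure lebesgue ((\<lambda>x. x - z0) ` face_cell P F 1)"
      using measure_scale_set[OF finB B(2,3) e measurable_translation_subtract[OF meas1, of z0]]
      unfolding A_def by blast
    also have "measure lebesgue ((\<lambda>x. x - z0) ` face_cell P F 1) = measure lebesgue (face_cell P F 1)"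
      by (rule measure_translation_subtract)
    finally show ?thesis by simp
  qed
  then show ?thesis using cardB by blast
qed

text \<open>A face of least dimension containing \<open>x\<close> works: were \<open>x\<close> on
  its relative boundary, a facet of it would be a smaller face containing \<open>x\<close>.\<close>

lemma polytope_point_in_rel_interior_face:
  fixes P :: "'a::euclidean_space set"
  assumes P: "polytope P" and x: "x \<in> P"
  shows "\<exists>F. F face_of P \<and> x \<in> rel_interior F"
proof -
  let ?S = "{F. F face_of P \<and> x \<in> F}"
  have fin: "finite ?S" using finite_polytope_faces[OF P] by (rule rev_finite_subset) auto
  have "P \<in> ?S" using P x by (simp add: face_of_refl polytope_imp_convex)
  then have "?S \<noteq> {}" by blast
  from ex_is_arg_min_if_finite[OF fin this, of aff_dim]
  obtain F where F: "F \<in> ?S" "\<And>G. G \<in> ?S \<Longrightarrow> aff_dim F \<le> aff_dim G"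
    by (auto simp: is_arg_min_linorder)
  have FP: "F face_of P" "x \<in> F" using F(1) by auto
  have pF: "polytope F" using face_of_polytope_polytope[OF P FP(1)] .
  have "x \<in> rel_interior F"
  proof (rule ccontr)
    assume "x \<notin> rel_interior F"
    then have "x \<in> F - rel_interior F" using FP by simp
    then obtain G where G: "G facet_of F" "x \<in> G"
      using rel_boundary_of_polyhedron[OF polytope_imp_polyhedron[OF pF]] by auto
    have "G face_of P" using G(1) FP(1) facet_of_imp_face_of face_of_trans by blast
    then have "aff_dim F \<le> aff_dim G" using F(2) G(2) by auto
    then show False using G(1) by (simp add: facet_of_def)
  qed
  then show ?thesis using FP by blast
qed

section \<open>Steiner polynomials and the norm\<close>

lemma parallel_body_sets:
  assumes "compact K" "K \<noteq> {}"
  shows "parallel_body K \<epsilon> \<in> lmeasurable"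
proof -
  have "parallel_body K \<epsilon> = (\<lambda>x. infdist x K) -` {..\<epsilon>}" by (auto simp: parallel_body_def)
  then have "closed (parallel_body K \<epsilon>)" by (auto intro!: continuous_closed_vimage continuous_intros)
  moreover have "bounded (parallel_body K \<epsilon>)"
  proof -
    obtain r where r: "\<And>y. y \<in> K \<Longrightarrow> norm y \<le> r" using compact_imp_bounded[OF assms(1)] by (auto simp: bounded_iff)
    have "norm x \<le> \<epsilon> + r" if "x \<in> parallel_body K \<epsilon>" for x
    proof -
      have cl: "closed K" using assms(1) by (rule compact_imp_closed)
      have "dist x (closest_point K x) \<le> \<epsilon>" using that infdist_closest_point[OF cl assms(2)] by (simp add: parallel_body_def)
      moreover have "norm (closest_point K x) \<le> r" by (intro r closest_point_in_set cl assms)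
      ultimately show ?thesis using norm_triangle_sub[of x "closest_point K x"] by (simp add: dist_norm)
    qed
    then show ?thesis unfolding bounded_iff by blast
  qed
  ultimately show ?thesis using compact_eq_bounded_closed lmeasurable_compact by blast
qed

text \<open>Each cell contributes one monomial, and the cells are grouped by exponent. The sign of
  the coefficients is recorded because it bounds them in the passage to general bodies.\<close>

lemma steiner_polytope:
  fixes P :: "(real^'n) set"
  assumes P: "polytope P" "P \<noteq> {}"
  shows "\<exists>a. (\<forall>k. 0 \<le> a k) \<and> (\<forall>\<epsilon>\<ge>0. measure lebesgue (parallel_body P \<epsilon>) = (\<Sum>k\<le>CARD('n). a k * \<epsilon> ^ k))"
proof -
  have cP: "compact P" "convex P" "closed P" using P by (auto simp: polytope_imp_compact polytope_imp_convex compact_imp_closed)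
  define \<F> where "\<F> = {F. F face_of P \<and> F \<noteq> {}}"
  have fin: "finite \<F>" using finite_polytope_faces[OF P(1)] by (rule rev_finite_subset) (auto simp: \<F>_def)
  have "\<forall>F\<in>\<F>. \<exists>j. j \<le> CARD('n) \<and> (\<forall>\<epsilon>\<ge>0. measure lebesgue (face_cell P F \<epsilon>) = measure lebesgue (face_cell P F 1) * \<epsilon> ^ j)"
    using measure_face_cell[OF cP(1,2) P(2)] by (auto simp: \<F>_def)
  from bchoice[OF this] obtain j where j: "\<And>F. F \<in> \<F> \<Longrightarrow> j F \<le> CARD('n)"
    "\<And>F \<epsilon>. F \<in> \<F> \<Longrightarrow> \<epsilon> \<ge> 0 \<Longrightarrow> measure lebesgue (face_cell P F \<epsilon>) = measure lebesgue (face_cell P F 1) * \<epsilon> ^ j F"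
    by blast
  define a where "a k = (\<Sum>F\<in>{F\<in>\<F>. j F = k}. measure lebesgue (face_cell P F 1))" for k
  have "measure lebesgue (parallel_body P \<epsilon>) = (\<Sum>k\<le>CARD('n). a k * \<epsilon> ^ k)" if e: "\<epsilon> \<ge> 0" for \<epsilon>
  proof -
    have "parallel_body P \<epsilon> = (\<Union>F\<in>\<F>. face_cell P F \<epsilon>)"
    proof (intro equalityI subsetI)
      fix x assume x: "x \<in> parallel_body P \<epsilon>"
      obtain F where "F face_of P" "closest_point P x \<in> rel_interior F"
        using polytope_point_in_rel_interior_face[OF P(1)] closest_point_in_set[OF cP(3) P(2)] by blast
      then show "x \<in> (\<Union>F\<in>\<F>. face_cell P F \<epsilon>)"
        using x rel_interior_subset by (force simp: \<F>_def face_cell_def parallel_body_def)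
    qed (auto simp: face_cell_def parallel_body_def)
    also have "measure lebesgue (\<Union>F\<in>\<F>. face_cell P F \<epsilon>) = (\<Sum>F\<in>\<F>. measure lebesgue (face_cell P F \<epsilon>))"
    proof (rule measure_finite_Union[OF fin])
      have *: "face_cell P F \<epsilon> \<in> lmeasurable" if "F \<in> \<F>" for F
        using that face_of_imp_closed[OF cP(2,3)] by (intro face_cell_sets cP P) (auto simp: \<F>_def)
      show "(\<lambda>F. face_cell P F \<epsilon>) ` \<F> \<subseteq> sets lebesgue" using * by auto
      show "emeasure lebesgue (face_cell P F \<epsilon>) \<noteq> \<infinity>" if "F \<in> \<F>" for F
        using *[OF that] by (auto simp: fmeasurable_def)
      show "disjoint_family_on (\<lambda>F. face_cell P F \<epsilon>) \<F>"
        unfolding disjoint_family_on_def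
      proof (intro ballI impI)
        fix F G assume "F \<in> \<F>" "G \<in> \<F>" "F \<noteq> G"
        then have "rel_interior F \<inter> rel_interior G = {}" using face_of_eq[of F P G] by (auto simp: \<F>_def)
        then show "face_cell P F \<epsilon> \<inter> face_cell P G \<epsilon> = {}" by (auto simp: face_cell_def)
      qed
    qed
    also have "\<dots> = (\<Sum>F\<in>\<F>. measure lebesgue (face_cell P F 1) * \<epsilon> ^ j F)"
      using j(2)[OF _ e] by (intro sum.cong) auto
    also have "\<dots> = (\<Sum>k\<le>CARD('n). \<Sum>F\<in>{F\<in>\<F>. j F = k}. measure lebesgue (face_cell P F 1) * \<epsilon> ^ j F)"
      using j(1) by (intro sum.group[symmetric] fin) auto
    also have "\<dots> = (\<Sum>k\<le>CARD('n). a k * \<epsilon> ^ k)"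
      unfolding a_def sum_distrib_right by (intro sum.cong) auto
    finally show ?thesis .
  qed
  moreover have "\<forall>k. 0 \<le> a k" unfolding a_def by (auto intro: sum_nonneg)
  ultimately show ?thesis by blast
qed

text \<open>A finite \<delta>-net, taken inside \<open>K\<close> so that neither its hull nor its
  diameter exceeds that of \<open>K\<close>.\<close>

lemma convex_body_polytope_approx:
  fixes K :: "(real^'n) set"
  assumes K: "convex_body K" and d: "\<delta> > 0"
  shows "\<exists>F. finite F \<and> F \<noteq> {} \<and> F \<subseteq> K \<and> (\<forall>x\<in>K. \<exists>y\<in>F. dist x y < \<delta>)"
proof -
  have "compact K" "K \<noteq> {}" using K by (auto simp: convex_body_def)
  obtain F where F: "F \<subseteq> K" "finite F" "K \<subseteq> (\<Union>x\<in>F. ball x \<delta>)"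
    using compactE_image[OF \<open>compact K\<close>, of K "\<lambda>x. ball x \<delta>"] d by force
  have "\<exists>y\<in>F. dist x y < \<delta>" if "x \<in> K" for x
    using subsetD[OF F(3) that] by (auto simp: dist_commute)
  then show ?thesis using \<open>K \<noteq> {}\<close> F(1,2) by (intro exI[of _ F]) auto
qed

text \<open>An inscribed polytope satisfies P_\<epsilon> \<subseteq> K_\<epsilon> \<subseteq>
  P_(\<epsilon>+\<delta>). Being nonnegative, its Steiner coefficients are bounded by the volume of
  the parallel body of \<open>K\<close> at distance 1, so they converge along a sequence \<delta>
  \<rightarrow> 0.\<close>

lemma steiner_convex_body:
  fixes K :: "(real^'n) set"
  assumes K: "convex_body K"
  shows "\<exists>a. (\<forall>k. 0 \<le> a k) \<and> (\<forall>\<epsilon>\<ge>0. measure lebesgue (parallel_body K \<epsilon>) = (\<Sum>k\<le>CARD('n). a k * \<epsilon> ^ k))"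
proof -
  have cK: "compact K" "K \<noteq> {}" "convex K" using K by (auto simp: convex_body_def)
  let ?V = "\<lambda>\<epsilon>. measure lebesgue (parallel_body K \<epsilon>)"
  have "\<exists>a. (\<forall>k. 0 \<le> a k) \<and> (\<forall>\<epsilon>\<ge>0. (\<Sum>k\<le>CARD('n). a k * \<epsilon> ^ k) \<le> ?V \<epsilon> \<and> ?V \<epsilon> \<le> (\<Sum>k\<le>CARD('n). a k * (\<epsilon> + \<delta>) ^ k))"
    if d: "\<delta> > 0" for \<delta>
  proof -
    obtain F where F: "finite F" "F \<noteq> {}" "F \<subseteq> K" "\<And>x. x \<in> K \<Longrightarrow> \<exists>y\<in>F. dist x y < \<delta>"
      using convex_body_polytope_approx[OF K d] by auto
    define P where "P = convex hull F"
    have P: "polytope P" "P \<noteq> {}" "P \<subseteq> K" "compact P"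
      using F cK by (auto simp: P_def polytope_convex_hull hull_minimal finite_imp_compact_convex_hull)
    obtain a where a: "\<forall>k. 0 \<le> a k" "\<And>\<epsilon>. \<epsilon> \<ge> 0 \<Longrightarrow> measure lebesgue (parallel_body P \<epsilon>) = (\<Sum>k\<le>CARD('n). a k * \<epsilon> ^ k)"
      using steiner_polytope[OF P(1,2)] by blast
    have "infdist x P \<le> infdist x K + \<delta>" for x
    proof -
      have "closest_point K x \<in> K" using cK by (simp add: closest_point_in_set compact_imp_closed)
      then obtain y where y: "y \<in> F" "dist (closest_point K x) y < \<delta>" using F(4) by blast
      have "infdist x P \<le> dist x y" by (rule infdist_le) (use y in \<open>auto simp: P_def hull_inc\<close>)
      also have "\<dots> \<le> dist x (closest_point K x) + dist (closest_point K x) y" by (rule dist_triangle)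
      finally show ?thesis using y(2) infdist_closest_point[of K x] cK by (simp add: compact_imp_closed)
    qed
    then have sub2: "parallel_body K \<epsilon> \<subseteq> parallel_body P (\<epsilon> + \<delta>)" for \<epsilon>
      by (force simp: parallel_body_def intro: order_trans)
    have sub1: "parallel_body P \<epsilon> \<subseteq> parallel_body K \<epsilon>" for \<epsilon>
      using infdist_mono[OF P(3,2)] by (auto simp: parallel_body_def intro: order_trans)
    have mono: "measure lebesgue A \<le> measure lebesgue B" if "A \<subseteq> B" "A \<in> lmeasurable" "B \<in> lmeasurable" for A B :: "(real^'n) set"
      using that by (intro measure_mono_fmeasurable) auto
    show ?thesis
    proof (intro exI[of _ a] conjI a(1) allI impI)
      fix \<epsilon> :: real assume e: "0 \<le> \<epsilon>"
      show "(\<Sum>k\<le>CARD('n). a k * \<epsilon> ^ k) \<le> ?V \<epsilon>"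
        unfolding a(2)[OF e, symmetric] by (intro mono sub1 parallel_body_sets P cK)
      have "?V \<epsilon> \<le> measure lebesgue (parallel_body P (\<epsilon> + \<delta>))" by (intro mono sub2 parallel_body_sets P cK)
      then show "?V \<epsilon> \<le> (\<Sum>k\<le>CARD('n). a k * (\<epsilon> + \<delta>) ^ k)" using a(2)[of "\<epsilon> + \<delta>"] e d by simp
    qed
  qed
  then have "\<forall>j. \<exists>a. (\<forall>k. 0 \<le> a k) \<and> (\<forall>\<epsilon>\<ge>0. (\<Sum>k\<le>CARD('n). a k * \<epsilon> ^ k) \<le> ?V \<epsilon> \<and>
      ?V \<epsilon> \<le> (\<Sum>k\<le>CARD('n). a k * (\<epsilon> + 1 / real (Suc j)) ^ k))"
    by simp
  from choice[OF this] obtain a where a: "\<And>j k. 0 \<le> a j k"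
    "\<And>j \<epsilon>. 0 \<le> \<epsilon> \<Longrightarrow> (\<Sum>k\<le>CARD('n). a j k * \<epsilon> ^ k) \<le> ?V \<epsilon>"
    "\<And>j \<epsilon>. 0 \<le> \<epsilon> \<Longrightarrow> ?V \<epsilon> \<le> (\<Sum>k\<le>CARD('n). a j k * (\<epsilon> + 1 / real (Suc j)) ^ k)"
    by blast
  have "norm (a j k) \<le> ?V 1" if "k < Suc CARD('n)" for j k
  proof -
    have "a j k \<le> (\<Sum>k\<le>CARD('n). a j k)" using that a(1) by (intro member_le_sum) auto
    also have "\<dots> \<le> ?V 1" using a(2)[of 1 j] by simp
    finally show ?thesis using a(1) by simp
  qed
  from bounded_lists_convergent_subseq[of "Suc CARD('n)" a, OF this]
  obtain r l where r: "strict_mono (r::nat\<Rightarrow>nat)" "\<And>k. k < Suc CARD('n) \<Longrightarrow> (\<lambda>j. a (r j) k) \<longlonglongrightarrow> l k" by blast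
  have del: "(\<lambda>j. 1 / real (Suc (r j))) \<longlonglongrightarrow> 0"
    using LIMSEQ_subseq_LIMSEQ[OF LIMSEQ_Suc[OF lim_1_over_n] r(1)] by (simp add: o_def)
  have V: "?V \<epsilon> = (\<Sum>k\<le>CARD('n). l k * \<epsilon> ^ k)" if e: "0 \<le> \<epsilon>" for \<epsilon>
  proof (rule antisym)
    have 1: "(\<lambda>j. \<Sum>k\<le>CARD('n). a (r j) k * \<epsilon> ^ k) \<longlonglongrightarrow> (\<Sum>k\<le>CARD('n). l k * \<epsilon> ^ k)"
      using r(2) by (intro tendsto_intros) auto
    show "(\<Sum>k\<le>CARD('n). l k * \<epsilon> ^ k) \<le> ?V \<epsilon>"
      by (rule LIMSEQ_le_const2[OF 1]) (use a(2)[OF e] in auto)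
    have 2: "(\<lambda>j. \<Sum>k\<le>CARD('n). a (r j) k * (\<epsilon> + 1 / real (Suc (r j))) ^ k) \<longlonglongrightarrow> (\<Sum>k\<le>CARD('n). l k * (\<epsilon> + 0) ^ k)"
      using r(2) del by (intro tendsto_intros) auto
    show "?V \<epsilon> \<le> (\<Sum>k\<le>CARD('n). l k * \<epsilon> ^ k)"
      using LIMSEQ_le_const[OF 2, of "?V \<epsilon>"] a(3)[OF e] by auto
  qed
  have "0 \<le> l k" if "k < Suc CARD('n)" for k
    by (rule LIMSEQ_le_const[OF r(2)[OF that]]) (use a(1) in auto)
  \<comment> \<open>Only coefficients up to the degree are known to converge; the others are set to
    0 to keep all of them nonnegative.\<close>
  then show ?thesis
    using V by (intro exI[of _ "\<lambda>k. if k \<le> CARD('n) then l k else 0"]) auto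
qed

lemma polyfun_eq_on_nonneg:
  fixes c d :: "nat \<Rightarrow> real"
  assumes "\<And>x. x \<ge> 0 \<Longrightarrow> (\<Sum>i\<le>n. c i * x ^ i) = (\<Sum>i\<le>n. d i * x ^ i)" "i \<le> n"
  shows "c i = d i"
proof (rule ccontr)
  assume "c i \<noteq> d i"
  then have "finite {z::real. (\<Sum>i\<le>n. (c i - d i) * z ^ i) = 0}"
    unfolding polyfun_finite_roots using assms(2) by (intro exI[of _ i]) auto
  moreover have "{0..} \<subseteq> {z::real. (\<Sum>i\<le>n. (c i - d i) * z ^ i) = 0}"
    using assms(1) by (auto simp: left_diff_distrib sum_subtractf)
  ultimately have "finite {0::real..}" using finite_subset by blast
  then show False using infinite_Ici by blast
qed

text \<open>Existence of the Steiner polynomial and uniqueness of its coefficients resolve the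
  definite description in \<open>quermass\<close>. The binomial factor for \<open>k = n - 1\<close>
  is \<open>n\<close>, so \<open>n\<close> times that quermassintegral is the coefficient
  itself.\<close>

lemma norm_body_steiner:
  fixes K :: "(real^'n) set"
  assumes K: "convex_body K"
  shows "\<exists>a. (\<forall>k. 0 \<le> a k) \<and> (\<forall>\<epsilon>\<ge>0. measure lebesgue (parallel_body K \<epsilon>) = (\<Sum>k\<le>CARD('n). a k * \<epsilon> ^ k))
     \<and> norm_body K = a (CARD('n) - 1)"
proof -
  obtain a where a: "\<forall>k. 0 \<le> a k" "\<And>\<epsilon>. \<epsilon> \<ge> 0 \<Longrightarrow> measure lebesgue (parallel_body K \<epsilon>) = (\<Sum>k\<le>CARD('n). a k * \<epsilon> ^ k)"
    using steiner_convex_body[OF K] by blast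
  define W where "W k = (if k \<le> CARD('n) then a k / real (CARD('n) choose k) else 0)" for k
  have "quermass K = W" unfolding quermass_def
  proof (rule the_equality)
    have "(\<Sum>k\<le>CARD('n). real (CARD('n) choose k) * W k * \<epsilon> ^ k) = (\<Sum>k\<le>CARD('n). a k * \<epsilon> ^ k)" for \<epsilon> :: real
      by (rule sum.cong) (auto simp: W_def)
    then show "(\<forall>k>CARD('n). W k = 0) \<and> (\<forall>\<epsilon>\<ge>0. measure lebesgue (parallel_body K \<epsilon>) =
       (\<Sum>k\<le>CARD('n). real (CARD('n) choose k) * W k * \<epsilon> ^ k))"
      using a(2) by (simp add: W_def)
  next
    fix W' assume W': "(\<forall>k>CARD('n). W' k = 0) \<and> (\<forall>\<epsilon>\<ge>0. measure lebesgue (parallel_body K \<epsilon>) =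
       (\<Sum>k\<le>CARD('n). real (CARD('n) choose k) * W' k * \<epsilon> ^ k))"
    show "W' = W"
    proof
      fix k
      show "W' k = W k"
      proof (cases "k \<le> CARD('n)")
        case True
        have "real (CARD('n) choose k) * W' k = a k"
          by (rule polyfun_eq_on_nonneg[where c = "\<lambda>k. real (CARD('n) choose k) * W' k" and d = a, OF _ True])
            (use W' a(2) in metis)
        moreover have "real (CARD('n) choose k) \<noteq> 0" using True by simp
        ultimately show ?thesis using True by (simp add: W_def field_simps)
      qed (use W' in \<open>simp add: W_def\<close>)
    qed
  qed
  moreover have "CARD('n) choose (CARD('n) - 1) = CARD('n)"
    using binomial_symmetric[of "CARD('n) - 1" "CARD('n)"] by simp
  ultimately have "norm_body K = a (CARD('n) - 1)" by (simp add: norm_body_def W_def)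
  then show ?thesis using a by blast
qed

subsection \<open>Gaussian integrals\<close>

text \<open>Euler's integral, with a power of \<open>sqrt r\<close> because the sublevel set of a
  squared distance at level \<open>r\<close> has radius \<open>sqrt r\<close>.\<close>

lemma nn_integral_Gamma:
  "(\<integral>\<^sup>+r. ennreal (sqrt r ^ k * exp (- r)) * indicator {0..} r \<partial>lborel) = ennreal (Gamma (real k / 2 + 1))"
proof -
  have "((\<lambda>t. t powr (real k / 2 + 1 - 1) / exp t) has_integral Gamma (real k / 2 + 1)) {0..}"
    by (rule Gamma_integral_real) simp
  then have hi: "((\<lambda>t. t powr (real k / 2) / exp t) has_integral Gamma (real k / 2 + 1)) {0..}" by simp
  have "(\<integral>\<^sup>+r. ennreal (indicator {0..} r * (r powr (real k / 2) / exp r)) \<partial>lborel) = ennreal (Gamma (real k / 2 + 1))"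
    by (rule nn_integral_has_integral_lebesgue[OF _ hi]) simp
  also have "(\<integral>\<^sup>+r. ennreal (indicator {0..} r * (r powr (real k / 2) / exp r)) \<partial>lborel)
     = (\<integral>\<^sup>+r. ennreal (sqrt r ^ k * exp (- r)) * indicator {0..} r \<partial>lborel)"
  proof (rule nn_integral_cong_AE)
    have "AE r in lborel. r \<noteq> (0::real)" by (rule AE_lborel_singleton)
    then show "AE r in lborel. ennreal (indicator {0..} r * (r powr (real k / 2) / exp r)) = ennreal (sqrt r ^ k * exp (- r)) * indicator {0..} r"
    proof eventually_elim
      case (elim r)
      show ?case
      proof (cases "r > 0")
        case True
        have "sqrt r ^ k = sqrt r powr real k" using True by (subst powr_realpow) auto
        also have "\<dots> = (r powr (1/2)) powr real k" using True by (subst powr_half_sqrt) auto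
        also have "\<dots> = r powr (1/2 * real k)" by (rule powr_powr)
        finally have *: "sqrt r ^ k = r powr (real k / 2)" by simp
        have "indicator {0..} r * (r powr (real k / 2) / exp r) = r powr (real k / 2) * exp (- r)"
          using True by (simp add: exp_minus inverse_eq_divide)
        then show ?thesis using True unfolding * by simp
      next
        case False
        then have "r < 0" using elim by simp
        then show ?thesis by (simp add: indicator_def)
      qed
    qed
  qed
  finally show ?thesis .
qed

text \<open>Writing exp(-d^2) as the integral of exp(-r) over r \<ge> d^2 and exchanging the
  integrals leaves the volumes of the sets d \<le> \<open>sqrt r\<close>, a polynomial in
  \<open>sqrt r\<close> that is integrated term by term.\<close>

lemma layer_cake_exp_square:
  fixes d :: "'a::euclidean_space \<Rightarrow> real"
  assumes [measurable]: "d \<in> borel_measurable borel" and d0: "\<And>x. 0 \<le> d x"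
    and m: "\<And>\<rho>. 0 \<le> \<rho> \<Longrightarrow> emeasure lborel {x. d x \<le> \<rho>} = ennreal (\<Sum>k\<le>n. b k * \<rho> ^ k)"
    and b0: "\<And>k. 0 \<le> b k"
  shows "(\<integral>\<^sup>+x. ennreal (exp (- (d x)\<^sup>2)) \<partial>lborel) = ennreal (\<Sum>k\<le>n. b k * Gamma (real k / 2 + 1))"
proof -
  have tail: "ennreal (exp (- c)) = (\<integral>\<^sup>+r. ennreal (exp (- r)) * indicator {c..} r \<partial>lborel)" for c :: real
  proof -
    have "(\<integral>\<^sup>+r. ennreal (exp (- r)) * indicator {c..} r \<partial>lborel) = ennreal (0 - (- exp (- c)))"
    proof (rule nn_integral_FTC_atLeast)
      have "((\<lambda>x::real. exp (- x)) \<longlongrightarrow> 0) at_top"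
        using exp_at_bot filterlim_compose[OF exp_at_bot filterlim_uminus_at_bot_at_top] by simp
      then show "((\<lambda>x::real. - exp (- x)) \<longlongrightarrow> 0) at_top" using tendsto_minus[of _ 0] by fastforce
    qed (auto intro!: derivative_eq_intros)
    then show ?thesis by simp
  qed
  have "(\<integral>\<^sup>+x. ennreal (exp (- (d x)\<^sup>2)) \<partial>lborel)
     = (\<integral>\<^sup>+x. \<integral>\<^sup>+r. ennreal (exp (- r)) * indicator {(d x)\<^sup>2..} r \<partial>lborel \<partial>lborel)"
    by (subst tail) simp
  also have "\<dots> = (\<integral>\<^sup>+r. \<integral>\<^sup>+x. ennreal (exp (- r)) * indicator {(d x)\<^sup>2..} r \<partial>lborel \<partial>lborel)"
    by (rule lborel_pair.Fubini') (simp add: indicator_def)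
  also have "\<dots> = (\<integral>\<^sup>+r. (\<Sum>k\<le>n. ennreal (b k) * (ennreal (sqrt r ^ k * exp (- r)) * indicator {0..} r)) \<partial>lborel)"
  proof (rule nn_integral_cong)
    fix r :: real
    show "(\<integral>\<^sup>+x. ennreal (exp (- r)) * indicator {(d x)\<^sup>2..} r \<partial>lborel)
      = (\<Sum>k\<le>n. ennreal (b k) * (ennreal (sqrt r ^ k * exp (- r)) * indicator {0..} r))"
    proof (cases "r \<ge> 0")
      case True
      have "(d x)\<^sup>2 \<le> r \<longleftrightarrow> d x \<le> sqrt r" for x
      proof
        assume "d x \<le> sqrt r"
        then have "(d x)\<^sup>2 \<le> (sqrt r)\<^sup>2" using d0[of x] by (intro power_mono)
        then show "(d x)\<^sup>2 \<le> r" using True by simp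
      qed (rule real_le_rsqrt)
      then have "(\<integral>\<^sup>+x. ennreal (exp (- r)) * indicator {(d x)\<^sup>2..} r \<partial>lborel)
          = (\<integral>\<^sup>+x. ennreal (exp (- r)) * indicator {x. d x \<le> sqrt r} x \<partial>lborel)"
        by (intro nn_integral_cong) (auto simp: indicator_def)
      also have "\<dots> = ennreal (exp (- r)) * emeasure lborel {x. d x \<le> sqrt r}"
        by (subst nn_integral_cmult) auto
      also have "\<dots> = ennreal (exp (- r) * (\<Sum>k\<le>n. b k * sqrt r ^ k))"
        using True by (simp add: m ennreal_mult' )
      also have "exp (- r) * (\<Sum>k\<le>n. b k * sqrt r ^ k) = (\<Sum>k\<le>n. b k * (sqrt r ^ k * exp (- r)))"
        by (simp add: sum_distrib_left algebra_simps)
      also have "ennreal (\<Sum>k\<le>n. b k * (sqrt r ^ k * exp (- r))) = (\<Sum>k\<le>n. ennreal (b k * (sqrt r ^ k * exp (- r))))"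
        using True b0 by (subst sum_ennreal) auto
      finally show ?thesis using True b0 by (simp add: ennreal_mult')
    next
      case False
      then have "\<not> (d x)\<^sup>2 \<le> r" for x using zero_le_power2[of "d x"] by linarith
      then show ?thesis using False by (simp add: indicator_def)
    qed
  qed
  also have "\<dots> = (\<Sum>k\<le>n. ennreal (b k) * ennreal (Gamma (real k / 2 + 1)))"
    by (subst nn_integral_sum) (auto simp: nn_integral_cmult nn_integral_Gamma)
  also have "\<dots> = ennreal (\<Sum>k\<le>n. b k * Gamma (real k / 2 + 1))"
    using b0 by (subst sum_ennreal[symmetric]) (auto simp: ennreal_mult' intro!: mult_nonneg_nonneg Gamma_real_nonneg)
  finally show ?thesis .
qed

text \<open>Here the sublevel sets are balls, so the polynomial is a single monomial, and the Gamma
  factor cancels against the one in the volume of the unit ball.\<close>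

lemma nn_integral_exp_norm:
  fixes t :: real and c :: "'a::euclidean_space"
  assumes t: "t > 0"
  shows "(\<integral>\<^sup>+x. ennreal (exp (- (t * norm (x - c))\<^sup>2)) \<partial>lborel) = ennreal (pi powr (real DIM('a) / 2) / t ^ DIM('a))"
proof -
  let ?n = "DIM('a)"
  define b where "b k = (if k = ?n then unit_ball_vol (real ?n) / t ^ ?n else 0)" for k
  have "(\<integral>\<^sup>+x. ennreal (exp (- (t * norm (x - c))\<^sup>2)) \<partial>lborel) = ennreal (\<Sum>k\<le>?n. b k * Gamma (real k / 2 + 1))"
  proof (rule layer_cake_exp_square)
    fix \<rho> :: real assume r: "0 \<le> \<rho>"
    have "{x. t * norm (x - c) \<le> \<rho>} = cball c (\<rho> / t)"
      using t by (auto simp: dist_norm norm_minus_commute field_simps)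
    then have "emeasure lborel {x. t * norm (x - c) \<le> \<rho>} = ennreal (unit_ball_vol (real ?n) * (\<rho> / t) ^ ?n)"
      using r t by (simp add: emeasure_cball)
    also have "unit_ball_vol (real ?n) * (\<rho> / t) ^ ?n = (\<Sum>k\<le>?n. b k * \<rho> ^ k)"
      by (simp add: b_def if_distrib[of "\<lambda>x. x * _"] sum.delta power_divide cong: if_cong)
    finally show "emeasure lborel {x. t * norm (x - c) \<le> \<rho>} = ennreal (\<Sum>k\<le>?n. b k * \<rho> ^ k)" .
  qed (use t in \<open>auto simp: b_def\<close>)
  also have "(\<Sum>k\<le>?n. b k * Gamma (real k / 2 + 1)) = unit_ball_vol (real ?n) / t ^ ?n * Gamma (real ?n / 2 + 1)"
    by (simp add: b_def if_distrib[of "\<lambda>x. x * _"] sum.delta cong: if_cong)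
  also have "\<dots> = pi powr (real ?n / 2) / t ^ ?n"
  proof -
    have "Gamma (real ?n / 2 + 1) > 0" by (rule Gamma_real_pos) simp
    then have "Gamma (real ?n / 2 + 1) \<noteq> 0" by (rule less_imp_neq[symmetric])
    then show ?thesis by (simp add: unit_ball_vol_def)
  qed
  finally show ?thesis .
qed

lemma integrable_exp_norm:
  fixes t :: real
  assumes t: "t > 0"
  shows "integrable lborel (\<lambda>x::'a::euclidean_space. exp (- (t * norm x)\<^sup>2))"
proof (rule integrableI_bounded)
  show "(\<integral>\<^sup>+x. ennreal (norm (exp (- (t * norm (x::'a))\<^sup>2))) \<partial>lborel) < \<infinity>"
    using nn_integral_exp_norm[OF t, of "0::'a"] by simp
qed measurable

lemma nn_integral_steiner_gauss:
  fixes K :: "(real^'n) set"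
  assumes cK: "compact K" "K \<noteq> {}" and t: "t > 0"
    and a: "\<And>k. 0 \<le> a k" "\<And>\<epsilon>. \<epsilon> \<ge> 0 \<Longrightarrow> measure lebesgue (parallel_body K \<epsilon>) = (\<Sum>k\<le>CARD('n). a k * \<epsilon> ^ k)"
  shows "(\<integral>\<^sup>+x. ennreal (exp (- (t * infdist x K)\<^sup>2)) \<partial>lborel) = ennreal (\<Sum>k\<le>CARD('n). a k / t ^ k * Gamma (real k / 2 + 1))"
proof (rule layer_cake_exp_square)
  show [measurable]: "(\<lambda>x. t * infdist x K) \<in> borel_measurable borel"
    by (intro borel_measurable_continuous_onI continuous_intros)
  fix \<rho> :: real assume r: "0 \<le> \<rho>"
  have eq: "{x. t * infdist x K \<le> \<rho>} = parallel_body K (\<rho> / t)"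
    using t by (auto simp: parallel_body_def field_simps)
  have "{x. t * infdist x K \<le> \<rho>} \<in> sets borel" by measurable
  then have s: "parallel_body K (\<rho> / t) \<in> sets borel" using eq by simp
  have lm: "parallel_body K (\<rho> / t) \<in> lmeasurable" by (rule parallel_body_sets[OF cK])
  have "emeasure lborel (parallel_body K (\<rho> / t)) = emeasure lebesgue (parallel_body K (\<rho> / t))"
    using s by simp
  also have "\<dots> = ennreal (measure lebesgue (parallel_body K (\<rho> / t)))"
    using lm by (simp add: emeasure_eq_measure2 fmeasurableD2)
  also have "measure lebesgue (parallel_body K (\<rho> / t)) = (\<Sum>k\<le>CARD('n). a k / t ^ k * \<rho> ^ k)"
    using a(2)[of "\<rho> / t"] r t by (simp add: power_divide)
  finally show "emeasure lborel {x. t * infdist x K \<le> \<rho>} = ennreal (\<Sum>k\<le>CARD('n). a k / t ^ k * \<rho> ^ k)"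
    by (simp add: eq)
qed (use t a in \<open>auto simp: infdist_nonneg\<close>)

lemma nn_integral_scale:
  fixes f :: "'a::euclidean_space \<Rightarrow> ennreal"
  assumes [measurable]: "f \<in> borel_measurable borel" and c: "c > 0"
  shows "(\<integral>\<^sup>+x. f (c *\<^sub>R x) \<partial>lborel) = (\<integral>\<^sup>+x. f x \<partial>lborel) / ennreal (c ^ DIM('a))"
proof -
  have "(\<integral>\<^sup>+x. f x \<partial>lborel) = (\<integral>\<^sup>+x. f x \<partial>density (distr lborel borel (\<lambda>x::'a. 0 + c *\<^sub>R x)) (\<lambda>_. ennreal (\<bar>c\<bar> ^ DIM('a))))"
    using c by (subst lborel_affine[of c 0, symmetric]) auto
  also have "\<dots> = ennreal (c ^ DIM('a)) * (\<integral>\<^sup>+x. f (c *\<^sub>R x) \<partial>lborel)"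
    using c by (subst nn_integral_density) (auto simp: nn_integral_distr nn_integral_cmult)
  finally show ?thesis
    using c by (simp add: ennreal_mult_divide_eq mult.commute[of "ennreal _"])
qed

section \<open>The norm bounded by a Gaussian integral\<close>

lemma abs_exp_minus_1_le: "\<bar>exp z - 1\<bar> \<le> \<bar>z\<bar> * exp \<bar>z\<bar>" for z :: real
proof (cases "z \<ge> 0")
  case True
  have "1 - z \<le> exp (- z)" using exp_ge_add_one_self[of "- z"] by linarith
  then have "(1 - z) * exp z \<le> exp (- z) * exp z" by (intro mult_right_mono) auto
  then have "exp z - 1 \<le> z * exp z" by (simp add: exp_minus algebra_simps)
  then show ?thesis using True by simp
next
  case False
  have "1 - exp z \<le> - z" using exp_ge_add_one_self[of z] by linarith
  also have "\<dots> \<le> - z * exp (- z)" using False by simp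
  finally show ?thesis using False by simp
qed

text \<open>The linear factor is absorbed into the exponential and the square is completed. The
  right-hand side is the integrable majorant both for linearly bounded functions and for the
  difference quotients below.\<close>

lemma exp_lin_bound:
  fixes r M :: real
  assumes "0 \<le> r" "0 \<le> M"
  shows "2 * M * r * exp (2 * M * r) * exp (- r\<^sup>2) \<le> exp (8 * M\<^sup>2) * exp (- (sqrt (1/2) * r)\<^sup>2)"
proof -
  have "2 * M * r \<le> exp (2 * M * r)" using exp_ge_add_one_self[of "2 * M * r"] by linarith
  then have "2 * M * r * exp (2 * M * r) * exp (- r\<^sup>2) \<le> exp (2 * M * r) * exp (2 * M * r) * exp (- r\<^sup>2)"
    by (intro mult_right_mono) auto
  also have "\<dots> = exp (4 * M * r - r\<^sup>2)" by (simp add: exp_add[symmetric] exp_diff exp_minus inverse_eq_divide)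
  also have "\<dots> \<le> exp (8 * M\<^sup>2 - r\<^sup>2 / 2)"
  proof -
    have "0 \<le> (4 * M - r)\<^sup>2" by simp
    then have "4 * M * r - r\<^sup>2 \<le> 8 * M\<^sup>2 - r\<^sup>2 / 2" by (simp add: power2_eq_square algebra_simps)
    then show ?thesis by simp
  qed
  also have "\<dots> = exp (8 * M\<^sup>2) * exp (- (sqrt (1/2) * r)\<^sup>2)"
    by (simp add: power_mult_distrib exp_diff exp_minus inverse_eq_divide)
  finally show ?thesis .
qed

lemma integrable_norm_gauss:
  fixes H :: "'a::euclidean_space \<Rightarrow> real"
  assumes [measurable]: "H \<in> borel_measurable borel" and M: "0 \<le> M" "\<And>x. \<bar>H x\<bar> \<le> M * norm x"
  shows "integrable lborel (\<lambda>x. H x * exp (- (norm x)\<^sup>2))"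
proof (rule Bochner_Integration.integrable_bound)
  show "integrable lborel (\<lambda>x::'a. exp (8 * M\<^sup>2) * exp (- (sqrt (1/2) * norm x)\<^sup>2))"
    using integrable_exp_norm[of "sqrt (1/2)", where 'a='a] by simp
  show "AE x in lborel. norm (H x * exp (- (norm x)\<^sup>2)) \<le> norm (exp (8 * M\<^sup>2) * exp (- (sqrt (1/2) * norm x)\<^sup>2))"
  proof (intro AE_I2)
    fix x :: 'a
    have "\<bar>H x\<bar> \<le> 2 * M * norm x * exp (2 * M * norm x)"
    proof -
      have "M * norm x * 1 \<le> 2 * M * norm x * exp (2 * M * norm x)" using M(1) by (intro mult_mono) auto
      then show ?thesis using M(2)[of x] by simp
    qed
    then have "\<bar>H x\<bar> * exp (- (norm x)\<^sup>2) \<le> 2 * M * norm x * exp (2 * M * norm x) * exp (- (norm x)\<^sup>2)"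
      by (intro mult_right_mono) auto
    also have "\<dots> \<le> exp (8 * M\<^sup>2) * exp (- (sqrt (1/2) * norm x)\<^sup>2)" using M by (intro exp_lin_bound) auto
    finally show "norm (H x * exp (- (norm x)\<^sup>2)) \<le> norm (exp (8 * M\<^sup>2) * exp (- (sqrt (1/2) * norm x)\<^sup>2))"
      by (simp add: abs_mult)
  qed
qed simp

lemma integral_gauss: "(\<integral>x. exp (- (norm (x::'a::euclidean_space))\<^sup>2) \<partial>lborel) = pi powr (real DIM('a) / 2)"
  using nn_integral_exp_norm[of 1 "0::'a"] by (subst integral_eq_nn_integral) auto

lemma integrable_gauss: "integrable lborel (\<lambda>x::'a::euclidean_space. exp (- (norm x)\<^sup>2))"
  using integrable_exp_norm[of 1, where 'a='a] by simp

lemma steiner_sum_scaled: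
  fixes a :: "nat \<Rightarrow> real"
  assumes "t > 0"
  shows "(\<Sum>k\<le>n. a k / t ^ k * g k) = (\<Sum>k\<le>n. a k * g k * t ^ (n - k)) / t ^ n"
  unfolding sum_divide_distrib
proof (rule sum.cong[OF refl])
  fix k assume "k \<in> {..n}"
  then have "t ^ n = t ^ k * t ^ (n - k)" by (simp add: power_add[symmetric])
  then show "a k / t ^ k * g k = a k * g k * t ^ (n - k) / t ^ n" using assms by simp
qed

text \<open>Stated for a homogeneous majorant \<open>H\<close> of the support function, so that it
  applies to a finite net of \<open>K\<close> with an error proportional to the norm.\<close>

lemma norm_body_le_gauss_integral:
  fixes K :: "(real^'n) set"
  assumes K: "convex_body K" and cH: "continuous_on UNIV H"
    and hom: "\<And>c x. c > 0 \<Longrightarrow> H (c *\<^sub>R x) = c * H x"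
    and M: "0 \<le> M" "\<And>x. \<bar>H x\<bar> \<le> M * norm x"
    and sup: "\<And>k x. k \<in> K \<Longrightarrow> k \<bullet> x \<le> H x"
  shows "norm_body K * Gamma ((real CARD('n) + 1) / 2) \<le> 2 * (\<integral>x. H x * exp (- (norm x)\<^sup>2) \<partial>lborel)"
proof -
  let ?n = "CARD('n)"
  let ?G = "pi powr (real ?n / 2)"
  have [measurable]: "H \<in> borel_measurable borel" using cH by (rule borel_measurable_continuous_onI)
  obtain a where a: "\<And>k. 0 \<le> a k" "\<And>\<epsilon>. \<epsilon> \<ge> 0 \<Longrightarrow> measure lebesgue (parallel_body K \<epsilon>) = (\<Sum>k\<le>?n. a k * \<epsilon> ^ k)"
    "norm_body K = a (?n - 1)"
    using norm_body_steiner[OF K] by blast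
  have cK: "compact K" "K \<noteq> {}" using K by (auto simp: convex_body_def)
  define g where "g k = Gamma (real k / 2 + 1)" for k
  have g0: "0 < g k" for k unfolding g_def by (rule Gamma_real_pos) simp
  define S where "S t = (\<Sum>k\<le>?n. a k * g k * t ^ (?n - k))" for t
  have S: "(\<integral>\<^sup>+x. ennreal (exp (- (t * infdist x K)\<^sup>2)) \<partial>lborel) = ennreal (S t / t ^ ?n)" if "t > 0" for t
    using nn_integral_steiner_gauss[OF cK that a(1,2)] steiner_sum_scaled[OF that, of a g ?n]
    by (simp add: g_def S_def)
  have S0: "0 \<le> S t" if "t \<ge> 0" for t
    unfolding S_def using a(1) g0 that by (intro sum_nonneg mult_nonneg_nonneg) (auto intro: less_imp_le)
  have SG: "?G \<le> S t" if t: "t > 0" for t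
  proof -
    obtain k where k: "k \<in> K" using cK by auto
    have "ennreal (?G / t ^ ?n) = (\<integral>\<^sup>+x. ennreal (exp (- (t * norm (x - k))\<^sup>2)) \<partial>lborel)"
      using nn_integral_exp_norm[OF t, of k] by simp
    also have "\<dots> \<le> (\<integral>\<^sup>+x. ennreal (exp (- (t * infdist x K)\<^sup>2)) \<partial>lborel)"
    proof (rule nn_integral_mono)
      fix x
      have "infdist x K \<le> norm (x - k)" using infdist_le[OF k, of x] by (simp add: dist_norm)
      then have "(t * infdist x K)\<^sup>2 \<le> (t * norm (x - k))\<^sup>2" using t by (intro power_mono mult_left_mono) (auto simp: infdist_nonneg)
      then show "ennreal (exp (- (t * norm (x - k))\<^sup>2)) \<le> ennreal (exp (- (t * infdist x K)\<^sup>2))" by (simp add: ennreal_leI)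
    qed
    also have "\<dots> = ennreal (S t / t ^ ?n)" by (rule S[OF t])
    finally have "?G / t ^ ?n \<le> S t / t ^ ?n" using S0[of t] t by simp
    then show ?thesis using t by (simp add: divide_le_cancel)
  qed
  have contS: "isCont S 0" unfolding S_def by (intro continuous_intros)
  \<comment> \<open>The constant term of \<open>S\<close>. Since distance to \<open>K\<close> is at
    most distance to one of its points, \<open>S t\<close> dominates the plain Gaussian integral,
    and letting t \<rightarrow> 0 isolates this term.\<close>
  have an: "?G \<le> a ?n * g ?n"
  proof -
    have "S 0 = a ?n * g ?n"
    proof -
      have "S 0 = (\<Sum>k\<le>?n. if k = ?n then a ?n * g ?n else 0)"
        unfolding S_def by (rule sum.cong) auto
      then show ?thesis by simp
    qed
    moreover have "(\<lambda>j. S (1 / real (Suc j))) \<longlonglongrightarrow> S 0"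
      by (rule isCont_tendsto_compose[OF contS LIMSEQ_Suc[OF lim_1_over_n]])
    then have "?G \<le> S 0" by (rule LIMSEQ_le_const) (use SG in auto)
    ultimately show ?thesis by simp
  qed
  have n1: "?n \<ge> 1" by (simp add: Suc_leI)
  \<comment> \<open>All summands are nonnegative, so those beyond the constant and the linear one
    may be dropped.\<close>
  have Slow: "?G + norm_body K * Gamma ((real ?n + 1) / 2) * t \<le> S t" if t: "t > 0" for t
  proof -
    have "(\<Sum>k\<in>{?n - 1, ?n}. a k * g k * t ^ (?n - k)) \<le> S t"
      unfolding S_def using a(1) less_imp_le[OF g0] t by (intro sum_mono2) (auto intro!: mult_nonneg_nonneg)
    also have "(\<Sum>k\<in>{?n - 1, ?n}. a k * g k * t ^ (?n - k)) = a (?n - 1) * g (?n - 1) * t + a ?n * g ?n"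
    proof -
      have "?n - 1 \<noteq> ?n" "?n - (?n - 1) = 1" using n1 by linarith+
      then show ?thesis by (simp only: sum.insert finite.intros empty_iff insert_iff simp_thms sum.empty) simp
    qed
    also have "g (?n - 1) = Gamma ((real ?n + 1) / 2)"
      unfolding g_def using n1 by (intro arg_cong[where f = Gamma]) (simp add: of_nat_diff field_simps)
    finally show ?thesis using an a(3) by simp
  qed
  \<comment> \<open>The upper bound for the Gaussian of the distance after the substitution
    \<open>y = t *\<^sub>R x\<close>, in which homogeneity turns \<open>H\<close> at
    \<open>x\<close> into \<open>H y / t\<close>.\<close>
  define F where "F t y = exp (- (norm y)\<^sup>2 + 2 * t * H y)" for t and y :: "real^'n"
  have [measurable]: "F t \<in> borel_measurable borel" for t unfolding F_def by measurable
  have Sup: "ennreal (S t) \<le> (\<integral>\<^sup>+y. ennreal (F t y) \<partial>lborel)" if t: "t > 0" for t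
  proof -
    have "ennreal (S t / t ^ ?n) = (\<integral>\<^sup>+x. ennreal (exp (- (t * infdist x K)\<^sup>2)) \<partial>lborel)"
      using S[OF t] by simp
    also have "\<dots> \<le> (\<integral>\<^sup>+x. ennreal (F t (t *\<^sub>R x)) \<partial>lborel)"
    proof (rule nn_integral_mono)
      fix x
      obtain k where k: "k \<in> K" "infdist x K = dist x k"
        using infdist_attains_inf[of K x] cK by (auto simp: compact_imp_closed)
      have "(dist x k)\<^sup>2 = (norm x)\<^sup>2 - 2 * (k \<bullet> x) + (norm k)\<^sup>2"
        by (simp add: dist_norm power2_norm_eq_inner inner_diff_left inner_diff_right inner_commute)
      then have "(norm x)\<^sup>2 - 2 * H x \<le> (infdist x K)\<^sup>2" 
        using sup[OF k(1), of x] zero_le_power2[of "norm k"] unfolding k(2) by linarith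
      then have "t\<^sup>2 * ((norm x)\<^sup>2 - 2 * H x) \<le> t\<^sup>2 * (infdist x K)\<^sup>2" by (intro mult_left_mono) auto
      then have "- (t * infdist x K)\<^sup>2 \<le> - (norm (t *\<^sub>R x))\<^sup>2 + 2 * t * H (t *\<^sub>R x)"
        using t hom[OF t, of x] by (simp add: power_mult_distrib power2_eq_square algebra_simps)
      then show "ennreal (exp (- (t * infdist x K)\<^sup>2)) \<le> ennreal (F t (t *\<^sub>R x))"
        unfolding F_def by (intro ennreal_leI) simp
    qed
    also have "\<dots> = (\<integral>\<^sup>+y. ennreal (F t y) \<partial>lborel) / ennreal (t ^ ?n)"
      using nn_integral_scale[of "\<lambda>y. ennreal (F t y)" t] t by simp
    finally have "ennreal (t ^ ?n) * ennreal (S t / t ^ ?n) \<le> ennreal (t ^ ?n) * ((\<integral>\<^sup>+y. ennreal (F t y) \<partial>lborel) / ennreal (t ^ ?n))"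
      by (rule mult_left_mono) simp
    moreover have "ennreal (t ^ ?n) * ennreal (S t / t ^ ?n) = ennreal (S t)"
      using t S0[of t] by (simp add: ennreal_mult'[symmetric])
    moreover have "ennreal (t ^ ?n) * ((\<integral>\<^sup>+y. ennreal (F t y) \<partial>lborel) / ennreal (t ^ ?n)) = (\<integral>\<^sup>+y. ennreal (F t y) \<partial>lborel)"
      using t by (simp add: ennreal_times_divide ennreal_mult_divide_eq mult.commute[of "ennreal _"])
    ultimately show ?thesis by simp
  qed
  \<comment> \<open>The difference quotient of \<open>F\<close> at \<open>t = 0\<close>. The
    constant terms on both sides being \<open>?G\<close>, division by \<open>t\<close> leaves a
    bound by its integral, and dominated convergence gives the limit \<open>2 * H y\<close> times
    the Gaussian density.\<close>
  define s where "s t y = exp (- (norm y)\<^sup>2) * ((exp (2 * H y * t) - 1) / t)" for t and y :: "real^'n"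
  have [measurable]: "s t \<in> borel_measurable borel" for t unfolding s_def by measurable
  let ?dom = "\<lambda>y::real^'n. exp (8 * M\<^sup>2) * exp (- (sqrt (1/2) * norm y)\<^sup>2)"
  have int_dom: "integrable lborel ?dom" using integrable_exp_norm[of "sqrt (1/2)", where 'a="real^'n"] by simp
  have bound: "\<bar>s t y\<bar> \<le> ?dom y" if t: "0 < t" "t \<le> 1" for t y
  proof -
    have "\<bar>exp (2 * H y * t) - 1\<bar> \<le> \<bar>2 * H y * t\<bar> * exp \<bar>2 * H y * t\<bar>" by (rule abs_exp_minus_1_le)
    also have "\<dots> \<le> (2 * M * norm y * t) * exp (2 * M * norm y)"
    proof (rule mult_mono)
      show "\<bar>2 * H y * t\<bar> \<le> 2 * M * norm y * t" using M(2)[of y] t by (simp add: abs_mult)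
      have "\<bar>2 * H y * t\<bar> \<le> 2 * (M * norm y) * 1"
        unfolding abs_mult using M(2)[of y] t M(1) by (intro mult_mono) auto
      then show "exp \<bar>2 * H y * t\<bar> \<le> exp (2 * M * norm y)" by simp
    qed (use M t in auto)
    finally have "\<bar>exp (2 * H y * t) - 1\<bar> / t \<le> 2 * M * norm y * exp (2 * M * norm y)"
      using t by (simp add: divide_le_eq algebra_simps)
    then have "\<bar>exp (2 * H y * t) - 1\<bar> / t * exp (- (norm y)\<^sup>2) \<le> 2 * M * norm y * exp (2 * M * norm y) * exp (- (norm y)\<^sup>2)"
      by (rule mult_right_mono) simp
    then have "\<bar>s t y\<bar> \<le> 2 * M * norm y * exp (2 * M * norm y) * exp (- (norm y)\<^sup>2)"
      using t unfolding s_def by (simp add: abs_mult abs_divide mult.commute[of "exp (- (norm y)\<^sup>2)"])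
    also have "\<dots> \<le> ?dom y" using M by (intro exp_lin_bound) auto
    finally show ?thesis .
  qed
  have ints: "integrable lborel (s t)" if t: "0 < t" "t \<le> 1" for t
    by (rule Bochner_Integration.integrable_bound[OF int_dom]) (use bound[OF t] in auto)
  have le: "norm_body K * Gamma ((real ?n + 1) / 2) \<le> (\<integral>y. s t y \<partial>lborel)" if t: "0 < t" "t \<le> 1" for t
  proof -
    have Fs: "F t y = exp (- (norm y)\<^sup>2) + t * s t y" for y
    proof -
      have "t * s t y = exp (- (norm y)\<^sup>2) * (exp (2 * H y * t) - 1)" using t by (simp add: s_def)
      moreover have "F t y = exp (- (norm y)\<^sup>2) * exp (2 * H y * t)" unfolding F_def exp_add by (simp add: mult.commute mult.left_commute)
      ultimately show ?thesis by (simp add: right_diff_distrib)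
    qed
    have intF: "integrable lborel (F t)" unfolding Fs
      using integrable_gauss[where 'a="real^'n"] ints[OF t] by (intro Bochner_Integration.integrable_add integrable_mult_right)
    have F0: "0 \<le> F t y" for y by (simp add: F_def)
    have "ennreal (S t) \<le> ennreal (\<integral>y. F t y \<partial>lborel)"
      using Sup[OF t(1)] nn_integral_eq_integral[OF intF] F0 by simp
    moreover have "0 \<le> (\<integral>y. F t y \<partial>lborel)" using F0 by (intro integral_nonneg_AE) auto
    ultimately have "S t \<le> (\<integral>y. F t y \<partial>lborel)" by simp
    also have "\<dots> = ?G + t * (\<integral>y. s t y \<partial>lborel)"
      unfolding Fs using integrable_gauss[where 'a="real^'n"] ints[OF t] integral_gauss[where 'a="real^'n"] by simp
    finally have "t * (norm_body K * Gamma ((real ?n + 1) / 2)) \<le> t * (\<integral>y. s t y \<partial>lborel)"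
      using Slow[OF t(1)] by (simp add: mult.commute)
    then show ?thesis using t(1) by simp
  qed
  have "(\<lambda>j. \<integral>y. s (1 / real (Suc j)) y \<partial>lborel) \<longlonglongrightarrow> (\<integral>y. exp (- (norm y)\<^sup>2) * (2 * H y) \<partial>lborel)"
  proof (rule integral_dominated_convergence[OF _ _ int_dom])
    show "AE y in lborel. (\<lambda>j. s (1 / real (Suc j)) y) \<longlonglongrightarrow> exp (- (norm y)\<^sup>2) * (2 * H y)"
    proof (intro AE_I2)
      fix y :: "real^'n"
      have "((\<lambda>t. exp (2 * H y * t)) has_real_derivative (2 * H y)) (at 0)"
        by (auto intro!: derivative_eq_intros)
      then have "((\<lambda>h. (exp (2 * H y * h) - 1) / h) \<longlongrightarrow> 2 * H y) (at 0)" by (simp add: DERIV_def)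
      moreover have "filterlim (\<lambda>j. 1 / real (Suc j)) (at 0) sequentially"
        by (rule filterlim_atI[OF LIMSEQ_Suc[OF lim_1_over_n]]) auto
      ultimately have "(\<lambda>j. (exp (2 * H y * (1 / real (Suc j))) - 1) / (1 / real (Suc j))) \<longlonglongrightarrow> 2 * H y"
        by (rule filterlim_compose)
      then show "(\<lambda>j. s (1 / real (Suc j)) y) \<longlonglongrightarrow> exp (- (norm y)\<^sup>2) * (2 * H y)"
        unfolding s_def by (intro tendsto_mult tendsto_const)
    qed
    show "AE y in lborel. norm (s (1 / real (Suc j)) y) \<le> ?dom y" for j
      using bound[of "1 / real (Suc j)"] by (intro AE_I2) auto
  qed measurable
  then have "norm_body K * Gamma ((real ?n + 1) / 2) \<le> (\<integral>y. exp (- (norm y)\<^sup>2) * (2 * H y) \<partial>lborel)"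
    by (rule LIMSEQ_le_const) (use le in auto)
  also have "\<dots> = (\<integral>y. 2 * (H y * exp (- (norm y)\<^sup>2)) \<partial>lborel)"
    by (intro Bochner_Integration.integral_cong) auto
  also have "\<dots> = 2 * (\<integral>y. H y * exp (- (norm y)\<^sup>2) \<partial>lborel)" by simp
  finally show ?thesis .
qed

text \<open>The right-hand side is the area of the unit sphere times a Gamma value. Instead of polar
  coordinates, Steiner's formula for the unit ball is used: the distance of \<open>x\<close> from
  the ball is at most \<open>\<bar>norm x - 1\<bar>\<close>, which yields a lower bound for its
  Gaussian integral, and the terms linear in \<open>t\<close> are compared.\<close>

lemma integral_norm_gauss_le:
  "2 * (\<integral>x. norm (x::real^'n) * exp (- (norm x)\<^sup>2) \<partial>lborel)
     \<le> real CARD('n) * unit_ball_vol (real CARD('n)) * Gamma ((real CARD('n) + 1) / 2)"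
proof -
  let ?n = "CARD('n)" and ?K = "cball 0 1 :: (real^'n) set"
  let ?G = "pi powr (real ?n / 2)"
  define A where "A = (\<integral>x. norm (x::real^'n) * exp (- (norm x)\<^sup>2) \<partial>lborel)"
  define a where "a k = unit_ball_vol (real ?n) * real (?n choose k)" for k
  define g where "g k = Gamma (real k / 2 + 1)" for k
  have g0: "0 < g k" for k unfolding g_def by (rule Gamma_real_pos) simp
  have a0: "0 \<le> a k" for k unfolding a_def by simp
  have intA: "integrable lborel (\<lambda>x::real^'n. norm x * exp (- (norm x)\<^sup>2))"
    by (rule integrable_norm_gauss[where M = 1]) auto
  have A0: "0 \<le> A" unfolding A_def by (intro integral_nonneg_AE) auto
  have inf_le: "infdist x ?K \<le> \<bar>norm x - 1\<bar>" "infdist x ?K \<le> \<epsilon> \<longleftrightarrow> norm x \<le> 1 + \<epsilon>" if "\<epsilon> \<ge> 0" for x \<epsilon>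
  proof -
    have up: "infdist x ?K \<le> \<bar>norm x - 1\<bar>" and up2: "norm x \<le> 1 + \<epsilon> \<Longrightarrow> infdist x ?K \<le> \<epsilon>"
    proof -
      have small: "infdist x ?K = 0" if "norm x \<le> 1" using that by (intro infdist_zero) simp
      have big: "infdist x ?K \<le> norm x - 1" if "norm x > 1"
      proof -
        have "sgn x \<in> ?K" by (simp add: norm_sgn)
        then have "infdist x ?K \<le> dist x (sgn x)" by (rule infdist_le)
        also have "norm x *\<^sub>R sgn x = x" using that by (cases "x = 0") (auto simp: sgn_div_norm)
        then have "x - sgn x = (norm x - 1) *\<^sub>R sgn x" by (simp add: algebra_simps)
        then have "dist x (sgn x) = norm x - 1" using that by (cases "x = 0") (auto simp: dist_norm norm_sgn)
        finally show ?thesis .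
      qed
      show "infdist x ?K \<le> \<bar>norm x - 1\<bar>" using small big by (cases "norm x \<le> 1") auto
      show "infdist x ?K \<le> \<epsilon>" if "norm x \<le> 1 + \<epsilon>" using small big that \<open>\<epsilon> \<ge> 0\<close> by (cases "norm x \<le> 1") auto
    qed
    show "infdist x ?K \<le> \<bar>norm x - 1\<bar>" by (rule up)
    have "norm x \<le> 1 + \<epsilon>" if "infdist x ?K \<le> \<epsilon>"
    proof -
      obtain k where k: "k \<in> ?K" "infdist x ?K = dist x k" using infdist_attains_inf[of ?K x] by auto
      then show ?thesis using that norm_triangle_sub[of x k] by (simp add: dist_norm)
    qed
    then show "infdist x ?K \<le> \<epsilon> \<longleftrightarrow> norm x \<le> 1 + \<epsilon>" using up2 by blast
  qed
  have pb: "parallel_body ?K \<epsilon> = cball 0 (1 + \<epsilon>)" if "\<epsilon> \<ge> 0" for \<epsilon>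
    unfolding parallel_body_def inf_le(2)[OF that] by (simp add: set_eq_iff)
  have st: "measure lebesgue (parallel_body ?K \<epsilon>) = (\<Sum>k\<le>?n. a k * \<epsilon> ^ k)" if e: "\<epsilon> \<ge> 0" for \<epsilon>
  proof -
    have "measure lebesgue (parallel_body ?K \<epsilon>) = unit_ball_vol (real ?n) * (\<epsilon> + 1) ^ ?n"
      using e by (simp add: pb content_cball add.commute)
    also have "(\<epsilon> + 1) ^ ?n = (\<Sum>k\<le>?n. real (?n choose k) * \<epsilon> ^ k)"
      by (simp add: binomial_ring)
    finally show ?thesis by (simp add: a_def sum_distrib_left mult.assoc)
  qed
  \<comment> \<open>The Steiner sum without its top term, divided by \<open>t\<close>. The top term
    equals \<open>?G\<close>, and \<open>S 0\<close> is the coefficient of \<open>t\<close> in the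
    full sum.\<close>
  define S where "S t = (\<Sum>k<?n. a k * g k * t ^ (?n - 1 - k))" for t
  have an: "a ?n * g ?n = ?G"
    using less_imp_neq[OF g0[of ?n]] by (simp add: a_def g_def unit_ball_vol_def)
  have low: "2 * A - t * (?G + 2 * t * A) \<le> S t" if t: "0 < t" for t
  proof -
    have sumS: "(\<Sum>k\<le>?n. a k * g k * t ^ (?n - k)) = t * S t + ?G"
    proof -
      have "(\<Sum>k<?n. a k * g k * t ^ (?n - k)) = t * S t"
        unfolding S_def sum_distrib_left
      proof (rule sum.cong[OF refl])
        fix k assume "k \<in> {..<?n}"
        then have "?n - k = Suc (?n - 1 - k)" by auto
        then show "a k * g k * t ^ (?n - k) = t * (a k * g k * t ^ (?n - 1 - k))" by simp
      qed
      then show ?thesis using an by (simp add: lessThan_Suc_atMost[symmetric])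
    qed
    \<comment> \<open>The square of \<open>norm x - 1\<close> is expanded, and the exponential of
      the mixed term is bounded below by its linear part; what remains is integrated
      explicitly.\<close>
    define F where "F y = exp (- t\<^sup>2) * (exp (- (norm y)\<^sup>2) + 2 * t * (norm y * exp (- (norm y)\<^sup>2)))" for y :: "real^'n"
    have [measurable]: "F \<in> borel_measurable borel" unfolding F_def by measurable
    have F0: "0 \<le> F y" for y unfolding F_def using t by simp
    have intF: "integrable lborel F" unfolding F_def
      using integrable_gauss[where 'a="real^'n"] intA by simp
    have valF: "(\<integral>y. F y \<partial>lborel) = exp (- t\<^sup>2) * (?G + 2 * t * A)"
      unfolding F_def A_def using integrable_gauss[where 'a="real^'n"] intA integral_gauss[where 'a="real^'n"] by simp
    have "ennreal (\<integral>y. F y \<partial>lborel) / ennreal (t ^ ?n) = (\<integral>\<^sup>+y. ennreal (F y) \<partial>lborel) / ennreal (t ^ ?n)"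
      using nn_integral_eq_integral[OF intF] F0 by simp
    also have "\<dots> = (\<integral>\<^sup>+x. ennreal (F (t *\<^sub>R x)) \<partial>lborel)"
      using nn_integral_scale[of "\<lambda>y. ennreal (F y)" t] t by simp
    also have "\<dots> \<le> (\<integral>\<^sup>+x. ennreal (exp (- (t * infdist x ?K)\<^sup>2)) \<partial>lborel)"
    proof (rule nn_integral_mono)
      fix x :: "real^'n"
      have "infdist x ?K \<le> \<bar>norm x - 1\<bar>" using inf_le(1)[of 0] by simp
      then have "(infdist x ?K)\<^sup>2 \<le> \<bar>norm x - 1\<bar>\<^sup>2" by (intro power_mono) (auto simp: infdist_nonneg)
      then have "t\<^sup>2 * (infdist x ?K)\<^sup>2 \<le> t\<^sup>2 * \<bar>norm x - 1\<bar>\<^sup>2" by (intro mult_left_mono) auto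
      then have "(t * infdist x ?K)\<^sup>2 \<le> (t * norm x)\<^sup>2 - 2 * t * (t * norm x) + t\<^sup>2"
        by (simp add: power_mult_distrib power2_eq_square algebra_simps)
      then have "exp (- t\<^sup>2 + (- (t * norm x)\<^sup>2 + 2 * t * (t * norm x))) \<le> exp (- (t * infdist x ?K)\<^sup>2)" by simp
      moreover have "F (t *\<^sub>R x) \<le> exp (- t\<^sup>2 + (- (t * norm x)\<^sup>2 + 2 * t * (t * norm x)))"
      proof -
        have "F (t *\<^sub>R x) = exp (- t\<^sup>2) * (exp (- (t * norm x)\<^sup>2) * (1 + 2 * t * (t * norm x)))"
          using t by (simp add: F_def algebra_simps)
        also have "\<dots> \<le> exp (- t\<^sup>2) * (exp (- (t * norm x)\<^sup>2) * exp (2 * t * (t * norm x)))"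
          by (intro mult_left_mono exp_ge_add_one_self) auto
        finally show ?thesis by (simp only: exp_add)
      qed
      ultimately show "ennreal (F (t *\<^sub>R x)) \<le> ennreal (exp (- (t * infdist x ?K)\<^sup>2))" by (intro ennreal_leI) linarith
    qed
    also have "\<dots> = ennreal ((t * S t + ?G) / t ^ ?n)"
      using nn_integral_steiner_gauss[OF _ _ t a0 st] steiner_sum_scaled[OF t, of a g ?n] by (simp add: g_def[symmetric] sumS)
    finally have "ennreal ((\<integral>y. F y \<partial>lborel) / t ^ ?n) \<le> ennreal ((t * S t + ?G) / t ^ ?n)"
      using t F0 by (simp add: divide_ennreal integral_nonneg_AE)
    moreover have "0 \<le> (t * S t + ?G) / t ^ ?n"
      unfolding S_def using t a0 less_imp_le[OF g0] by (intro divide_nonneg_pos add_nonneg_nonneg mult_nonneg_nonneg sum_nonneg) auto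
    ultimately have "(\<integral>y. F y \<partial>lborel) / t ^ ?n \<le> (t * S t + ?G) / t ^ ?n" by simp
    then have "exp (- t\<^sup>2) * (?G + 2 * t * A) \<le> t * S t + ?G" using t valF by (simp add: divide_le_cancel)
    moreover have "(1 - t\<^sup>2) * (?G + 2 * t * A) \<le> exp (- t\<^sup>2) * (?G + 2 * t * A)"
      using t A0 exp_ge_add_one_self[of "- t\<^sup>2"] by (intro mult_right_mono) auto
    ultimately have "t * (2 * A - t * (?G + 2 * t * A)) \<le> t * S t" by (simp add: power2_eq_square algebra_simps)
    then show ?thesis using t by simp
  qed
  have contS: "isCont S 0" unfolding S_def by (intro continuous_intros)
  have lim: "(\<lambda>j. 1 / real (Suc j)) \<longlonglongrightarrow> 0" by (rule LIMSEQ_Suc[OF lim_1_over_n])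
  have 1: "(\<lambda>j. S (1 / real (Suc j))) \<longlonglongrightarrow> S 0" by (rule isCont_tendsto_compose[OF contS lim])
  have 2: "(\<lambda>j. 2 * A - (1 / real (Suc j)) * (?G + 2 * (1 / real (Suc j)) * A)) \<longlonglongrightarrow> 2 * A - 0 * (?G + 2 * 0 * A)"
    by (intro tendsto_intros lim)
  have "2 * A - 0 * (?G + 2 * 0 * A) \<le> S 0"
    by (rule LIMSEQ_le[OF 2 1]) (intro exI allI impI low, simp)
  moreover have "S 0 = a (?n - 1) * g (?n - 1)"
  proof -
    have "S 0 = (\<Sum>k<?n. if k = ?n - 1 then a (?n - 1) * g (?n - 1) else 0)"
      unfolding S_def by (rule sum.cong) auto
    then show ?thesis by (simp add: sum.delta)
  qed
  moreover have "g (?n - 1) = Gamma ((real ?n + 1) / 2)"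
    unfolding g_def by (intro arg_cong[where f = Gamma]) (simp add: of_nat_diff Suc_leI field_simps)
  moreover have "a (?n - 1) = real ?n * unit_ball_vol (real ?n)"
    using binomial_symmetric[of "?n - 1" ?n] by (simp add: a_def Suc_leI)
  ultimately show ?thesis by (simp add: A_def)
qed

section \<open>Rotation invariance and Crofton's formula with Gaussian weight\<close>

lemma lborel_orthogonal:
  fixes f :: "real^'n \<Rightarrow> real^'n"
  assumes f: "orthogonal_transformation f"
  shows "distr lborel borel f = lborel"
proof -
  have linf: "linear f" using f by (rule orthogonal_transformation_linear)
  have [measurable]: "f \<in> borel_measurable borel"
    using linear_continuous_on[OF linear_conv_bounded_linear[THEN iffD1, OF linf]] by (rule borel_measurable_continuous_onI)
  define h where "h = inv f"
  have h: "orthogonal_transformation h" using f by (simp add: h_def orthogonal_transformation_inv)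
  have bij: "bij f" using f by (rule orthogonal_transformation_bij)
  have "lborel = distr lborel borel f"
  proof (rule lborel_eqI)
    fix l u :: "real^'n" assume lu: "\<And>b. b \<in> Basis \<Longrightarrow> l \<bullet> b \<le> u \<bullet> b"
    have im: "f -` box l u = h ` box l u" using bij by (simp add: h_def bij_vimage_eq_inv_image)
    have s: "f -` box l u \<in> sets borel" using measurable_sets[of f borel borel "box l u"] by simp
    have "emeasure (distr lborel borel f) (box l u) = emeasure lborel (f -` box l u)"
      by (subst emeasure_distr) auto
    also have "\<dots> = emeasure lebesgue (f -` box l u)" using s by simp
    also have "\<dots> = ennreal (measure lebesgue (h ` box l u))"
      unfolding im using measure_orthogonal(1)[OF h, of "box l u"] by (simp add: emeasure_eq_measure2 fmeasurableD2)
    also have "measure lebesgue (h ` box l u) = measure lebesgue (box l u)"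
      by (rule measure_orthogonal(2)[OF h]) simp
    also have "ennreal (measure lebesgue (box l u)) = emeasure lborel (box l u)"
      by (simp add: emeasure_eq_measure2 fmeasurableD2[OF lmeasurable_box])
    also have "\<dots> = (\<Prod>b\<in>Basis. (u - l) \<bullet> b)" using lu by (rule emeasure_lborel_box)
    finally show "emeasure (distr lborel borel f) (box l u) = (\<Prod>b\<in>Basis. (u - l) \<bullet> b)" .
  qed simp
  then show ?thesis by simp
qed

lemma integral_orthogonal:
  fixes f :: "real^'n \<Rightarrow> real^'n" and g :: "real^'n \<Rightarrow> real"
  assumes f: "orthogonal_transformation f" and [measurable]: "g \<in> borel_measurable borel"
  shows "(\<integral>x. g (f x) \<partial>lborel) = (\<integral>x. g x \<partial>lborel)"
proof -
  have [measurable]: "f \<in> borel_measurable borel"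
    using linear_continuous_on[OF linear_conv_bounded_linear[THEN iffD1, OF orthogonal_transformation_linear[OF f]]]
    by (rule borel_measurable_continuous_onI)
  have "(\<integral>x. g x \<partial>lborel) = (\<integral>x. g x \<partial>distr lborel borel f)" by (simp add: lborel_orthogonal[OF f])
  also have "\<dots> = (\<integral>x. g (f x) \<partial>lborel)" by (rule integral_distr) auto
  finally show ?thesis by simp
qed

text \<open>With \<open>v\<close> rotated to a coordinate axis the integral is a product: the axis
  contributes the integral of \<open>\<bar>s\<bar> * exp (- s\<^sup>2)\<close>, which is 1, and each
  other coordinate contributes \<open>sqrt pi\<close>.\<close>

lemma integral_abs_inner_gauss:
  fixes v :: "real^'n"
  shows "(\<integral>x. \<bar>v \<bullet> x\<bar> * exp (- (norm x)\<^sup>2) \<partial>lborel) = norm v * pi powr ((real CARD('n) - 1) / 2)"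
proof -
  obtain i :: 'n where True by auto
  let ?e = "axis i 1 :: real^'n"
  obtain f where f: "orthogonal_transformation f" "f (norm v *\<^sub>R ?e) = v"
    using orthogonal_transformation_exists[of "norm v *\<^sub>R ?e" v] by auto
  have "(\<integral>x. \<bar>v \<bullet> x\<bar> * exp (- (norm x)\<^sup>2) \<partial>lborel) = (\<integral>x. \<bar>v \<bullet> f x\<bar> * exp (- (norm (f x))\<^sup>2) \<partial>lborel)"
    by (rule integral_orthogonal[OF f(1), symmetric]) measurable
  also have "\<dots> = (\<integral>x. norm v * (\<bar>x \<bullet> ?e\<bar> * exp (- (norm x)\<^sup>2)) \<partial>lborel)"
  proof (rule Bochner_Integration.integral_cong)
    fix x
    have "f (norm v *\<^sub>R ?e) \<bullet> f x = (norm v *\<^sub>R ?e) \<bullet> x" using f(1) by (simp only: orthogonal_transformation_def)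
    then have "v \<bullet> f x = norm v * (x \<bullet> ?e)" by (simp add: f(2) inner_commute)
    then show "\<bar>v \<bullet> f x\<bar> * exp (- (norm (f x))\<^sup>2) = norm v * (\<bar>x \<bullet> ?e\<bar> * exp (- (norm x)\<^sup>2))"
      using f(1) by (simp add: abs_mult orthogonal_transformation_norm)
  qed simp
  also have "\<dots> = norm v * (\<integral>x. \<bar>x \<bullet> ?e\<bar> * exp (- (norm x)\<^sup>2) \<partial>lborel)" by simp
  also have "(\<integral>x. \<bar>x \<bullet> ?e\<bar> * exp (- (norm x)\<^sup>2) \<partial>lborel) = pi powr ((real CARD('n) - 1) / 2)"
  proof -
    define \<phi> where "\<phi> b s = (if b = ?e then \<bar>s\<bar> else 1) * exp (- s\<^sup>2)" for b :: "real^'n" and s :: real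
    have [measurable]: "\<phi> b \<in> borel_measurable borel" for b unfolding \<phi>_def by measurable
    have eB: "?e \<in> Basis" by simp
    have prod: "\<bar>x \<bullet> ?e\<bar> * exp (- (norm x)\<^sup>2) = (\<Prod>b\<in>Basis. \<phi> b (x \<bullet> b))" for x
    proof -
      have "(\<Prod>b\<in>Basis. \<phi> b (x \<bullet> b)) = (\<Prod>b\<in>Basis. if b = ?e then \<bar>x \<bullet> b\<bar> else 1) * (\<Prod>b\<in>Basis. exp (- (x \<bullet> b)\<^sup>2))"
        unfolding \<phi>_def by (rule prod.distrib)
      also have "(\<Prod>b\<in>Basis. if b = ?e then \<bar>x \<bullet> b\<bar> else 1) = \<bar>x \<bullet> ?e\<bar>" using eB by simp
      also have "(\<Prod>b\<in>Basis. exp (- (x \<bullet> b)\<^sup>2)) = exp (- (norm x)\<^sup>2)"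
      proof -
        have "(norm x)\<^sup>2 = (\<Sum>b\<in>Basis. (x \<bullet> b)\<^sup>2)"
          unfolding power2_norm_eq_inner by (subst euclidean_inner) (simp add: power2_eq_square)
        then show ?thesis by (simp add: exp_sum sum_negf[symmetric])
      qed
      finally show ?thesis by simp
    qed
    have m0: "(\<integral>\<^sup>+s. ennreal (exp (- s\<^sup>2)) \<partial>lborel) = ennreal (sqrt pi)"
    proof -
      have "(\<integral>\<^sup>+s. ennreal (exp (- (1 * norm (s - (0::real)))\<^sup>2)) \<partial>lborel) = ennreal (pi powr (real DIM(real) / 2) / 1 ^ DIM(real))"
        by (rule nn_integral_exp_norm) simp
      then show ?thesis by (simp add: powr_half_sqrt)
    qed
    have m1: "(\<integral>\<^sup>+s. ennreal (\<bar>s\<bar> * exp (- s\<^sup>2)) \<partial>lborel) = 1"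
    proof -
      have "has_bochner_integral lborel (\<lambda>x::real. indicator {0..} x *\<^sub>R (\<bar>x\<bar> * exp (- x\<^sup>2))) (1 / 2)"
        using gaussian_moment_1 by (rule has_bochner_integral_cong[THEN iffD1, rotated -1]) (auto simp: indicator_def)
      from has_bochner_integral_even_function[OF this] have "has_bochner_integral lborel (\<lambda>x::real. \<bar>x\<bar> * exp (- x\<^sup>2)) 1" by simp
      then show ?thesis
        using nn_integral_eq_integral[of lborel "\<lambda>x::real. \<bar>x\<bar> * exp (- x\<^sup>2)"]
        by (simp add: has_bochner_integral_iff)
    qed
    have "(\<integral>\<^sup>+x. ennreal (\<bar>x \<bullet> ?e\<bar> * exp (- (norm x)\<^sup>2)) \<partial>lborel) = (\<integral>\<^sup>+x. (\<Prod>b\<in>Basis. ennreal (\<phi> b (x \<bullet> b))) \<partial>lborel)"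
      unfolding prod by (intro nn_integral_cong prod_ennreal[symmetric]) (auto simp: \<phi>_def)
    also have "\<dots> = (\<Prod>b\<in>Basis. \<integral>\<^sup>+s. ennreal (\<phi> b s) \<partial>lborel)"
      by (rule nn_integral_lborel_prod) auto
    also have "\<dots> = (\<Prod>b\<in>Basis. if b = ?e then 1 else ennreal (sqrt pi))"
      by (intro prod.cong) (auto simp: \<phi>_def m0 m1)
    also have "\<dots> = (\<Prod>b\<in>Basis - {?e}. ennreal (sqrt pi))"
      by (subst prod.remove[OF _ eB]) (auto intro!: prod.cong)
    also have "\<dots> = ennreal (sqrt pi ^ (CARD('n) - 1))"
      by (simp add: card_Diff_singleton eB ennreal_power)
    finally have "(\<integral>x. \<bar>x \<bullet> ?e\<bar> * exp (- (norm x)\<^sup>2) \<partial>lborel) = sqrt pi ^ (CARD('n) - 1)"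
      by (subst integral_eq_nn_integral) auto
    also have "\<dots> = sqrt pi powr real (CARD('n) - 1)" by (subst powr_realpow) auto
    also have "\<dots> = (pi powr (1/2)) powr real (CARD('n) - 1)" by (simp add: powr_half_sqrt)
    also have "\<dots> = pi powr (1/2 * real (CARD('n) - 1))" by (rule powr_powr)
    also have "1/2 * real (CARD('n) - 1) = (real CARD('n) - 1) / 2" by (simp add: of_nat_diff Suc_leI)
    finally show ?thesis .
  qed
  finally show ?thesis .
qed

subsection \<open>Averaging over great circles\<close>

definition gauss :: "(real^'n) measure" where
  "gauss = density lborel (\<lambda>x. ennreal (exp (- (norm x)\<^sup>2)))"

text \<open>The weight \<open>norm x\<close> absorbs the homogeneity: the Gaussian integral of a
  function of degree 1 is the \<open>wgauss\<close>-integral of its values on directions.\<close>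

definition wgauss :: "(real^'n) measure" where
  "wgauss = density lborel (\<lambda>x. ennreal (norm x * exp (- (norm x)\<^sup>2)))"

lemma sets_gauss [simp, measurable_cong]: "sets gauss = sets borel" "sets wgauss = sets borel"
  by (auto simp: gauss_def wgauss_def)
lemma space_gauss [simp]: "space gauss = UNIV" "space wgauss = UNIV"
  by (auto simp: gauss_def wgauss_def)

lemma emeasure_gauss: "emeasure (gauss :: (real^'n) measure) UNIV = ennreal (pi powr (real CARD('n) / 2))"
proof -
  have "emeasure (gauss :: (real^'n) measure) UNIV = (\<integral>\<^sup>+x. ennreal (exp (- (1 * norm (x - 0 :: real^'n))\<^sup>2)) \<partial>lborel)"
    by (simp add: gauss_def emeasure_density)
  then show ?thesis by (subst (asm) nn_integral_exp_norm) auto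
qed

lemma finite_gauss: "finite_measure gauss"
  by (rule finite_measureI) (simp add: emeasure_gauss)

lemma integral_wgauss:
  fixes f :: "real^'n \<Rightarrow> real"
  assumes [measurable]: "f \<in> borel_measurable borel"
  shows "(\<integral>x. f x \<partial>wgauss) = (\<integral>x. norm x * exp (- (norm x)\<^sup>2) * f x \<partial>lborel)"
  unfolding wgauss_def by (subst integral_density) auto

lemma finite_wgauss: "finite_measure (wgauss :: (real^'n) measure)"
proof (rule finite_measureI)
  have i: "integrable lborel (\<lambda>x::real^'n. norm x * exp (- (norm x)\<^sup>2))"
    by (rule integrable_norm_gauss[where M = 1]) auto
  have "emeasure (wgauss :: (real^'n) measure) UNIV = (\<integral>\<^sup>+x. ennreal (norm (x::real^'n) * exp (- (norm x)\<^sup>2)) \<partial>lborel)"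
    by (simp add: wgauss_def emeasure_density)
  then show "emeasure (wgauss :: (real^'n) measure) (space wgauss) \<noteq> \<infinity>"
    using nn_integral_eq_integral[OF i] by simp
qed

lemma orthogonal_measurable:
  fixes f :: "real^'n \<Rightarrow> real^'n"
  assumes "orthogonal_transformation f" shows "f \<in> borel_measurable borel"
  using linear_continuous_on[OF linear_conv_bounded_linear[THEN iffD1, OF orthogonal_transformation_linear[OF assms]]]
  by (rule borel_measurable_continuous_onI)

lemma nn_integral_gauss_orthogonal:
  fixes f :: "real^'n \<Rightarrow> real^'n"
  assumes f: "orthogonal_transformation f" and [measurable]: "g \<in> borel_measurable borel"
  shows "(\<integral>\<^sup>+x. g (f x) \<partial>gauss) = (\<integral>\<^sup>+x. g x \<partial>gauss)"
    and "(\<integral>\<^sup>+x. g (f x) \<partial>wgauss) = (\<integral>\<^sup>+x. g x \<partial>wgauss)"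
proof -
  have [measurable]: "f \<in> borel_measurable borel" using f by (rule orthogonal_measurable)
  have *: "(\<integral>\<^sup>+x. ennreal (\<phi> (norm x)) * g (f x) \<partial>lborel) = (\<integral>\<^sup>+x. ennreal (\<phi> (norm x)) * g x \<partial>lborel)"
    if [measurable]: "\<phi> \<in> borel_measurable borel" for \<phi> :: "real \<Rightarrow> real"
  proof -
    have "(\<integral>\<^sup>+x. ennreal (\<phi> (norm x)) * g x \<partial>lborel) = (\<integral>\<^sup>+x. ennreal (\<phi> (norm x)) * g x \<partial>distr lborel borel f)"
      by (simp add: lborel_orthogonal[OF f])
    also have "\<dots> = (\<integral>\<^sup>+x. ennreal (\<phi> (norm (f x))) * g (f x) \<partial>lborel)"
      by (subst nn_integral_distr) auto
    finally show ?thesis using f by (simp add: orthogonal_transformation_norm)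
  qed
  show "(\<integral>\<^sup>+x. g (f x) \<partial>gauss) = (\<integral>\<^sup>+x. g x \<partial>gauss)"
    using *[of "\<lambda>r. exp (- r\<^sup>2)"] by (simp add: gauss_def nn_integral_density)
  show "(\<integral>\<^sup>+x. g (f x) \<partial>wgauss) = (\<integral>\<^sup>+x. g x \<partial>wgauss)"
    using *[of "\<lambda>r. r * exp (- r\<^sup>2)"] by (simp add: wgauss_def nn_integral_density)
qed

section \<open>Random great circles\<close>

definition perp_dir :: "'a::real_inner \<Rightarrow> 'a \<Rightarrow> 'a" where
  "perp_dir x y = sgn (y - (y \<bullet> sgn x) *\<^sub>R sgn x)"

text \<open>The point at angle \<open>u\<close> on the great circle through \<open>x\<close> and the part of \<open>y\<close> orthogonal to \<open>x\<close>.\<close>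
definition circle_pt :: "('a::real_inner \<times> 'a) \<times> complex \<Rightarrow> 'a" where
  "circle_pt p = Re (snd p) *\<^sub>R sgn (fst (fst p)) + Im (snd p) *\<^sub>R perp_dir (fst (fst p)) (snd (fst p))"

lemma sgn_orthogonal:
  fixes f :: "'a::real_inner \<Rightarrow> 'a"
  assumes f: "orthogonal_transformation f"
  shows "sgn (f x) = f (sgn x)"
  using f by (simp add: sgn_div_norm orthogonal_transformation_norm linear_scale[OF orthogonal_transformation_linear[OF f]])

lemma circle_pt_orthogonal:
  fixes f :: "'a::real_inner \<Rightarrow> 'a"
  assumes f: "orthogonal_transformation f"
  shows "circle_pt ((f x, f y), u) = f (circle_pt ((x, y), u))"
proof -
  have lin: "linear f" using f by (rule orthogonal_transformation_linear)
  have "f y \<bullet> sgn (f x) = y \<bullet> sgn x" unfolding sgn_orthogonal[OF f] using f by (simp only: orthogonal_transformation_def)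
  then have "f y - (f y \<bullet> sgn (f x)) *\<^sub>R sgn (f x) = f (y - (y \<bullet> sgn x) *\<^sub>R sgn x)"
    by (simp add: sgn_orthogonal[OF f] linear_diff[OF lin] linear_scale[OF lin])
  then have "perp_dir (f x) (f y) = f (perp_dir x y)" by (simp add: perp_dir_def sgn_orthogonal[OF f])
  then show ?thesis by (simp add: circle_pt_def sgn_orthogonal[OF f] linear_add[OF lin] linear_scale[OF lin])
qed

lemma perp_dir_orthonormal:
  assumes "x \<noteq> 0" "y - (y \<bullet> sgn x) *\<^sub>R sgn x \<noteq> 0"
  shows "norm (sgn x) = 1" "norm (perp_dir x y) = 1" "sgn x \<bullet> perp_dir x y = 0"
proof -
  show n: "norm (sgn x) = 1" using assms(1) by (simp add: norm_sgn)
  show "norm (perp_dir x y) = 1" using assms(2) by (simp add: perp_dir_def norm_sgn)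
  have "sgn x \<bullet> (y - (y \<bullet> sgn x) *\<^sub>R sgn x) = 0"
    using n by (simp add: inner_diff_right dot_square_norm inner_commute)
  then show "sgn x \<bullet> perp_dir x y = 0" by (simp add: perp_dir_def sgn_div_norm)
qed

lemma norm_frame:
  assumes "norm a = 1" "norm b = 1" "a \<bullet> b = 0" "norm u = 1"
  shows "norm (Re u *\<^sub>R a + Im u *\<^sub>R b) = 1"
proof -
  have ab: "a \<bullet> a = 1" "b \<bullet> b = 1" "b \<bullet> a = 0" using assms(1-3) by (auto simp: norm_eq_1 inner_commute)
  have "(Re u *\<^sub>R a + Im u *\<^sub>R b) \<bullet> (Re u *\<^sub>R a + Im u *\<^sub>R b) = (Re u)\<^sup>2 + (Im u)\<^sup>2"
    by (simp add: inner_add_left inner_add_right ab assms(3) power2_eq_square)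
  also have "\<dots> = 1" using assms(4) cmod_power2[of u] by simp
  finally show ?thesis by (simp add: norm_eq_1)
qed

text \<open>For fixed nonzero \<open>x\<close> the exceptional \<open>y\<close> lie on the line
  through \<open>x\<close>, which is a null set because the dimension is at least 2.\<close>

lemma AE_gauss_pair_nondegenerate:
  assumes n: "CARD('n) \<ge> 2"
  shows "AE p in gauss \<Otimes>\<^sub>M gauss. fst p \<noteq> 0 \<and> snd p - (snd p \<bullet> sgn (fst p)) *\<^sub>R sgn (fst p) \<noteq> (0::real^'n)"
proof -
  interpret finite_measure "gauss :: (real^'n) measure" by (rule finite_gauss)
  interpret pair_sigma_finite "gauss :: (real^'n) measure" "gauss :: (real^'n) measure" ..
  have AEg: "(AE x in (gauss :: (real^'n) measure). P x) \<longleftrightarrow> (AE x in lborel. P x)" for P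
    unfolding gauss_def by (subst AE_density) auto
  show ?thesis
  proof (rule AE_pair_measure)
    show "{p \<in> space (gauss \<Otimes>\<^sub>M gauss). fst p \<noteq> 0 \<and> snd p - (snd p \<bullet> sgn (fst p)) *\<^sub>R sgn (fst p) \<noteq> (0::real^'n)} \<in> sets (gauss \<Otimes>\<^sub>M gauss)"
      unfolding sgn_div_norm by measurable
    have "AE x in lborel. x \<noteq> (0::real^'n)" by (rule AE_lborel_singleton)
    then have "AE x in gauss. x \<noteq> (0::real^'n)" unfolding AEg .
    then show "AE x in gauss. AE y in gauss. fst (x, y) \<noteq> 0 \<and> snd (x, y) - (snd (x, y) \<bullet> sgn (fst (x, y))) *\<^sub>R sgn (fst (x, y)) \<noteq> (0::real^'n)"
    proof eventually_elim
      case (elim x)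
      have "negligible (span {x})"
      proof (rule negligible_lowdim)
        have "dim (span {x}) \<le> 1" using dim_le_card[of "span {x}" "{x}"] by simp
        then show "dim (span {x}) < DIM(real^'n)" using n by simp
      qed
      moreover have "span {x} \<in> sets borel" by (intro borel_closed closed_span)
      ultimately have "span {x} \<in> null_sets lborel"
        by (simp add: negligible_iff_null_sets null_sets_completion_iff)
      then have "AE y in lborel. y \<notin> span {x}" by (rule AE_not_in)
      then have "AE y in gauss. y \<notin> span {x}" unfolding AEg .
      then show ?case
      proof eventually_elim
        case (elim y)
        have "(y \<bullet> sgn x) *\<^sub>R sgn x \<in> span {x}"
          unfolding sgn_div_norm by (intro span_scale span_base) simp
        then show ?case using elim \<open>x \<noteq> 0\<close> by auto
      qed
    qed
  qed
qed

text \<open>The law, not normalised, of a uniform point on the great circle whose frame comes from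
  two independent Gaussian vectors by the Gram-Schmidt process. Dependent pairs, for which
  \<open>sgn\<close> yields 0, form a null set.\<close>

definition circle_law :: "(real^'n) measure" where
  "circle_law = distr ((gauss \<Otimes>\<^sub>M gauss) \<Otimes>\<^sub>M circ) borel circle_pt"

lemma circle_pt_measurable [measurable]:
  "circle_pt \<in> borel_measurable (((gauss :: (real^'n) measure) \<Otimes>\<^sub>M (gauss :: (real^'n) measure)) \<Otimes>\<^sub>M circ)"
  unfolding circle_pt_def perp_dir_def sgn_div_norm by measurable

lemma sets_circle_law [simp, measurable_cong]: "sets circle_law = sets borel" by (simp add: circle_law_def)
lemma space_circle_law [simp]: "space circle_law = UNIV" by (simp add: circle_law_def)

lemma emeasure_circle_law:
  "emeasure (circle_law :: (real^'n) measure) UNIV = ennreal (2 * pi * (pi powr (real CARD('n) / 2))\<^sup>2)"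
proof -
  interpret g: finite_measure "gauss :: (real^'n) measure" by (rule finite_gauss)
  interpret c: finite_measure circ by (rule finite_circ)
  interpret gg: pair_sigma_finite "gauss :: (real^'n) measure" "gauss :: (real^'n) measure" ..
  have "emeasure (circle_law :: (real^'n) measure) UNIV = emeasure (((gauss :: (real^'n) measure) \<Otimes>\<^sub>M (gauss :: (real^'n) measure)) \<Otimes>\<^sub>M circ) ((UNIV \<times> UNIV) \<times> UNIV)"
    unfolding circle_law_def by (subst emeasure_distr) (auto simp: space_pair_measure)
  also have "\<dots> = emeasure (gauss :: (real^'n) measure) UNIV * emeasure (gauss :: (real^'n) measure) UNIV * emeasure circ UNIV"
    by (subst c.emeasure_pair_measure_Times) (auto simp: g.emeasure_pair_measure_Times simp del: UNIV_Times_UNIV)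
  also have "\<dots> = ennreal (2 * pi * (pi powr (real CARD('n) / 2))\<^sup>2)"
    unfolding emeasure_gauss circ_total by (simp add: ennreal_mult'[symmetric] power2_eq_square mult_ac)
  finally show ?thesis .
qed

lemma finite_circle_law: "finite_measure circle_law"
  by (rule finite_measureI) (simp add: emeasure_circle_law)

lemma AE_circle_law_norm:
  assumes n: "CARD('n) \<ge> 2"
  shows "AE w in (circle_law :: (real^'n) measure). norm w = 1"
proof -
  interpret g: finite_measure "gauss :: (real^'n) measure" by (rule finite_gauss)
  interpret c: finite_measure circ by (rule finite_circ)
  interpret gg: pair_sigma_finite "gauss :: (real^'n) measure" "gauss :: (real^'n) measure" ..
  interpret ggc: pair_sigma_finite "(gauss :: (real^'n) measure) \<Otimes>\<^sub>M (gauss :: (real^'n) measure)" circ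
    by (intro pair_sigma_finite.intro sigma_finite_pair_measure c.sigma_finite_measure_axioms g.sigma_finite_measure_axioms)
  have "AE p in ((gauss :: (real^'n) measure) \<Otimes>\<^sub>M (gauss :: (real^'n) measure)) \<Otimes>\<^sub>M circ. norm (circle_pt p) = 1"
  proof (rule ggc.AE_pair_measure)
    show "{p \<in> space (((gauss :: (real^'n) measure) \<Otimes>\<^sub>M (gauss :: (real^'n) measure)) \<Otimes>\<^sub>M circ). norm (circle_pt p) = 1} \<in> sets (((gauss :: (real^'n) measure) \<Otimes>\<^sub>M (gauss :: (real^'n) measure)) \<Otimes>\<^sub>M circ)"
      by measurable
    show "AE q in (gauss :: (real^'n) measure) \<Otimes>\<^sub>M (gauss :: (real^'n) measure). AE u in circ. norm (circle_pt (q, u)) = 1"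
      using AE_gauss_pair_nondegenerate[OF n]
    proof eventually_elim
      case (elim q)
      note on = perp_dir_orthonormal[of "fst q" "snd q"]
      show ?case using AE_circ_norm
      proof eventually_elim
        case u: (elim u)
        show ?case unfolding circle_pt_def fst_conv snd_conv
          by (rule norm_frame) (use on elim u in auto)
      qed
    qed
  qed
  then show ?thesis unfolding circle_law_def by (subst AE_distr_iff) auto
qed

lemma nn_integral_circle_law:
  fixes g :: "real^'n \<Rightarrow> ennreal"
  assumes [measurable]: "g \<in> borel_measurable borel"
  shows "(\<integral>\<^sup>+w. g w \<partial>circle_law) = (\<integral>\<^sup>+x. \<integral>\<^sup>+y. \<integral>\<^sup>+u. g (circle_pt ((x, y), u)) \<partial>circ \<partial>gauss \<partial>gauss)"
proof -
  interpret g: finite_measure "gauss :: (real^'n) measure" by (rule finite_gauss)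
  interpret c: finite_measure circ by (rule finite_circ)
  have "(\<integral>\<^sup>+w. g w \<partial>circle_law) = (\<integral>\<^sup>+p. g (circle_pt p) \<partial>(gauss \<Otimes>\<^sub>M gauss) \<Otimes>\<^sub>M circ)"
    unfolding circle_law_def by (subst nn_integral_distr) auto
  also have "\<dots> = (\<integral>\<^sup>+q. \<integral>\<^sup>+u. g (circle_pt (q, u)) \<partial>circ \<partial>gauss \<Otimes>\<^sub>M gauss)"
    by (subst c.nn_integral_fst[symmetric]) auto
  also have "\<dots> = (\<integral>\<^sup>+x. \<integral>\<^sup>+y. \<integral>\<^sup>+u. g (circle_pt ((x, y), u)) \<partial>circ \<partial>gauss \<partial>gauss)"
    by (subst g.nn_integral_fst[symmetric]) auto
  finally show ?thesis .
qed

text \<open>\<open>circle_pt\<close> commutes with orthogonal maps, so \<open>f\<close> can be moved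
  to the two Gaussian vectors, whose laws it preserves.\<close>

lemma circle_law_orthogonal:
  fixes f :: "real^'n \<Rightarrow> real^'n" and g :: "real^'n \<Rightarrow> ennreal"
  assumes f: "orthogonal_transformation f" and [measurable]: "g \<in> borel_measurable borel"
  shows "(\<integral>\<^sup>+w. g (f w) \<partial>circle_law) = (\<integral>\<^sup>+w. g w \<partial>circle_law)"
proof -
  interpret g: finite_measure "gauss :: (real^'n) measure" by (rule finite_gauss)
  interpret c: finite_measure circ by (rule finite_circ)
  have [measurable]: "f \<in> borel_measurable borel" using f by (rule orthogonal_measurable)
  define h where "h x y = (\<integral>\<^sup>+u. g (circle_pt ((x, y), u)) \<partial>circ)" for x y
  have hm: "(\<lambda>p. h (fst p) (snd p)) \<in> borel_measurable (gauss \<Otimes>\<^sub>M gauss)"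
    unfolding h_def by (rule c.borel_measurable_nn_integral) (simp add: split_beta')
  have hm1: "h x \<in> borel_measurable borel" for x
    using measurable_compose[OF measurable_Pair1', OF _ hm, of x] by simp
  have hm2: "(\<lambda>x. \<integral>\<^sup>+y. h x y \<partial>gauss) \<in> borel_measurable borel"
    using g.borel_measurable_nn_integral_fst[OF hm] by simp
  have "(\<integral>\<^sup>+w. g (f w) \<partial>circle_law) = (\<integral>\<^sup>+x. \<integral>\<^sup>+y. h (f x) (f y) \<partial>gauss \<partial>gauss)"
    by (subst nn_integral_circle_law) (auto simp: h_def circle_pt_orthogonal[OF f])
  also have "\<dots> = (\<integral>\<^sup>+x. \<integral>\<^sup>+y. h (f x) y \<partial>gauss \<partial>gauss)"
    by (intro nn_integral_cong nn_integral_gauss_orthogonal(1)[OF f] hm1)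
  also have "\<dots> = (\<integral>\<^sup>+x. \<integral>\<^sup>+y. h x y \<partial>gauss \<partial>gauss)"
    by (rule nn_integral_gauss_orthogonal(1)[OF f hm2])
  also have "\<dots> = (\<integral>\<^sup>+w. g w \<partial>circle_law)"
    unfolding h_def by (rule nn_integral_circle_law[symmetric]) simp
  finally show ?thesis .
qed

text \<open>Integrating \<open>zonal \<rho> w z\<close> against the two rotation-invariant laws \<open>circle_law\<close> in \<open>w\<close> and \<open>wgauss\<close> in
  \<open>z\<close> in either order shows that, as \<open>\<rho>\<close> tends to 0, both give the same average of a continuous function
  of the direction. This avoids the uniqueness of the invariant measure on the sphere.\<close>
definition zonal :: "real \<Rightarrow> 'a::real_inner \<Rightarrow> 'a \<Rightarrow> real" where
  "zonal \<rho> w z = max 0 (sgn w \<bullet> sgn z - 1 + \<rho>)"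

lemma zonal_bounds: "\<rho> \<ge> 0 \<Longrightarrow> 0 \<le> zonal \<rho> w z" "\<rho> \<ge> 0 \<Longrightarrow> zonal \<rho> w z \<le> \<rho>"
proof -
  have "sgn w \<bullet> sgn z \<le> norm (sgn w) * norm (sgn z)" by (rule norm_cauchy_schwarz)
  also have "\<dots> \<le> 1" by (simp add: norm_sgn)
  finally show "\<rho> \<ge> 0 \<Longrightarrow> zonal \<rho> w z \<le> \<rho>" by (simp add: zonal_def)
qed (simp add: zonal_def)

lemma zonal_orthogonal:
  fixes f :: "'a::real_inner \<Rightarrow> 'a"
  assumes f: "orthogonal_transformation f"
  shows "zonal \<rho> (f w) (f z) = zonal \<rho> w z"
  unfolding zonal_def sgn_orthogonal[OF f] using f by (simp only: orthogonal_transformation_def)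

lemma zonal_measurable [measurable]:
  fixes F G :: "'b \<Rightarrow> 'a::euclidean_space"
  assumes [measurable]: "F \<in> borel_measurable N" "G \<in> borel_measurable N"
  shows "(\<lambda>p. zonal \<rho> (F p) (G p)) \<in> borel_measurable N"
  unfolding zonal_def sgn_div_norm by measurable

lemma zonal_sgn:
  fixes w z :: "'a::real_inner"
  shows "zonal \<rho> (sgn w) z = zonal \<rho> w z" "zonal \<rho> w (sgn z) = zonal \<rho> w z"
proof -
  have "sgn (sgn x) = sgn x" for x :: 'a by (cases "x = 0") (auto simp: sgn_div_norm)
  then show "zonal \<rho> (sgn w) z = zonal \<rho> w z" "zonal \<rho> w (sgn z) = zonal \<rho> w z"
    unfolding zonal_def by simp_all
qed

lemma orthogonal_between_directions:
  fixes w z :: "real^'n"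
  assumes "w \<noteq> 0" "z \<noteq> 0"
  obtains f where "orthogonal_transformation f" "f (sgn w) = sgn z"
  using orthogonal_transformation_exists[of "sgn w" "sgn z"] assms by (auto simp: norm_sgn)

text \<open>An orthogonal map between the two directions preserves both the kernel and the
  measure.\<close>

lemma zonal_integral_const:
  fixes w w' :: "real^'n"
  assumes "w \<noteq> 0" "w' \<noteq> 0" "\<rho> \<ge> 0"
  shows "(\<integral>z. zonal \<rho> w z \<partial>wgauss) = (\<integral>z. zonal \<rho> w' z \<partial>wgauss)"
    and "(\<integral>z. zonal \<rho> z w \<partial>circle_law) = (\<integral>z. zonal \<rho> z w' \<partial>circle_law)"
proof -
  obtain f where f: "orthogonal_transformation f" "f (sgn w) = sgn w'"
    using orthogonal_between_directions[OF assms(1,2)] .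
  have "(\<integral>\<^sup>+z. ennreal (zonal \<rho> w' z) \<partial>wgauss) = (\<integral>\<^sup>+z. ennreal (zonal \<rho> w' (f z)) \<partial>wgauss)"
    by (rule nn_integral_gauss_orthogonal(2)[OF f(1), symmetric]) measurable
  also have "\<dots> = (\<integral>\<^sup>+z. ennreal (zonal \<rho> w z) \<partial>wgauss)"
    using zonal_orthogonal[OF f(1), of \<rho> "sgn w"] by (simp add: f(2) zonal_sgn)
  finally show "(\<integral>z. zonal \<rho> w z \<partial>wgauss) = (\<integral>z. zonal \<rho> w' z \<partial>wgauss)"
    using zonal_bounds(1)[OF assms(3)] by (subst (1 2) integral_eq_nn_integral) auto
  have "(\<integral>\<^sup>+z. ennreal (zonal \<rho> z w') \<partial>circle_law) = (\<integral>\<^sup>+z. ennreal (zonal \<rho> (f z) w') \<partial>circle_law)"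
    by (rule circle_law_orthogonal[OF f(1), symmetric]) measurable
  also have "\<dots> = (\<integral>\<^sup>+z. ennreal (zonal \<rho> z w) \<partial>circle_law)"
    using zonal_orthogonal[OF f(1), of \<rho> _ "sgn w"] by (simp add: f(2) zonal_sgn)
  finally show "(\<integral>z. zonal \<rho> z w \<partial>circle_law) = (\<integral>z. zonal \<rho> z w' \<partial>circle_law)"
    using zonal_bounds(1)[OF assms(3)] by (subst (1 2) integral_eq_nn_integral) auto
qed

text \<open>The kernel is positive on an open cone around \<open>w\<close>, and a nonempty open set
  is not null. This allows the constant to be cancelled when the averages are compared.\<close>

lemma zonal_integral_pos:
  fixes w :: "real^'n"
  assumes w: "norm w = 1" and r: "\<rho> > 0"
  shows "0 < (\<integral>z. zonal \<rho> w z \<partial>wgauss)"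
proof -
  interpret finite_measure "wgauss :: (real^'n) measure" by (rule finite_wgauss)
  let ?f = "\<lambda>z. norm z * exp (- (norm z)\<^sup>2) * zonal \<rho> w z"
  have int: "integrable lborel ?f"
  proof (rule Bochner_Integration.integrable_bound)
    show "integrable lborel (\<lambda>z::real^'n. \<rho> * (norm z * exp (- (norm z)\<^sup>2)))"
      using integrable_norm_gauss[of "norm :: real^'n \<Rightarrow> real" 1] by simp
    show "AE z in lborel. norm (?f z) \<le> norm (\<rho> * (norm z * exp (- (norm z)\<^sup>2)))"
    proof (intro AE_I2)
      fix z :: "real^'n"
      have "zonal \<rho> w z * (norm z * exp (- (norm z)\<^sup>2)) \<le> \<rho> * (norm z * exp (- (norm z)\<^sup>2))"
        using zonal_bounds(2)[of \<rho> w z] r by (intro mult_right_mono) auto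
      then show "norm (?f z) \<le> norm (\<rho> * (norm z * exp (- (norm z)\<^sup>2)))"
        using zonal_bounds(1)[of \<rho> w z] r by (simp add: abs_mult mult.commute)
    qed
  qed measurable
  have nn: "0 \<le> ?f z" for z using zonal_bounds(1)[of \<rho> w z] r by simp
  have "(\<integral>z. ?f z \<partial>lborel) \<noteq> 0"
  proof
    assume "(\<integral>z. ?f z \<partial>lborel) = 0"
    then have ae: "AE z in lborel. ?f z = 0"
      using integral_nonneg_eq_0_iff_AE[OF int] nn by simp
    define U where "U = {z::real^'n. (1 - \<rho>) * norm z < w \<bullet> z}"
    have "open U" unfolding U_def by (intro open_Collect_less continuous_intros)
    have "w \<in> U" using w r by (simp add: U_def dot_square_norm)
    have pos: "?f z > 0" if "z \<in> U" for z
    proof -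
      have z0: "z \<noteq> 0" using that by (auto simp: U_def)
      have "sgn w = w" using w by (simp add: sgn_div_norm)
      then have "sgn w \<bullet> sgn z = (w \<bullet> z) / norm z" by (simp add: sgn_div_norm divide_inverse mult.commute)
      also have "\<dots> > 1 - \<rho>" using that z0 by (simp add: U_def less_divide_eq)
      finally have "zonal \<rho> w z > 0" by (simp add: zonal_def)
      then show ?thesis using z0 by simp
    qed
    have "AE z in lborel. z \<notin> U" using ae by eventually_elim (use pos in force)
    then have "U \<in> null_sets lborel"
      using \<open>open U\<close> by (simp add: AE_iff_null_sets)
    then have "negligible U" by (simp add: negligible_iff_null_sets null_sets_completionI)
    then show False using open_not_negligible[OF \<open>open U\<close>] \<open>w \<in> U\<close> by auto
  qed
  moreover have "0 \<le> (\<integral>z. ?f z \<partial>lborel)" using nn by (intro integral_nonneg_AE) auto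
  ultimately show ?thesis by (subst integral_wgauss) auto
qed

lemma great_circle_average:
  fixes H :: "real^'n \<Rightarrow> real"
  assumes n: "CARD('n) \<ge> 2" and cH: "continuous_on UNIV H"
    and hom: "\<And>c x. c > 0 \<Longrightarrow> H (c *\<^sub>R x) = c * H x"
    and M: "0 \<le> M" "\<And>x. \<bar>H x\<bar> \<le> M * norm x"
    and circle: "\<And>a b. norm a = 1 \<Longrightarrow> norm b = 1 \<Longrightarrow> a \<bullet> b = 0 \<Longrightarrow> (\<integral>u. H (Re u *\<^sub>R a + Im u *\<^sub>R b) \<partial>circ) \<le> d"
  shows "(\<integral>x. H x * exp (- (norm x)\<^sup>2) \<partial>lborel) \<le> d / (2 * pi) * (\<integral>x. norm (x::real^'n) * exp (- (norm x)\<^sup>2) \<partial>lborel)"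
proof -
  define A where "A = (\<integral>x. norm (x::real^'n) * exp (- (norm x)\<^sup>2) \<partial>lborel)"
  define I where "I = (\<integral>x. H x * exp (- (norm x)\<^sup>2) \<partial>lborel)"
  define G where "G = pi powr (real CARD('n) / 2)"
  have G0: "G > 0" by (simp add: G_def)
  have [measurable]: "H \<in> borel_measurable borel" using cH by (rule borel_measurable_continuous_onI)
  interpret mu: finite_measure "wgauss :: (real^'n) measure" by (rule finite_wgauss)
  interpret nu: finite_measure "circle_law :: (real^'n) measure" by (rule finite_circle_law)
  interpret P: pair_sigma_finite "circle_law :: (real^'n) measure" "wgauss :: (real^'n) measure" ..
  interpret PF: finite_measure "(circle_law :: (real^'n) measure) \<Otimes>\<^sub>M (wgauss :: (real^'n) measure)"
    by (intro finite_measure_pair_measure finite_circle_law finite_wgauss)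
  have A0: "0 \<le> A" unfolding A_def by (intro integral_nonneg_AE) auto
  have Amu: "(\<integral>z. 1 \<partial>(wgauss :: (real^'n) measure)) = A" unfolding A_def by (subst integral_wgauss) auto
  have Vnu: "measure (circle_law :: (real^'n) measure) UNIV = 2 * pi * G\<^sup>2"
    unfolding measure_def emeasure_circle_law G_def by (subst enn2real_ennreal) auto
  have Hs: "\<bar>H (sgn z)\<bar> \<le> M" for z
    using M(2)[of "sgn z"] M(1) by (cases "z = 0") (auto simp: norm_sgn)
  have Imu: "(\<integral>z. H (sgn z) \<partial>wgauss) = I"
  proof -
    have "(\<integral>z. H (sgn z) \<partial>wgauss) = (\<integral>z. norm z * exp (- (norm z)\<^sup>2) * H (sgn z) \<partial>lborel)"
      by (rule integral_wgauss) (unfold sgn_div_norm, measurable)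
    also have "\<dots> = I" unfolding I_def
    proof (rule Bochner_Integration.integral_cong)
      fix z :: "real^'n"
      show "norm z * exp (- (norm z)\<^sup>2) * H (sgn z) = H z * exp (- (norm z)\<^sup>2)"
      proof (cases "z = 0")
        case True
        then show ?thesis using M(2)[of 0] by simp
      next
        case False
        then have "norm z *\<^sub>R sgn z = z" by (simp add: sgn_div_norm)
        then have "H z = norm z * H (sgn z)" using hom[of "norm z" "sgn z"] False by simp
        then show ?thesis by simp
      qed
    qed simp
    finally show ?thesis .
  qed
  have AEw: "AE w in (circle_law :: (real^'n) measure). norm w = 1" by (rule AE_circle_law_norm[OF n])
  have AEz: "AE z in (wgauss :: (real^'n) measure). z \<noteq> 0"
    unfolding wgauss_def using AE_lborel_singleton[of "0::real^'n"] by (subst AE_density) auto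
  have intH: "integrable circle_law H"
  proof (rule nu.integrable_const_bound[where B = M])
    show "AE w in circle_law. norm (H w) \<le> M" using AEw
    proof eventually_elim
      case (elim w) then show ?case using M(2)[of w] by simp
    qed
  qed simp
  \<comment> \<open>The bound for single great circles, integrated over the pairs of Gaussian
    vectors, whose total mass is \<open>G\<^sup>2\<close>.\<close>
  have Hnu: "(\<integral>w. H w \<partial>circle_law) \<le> d * G\<^sup>2"
  proof -
    interpret g: finite_measure "gauss :: (real^'n) measure" by (rule finite_gauss)
    interpret c: finite_measure circ by (rule finite_circ)
    interpret gg: finite_measure "(gauss :: (real^'n) measure) \<Otimes>\<^sub>M (gauss :: (real^'n) measure)"
      by (intro finite_measure_pair_measure finite_gauss)
    interpret ggc: pair_sigma_finite "(gauss :: (real^'n) measure) \<Otimes>\<^sub>M (gauss :: (real^'n) measure)" circ ..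
    have i: "integrable (((gauss :: (real^'n) measure) \<Otimes>\<^sub>M (gauss :: (real^'n) measure)) \<Otimes>\<^sub>M circ) (\<lambda>p. H (circle_pt p))"
      using intH unfolding circle_law_def by (subst (asm) integrable_distr_eq) auto
    have "(\<integral>w. H w \<partial>circle_law) = (\<integral>p. H (circle_pt p) \<partial>((gauss \<Otimes>\<^sub>M gauss) \<Otimes>\<^sub>M circ))"
      unfolding circle_law_def by (rule integral_distr) auto
    also have "\<dots> = (\<integral>q. (\<integral>u. H (circle_pt (q, u)) \<partial>circ) \<partial>(gauss \<Otimes>\<^sub>M gauss))"
      using ggc.integral_fst'[OF i] by simp
    also have "\<dots> \<le> (\<integral>q. d \<partial>((gauss :: (real^'n) measure) \<Otimes>\<^sub>M (gauss :: (real^'n) measure)))"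
    proof (rule integral_mono_AE)
      show "integrable (gauss \<Otimes>\<^sub>M gauss) (\<lambda>q. \<integral>u. H (circle_pt (q, u)) \<partial>circ)"
        using ggc.integrable_fst'[OF i] by simp
      show "AE q in gauss \<Otimes>\<^sub>M gauss. (\<integral>u. H (circle_pt (q, u)) \<partial>circ) \<le> d"
        using AE_gauss_pair_nondegenerate[OF n]
      proof eventually_elim
        case (elim q)
        show ?case unfolding circle_pt_def fst_conv snd_conv
          by (rule circle) (use perp_dir_orthonormal[of "fst q" "snd q"] elim in auto)
      qed
    qed simp
    also have "\<dots> = d * G\<^sup>2"
    proof -
      have "emeasure ((gauss :: (real^'n) measure) \<Otimes>\<^sub>M (gauss :: (real^'n) measure)) (UNIV \<times> UNIV) = ennreal (G\<^sup>2)"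
        by (subst g.emeasure_pair_measure_Times) (auto simp: emeasure_gauss G_def ennreal_mult'[symmetric] power2_eq_square)
      then have "measure ((gauss :: (real^'n) measure) \<Otimes>\<^sub>M (gauss :: (real^'n) measure)) UNIV = G\<^sup>2"
        by (simp add: measure_def)
      then show ?thesis by (simp add: space_pair_measure)
    qed
    finally show ?thesis .
  qed
  have main: "I \<le> A * (d / (2 * pi) + \<omega>)" if om: "\<omega> > 0" for \<omega>
  proof -
    have "uniformly_continuous_on (sphere 0 1) H"
      using cH by (intro compact_uniformly_continuous) (auto intro: continuous_on_subset)
    then obtain \<delta> where \<delta>: "\<delta> > 0" "\<And>x y. norm x = 1 \<Longrightarrow> norm y = 1 \<Longrightarrow> dist x y < \<delta> \<Longrightarrow> \<bar>H x - H y\<bar> < \<omega>"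
      using om unfolding uniformly_continuous_on_def by (metis dist_real_def mem_sphere_0 dist_commute)
    \<comment> \<open>For unit vectors the squared distance is 2 minus twice the inner product, so
      with this \<rho> the kernel vanishes unless the directions are closer than \<delta>.\<close>
    define \<rho> where "\<rho> = \<delta>\<^sup>2 / 2"
    have r: "\<rho> > 0" using \<delta>(1) by (simp add: \<rho>_def)
    obtain i :: 'n where True by auto
    let ?e = "axis i 1 :: real^'n"
    define c where "c = (\<integral>z. zonal \<rho> ?e z \<partial>wgauss)"
    define c2 where "c2 = (\<integral>w. zonal \<rho> w ?e \<partial>circle_law)"
    have c0: "c > 0" unfolding c_def by (rule zonal_integral_pos[OF _ r]) simp
    have cw: "(\<integral>z. zonal \<rho> w z \<partial>wgauss) = c" if "w \<noteq> 0" for w :: "real^'n"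
      unfolding c_def using r that by (intro zonal_integral_const(1)) (auto simp: axis_eq_0_iff)
    have cz: "(\<integral>w. zonal \<rho> w z \<partial>circle_law) = c2" if "z \<noteq> 0" for z :: "real^'n"
      unfolding c2_def using r that by (intro zonal_integral_const(2)) (auto simp: axis_eq_0_iff)
    have zb: "0 \<le> zonal \<rho> w z" "zonal \<rho> w z \<le> \<rho>" for w z :: "real^'n" using zonal_bounds[of \<rho>] r by auto
    have Fub: "(\<integral>w. (\<integral>z. zonal \<rho> w z * h z \<partial>wgauss) \<partial>circle_law) = c2 * (\<integral>z. h z \<partial>wgauss)"
      and intFub: "integrable circle_law (\<lambda>w. \<integral>z. zonal \<rho> w z * h z \<partial>wgauss)"
      if [measurable]: "h \<in> borel_measurable borel" and hb: "\<And>z. \<bar>h z\<bar> \<le> B" for h :: "real^'n \<Rightarrow> real" and B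
    proof -
      have i: "integrable (circle_law \<Otimes>\<^sub>M wgauss) (\<lambda>(w, z). zonal \<rho> w z * h z)"
      proof (rule PF.integrable_const_bound[where B = "\<rho> * B"])
        show "AE p in circle_law \<Otimes>\<^sub>M wgauss. norm (case p of (w, z) \<Rightarrow> zonal \<rho> w z * h z) \<le> \<rho> * B"
          using zb hb r by (intro AE_I2) (auto simp: abs_mult intro!: mult_mono)
      qed measurable
      have "(\<integral>w. (\<integral>z. zonal \<rho> w z * h z \<partial>wgauss) \<partial>circle_law) = (\<integral>z. (\<integral>w. zonal \<rho> w z * h z \<partial>circle_law) \<partial>wgauss)"
        using P.Fubini_integral[OF i] by simp
      also have "\<dots> = (\<integral>z. c2 * h z \<partial>wgauss)"
      proof (rule integral_cong_AE)
        show "AE z in wgauss. (\<integral>w. zonal \<rho> w z * h z \<partial>circle_law) = c2 * h z"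
          using AEz by eventually_elim (simp add: cz)
      qed measurable
      finally show "(\<integral>w. (\<integral>z. zonal \<rho> w z * h z \<partial>wgauss) \<partial>circle_law) = c2 * (\<integral>z. h z \<partial>wgauss)" by simp
      show "integrable circle_law (\<lambda>w. \<integral>z. zonal \<rho> w z * h z \<partial>wgauss)"
        using P.integrable_fst'[OF i] by simp
    qed
    \<comment> \<open>Fubini for the kernel alone: the total masses
      \<open>2 * pi * G\<^sup>2\<close> and \<open>A\<close> of the two laws determine the ratio of
      \<open>c\<close> and \<open>c2\<close>, which removes both from the final estimate.\<close>
    have bal: "c * (2 * pi * G\<^sup>2) = c2 * A"
    proof -
      have "(\<integral>w. (\<integral>z. zonal \<rho> w z * 1 \<partial>wgauss) \<partial>(circle_law :: (real^'n) measure)) = (\<integral>w. c \<partial>(circle_law :: (real^'n) measure))"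
      proof (rule integral_cong_AE)
        show "AE w in (circle_law :: (real^'n) measure). (\<integral>z. zonal \<rho> w z * 1 \<partial>wgauss) = c"
          using AEw
        proof eventually_elim
          case (elim w)
          then have "w \<noteq> 0" by auto
          then show ?case by (simp add: cw)
        qed
      qed measurable
      also have "\<dots> = c * (2 * pi * G\<^sup>2)" by (simp add: Vnu)
      finally show ?thesis using Fub[of "\<lambda>_. 1" 1] Amu by simp
    qed
    \<comment> \<open>Where the kernel is nonzero, \<open>H\<close> at the direction of
      \<open>z\<close> exceeds \<open>H w\<close> by less than \<open>\<omega>\<close>.\<close>
    have low: "(\<integral>z. zonal \<rho> w z * H (sgn z) \<partial>wgauss) \<le> c * H w + \<omega> * c" if w: "norm w = 1" for w
    proof -
      have w0: "w \<noteq> 0" using w by auto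
      have sw: "sgn w = w" using w by (simp add: sgn_div_norm)
      have im: "integrable wgauss (\<lambda>z. zonal \<rho> w z)"
        by (rule mu.integrable_const_bound[where B = \<rho>]) (use zb in auto)
      have "(\<integral>z. zonal \<rho> w z * H (sgn z) \<partial>wgauss) \<le> (\<integral>z. zonal \<rho> w z * (H w + \<omega>) \<partial>wgauss)"
      proof (rule integral_mono_AE)
        show "integrable wgauss (\<lambda>z. zonal \<rho> w z * H (sgn z))"
        proof (rule mu.integrable_const_bound[where B = "\<rho> * M"])
          show "AE z in wgauss. norm (zonal \<rho> w z * H (sgn z)) \<le> \<rho> * M"
            using zb Hs r by (intro AE_I2) (auto simp: abs_mult intro!: mult_mono)
        qed (unfold sgn_div_norm, measurable)
        show "integrable wgauss (\<lambda>z. zonal \<rho> w z * (H w + \<omega>))" using im by simp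
        show "AE z in wgauss. zonal \<rho> w z * H (sgn z) \<le> zonal \<rho> w z * (H w + \<omega>)"
          using AEz
        proof eventually_elim
          case (elim z)
          show ?case
          proof (cases "zonal \<rho> w z = 0")
            case False
            then have "sgn w \<bullet> sgn z > 1 - \<rho>" by (auto simp: zonal_def max_def split: if_splits)
            then have wz: "w \<bullet> sgn z > 1 - \<rho>" by (simp add: sw)
            have nz: "norm (sgn z) = 1" using elim by (simp add: norm_sgn)
            have "(dist (sgn z) w)\<^sup>2 = 2 - 2 * (w \<bullet> sgn z)"
              using w nz by (simp add: dist_norm power2_norm_eq_inner inner_diff_left inner_diff_right norm_eq_1 inner_commute)
            also have "\<dots> < \<delta>\<^sup>2" using wz by (simp add: \<rho>_def)
            finally have "dist (sgn z) w < \<delta>" using \<delta>(1) by (simp add: power_less_imp_less_base)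
            then have "\<bar>H (sgn z) - H w\<bar> < \<omega>" using \<delta>(2)[OF nz w] by simp
            then show ?thesis using zb(1) by (intro mult_left_mono) auto
          qed simp
        qed
      qed
      also have "\<dots> = c * (H w + \<omega>)" using cw[OF w0] by simp
      finally show ?thesis by (simp add: algebra_simps)
    qed
    \<comment> \<open>Fubini for the kernel times \<open>H\<close>: integrating over
      \<open>w\<close> inside reproduces \<open>c2 * I\<close>, whereas integrating over
      \<open>z\<close> inside smooths \<open>H\<close> around a point of a great circle.\<close>
    have "c2 * I = (\<integral>w. (\<integral>z. zonal \<rho> w z * H (sgn z) \<partial>wgauss) \<partial>circle_law)"
      using Fub[of "\<lambda>z. H (sgn z)" M] Hs Imu by (simp add: sgn_div_norm)
    also have "\<dots> \<le> (\<integral>w. c * H w + \<omega> * c \<partial>circle_law)"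
    proof (rule integral_mono_AE)
      show "integrable circle_law (\<lambda>w. \<integral>z. zonal \<rho> w z * H (sgn z) \<partial>wgauss)"
        by (rule intFub[where B = M]) (use Hs in \<open>auto simp: sgn_div_norm\<close>)
      show "integrable circle_law (\<lambda>w. c * H w + \<omega> * c)" using intH by simp
      show "AE w in circle_law. (\<integral>z. zonal \<rho> w z * H (sgn z) \<partial>wgauss) \<le> c * H w + \<omega> * c"
        using AEw by eventually_elim (rule low)
    qed
    also have "\<dots> = c * (\<integral>w. H w \<partial>circle_law) + \<omega> * c * (2 * pi * G\<^sup>2)"
      using intH by (simp add: Vnu)
    also have "\<dots> \<le> c * (d * G\<^sup>2) + \<omega> * c * (2 * pi * G\<^sup>2)"
      using Hnu c0 by simp
    finally have "A * (c2 * I) \<le> A * (c * (d * G\<^sup>2) + \<omega> * c * (2 * pi * G\<^sup>2))"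
      using A0 by (rule mult_left_mono)
    moreover have "A * (c2 * I) = (c * G\<^sup>2 * (2 * pi)) * I" using bal by (simp add: algebra_simps)
    moreover have "A * (c * (d * G\<^sup>2) + \<omega> * c * (2 * pi * G\<^sup>2)) = (c * G\<^sup>2 * (2 * pi)) * (A * (d / (2 * pi) + \<omega>))"
      by (simp add: field_simps)
    ultimately have "(c * G\<^sup>2 * (2 * pi)) * I \<le> (c * G\<^sup>2 * (2 * pi)) * (A * (d / (2 * pi) + \<omega>))" by simp
    moreover have "c * G\<^sup>2 * (2 * pi) > 0" using c0 G0 by simp
    ultimately show ?thesis by (simp only: mult_le_cancel_left_pos)
  qed
  have "(\<lambda>j. A * (d / (2 * pi) + 1 / real (Suc j))) \<longlonglongrightarrow> A * (d / (2 * pi) + 0)"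
    by (intro tendsto_intros LIMSEQ_Suc[OF lim_1_over_n])
  then have "I \<le> A * (d / (2 * pi) + 0)"
    by (rule LIMSEQ_le_const) (intro exI allI impI main, simp)
  then show ?thesis by (simp add: A_def I_def mult.commute)
qed

subsection \<open>Projection to planes and passage to the limit\<close>

text \<open>The first three parts are the conditions that \<open>great_circle_average\<close> puts
  on its integrand; the last is Crofton's formula for polygons with Gaussian weight. All reduce to
  single edges.\<close>

lemma plen_inner_properties:
  fixes xs :: "(real^'n) list"
  shows "continuous_on UNIV (\<lambda>x. plen (map (\<lambda>v. v \<bullet> x) xs))"
    and "c > 0 \<Longrightarrow> plen (map (\<lambda>v. v \<bullet> (c *\<^sub>R x)) xs) = c * plen (map (\<lambda>v. v \<bullet> x) xs)"
    and "plen (map (\<lambda>v. v \<bullet> x) xs) \<le> plen xs * norm x"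
    and "integrable lborel (\<lambda>x. plen (map (\<lambda>v. v \<bullet> x) xs) * exp (- (norm x)\<^sup>2))
      \<and> (\<integral>x. plen (map (\<lambda>v. v \<bullet> x) xs) * exp (- (norm x)\<^sup>2) \<partial>lborel) = plen xs * pi powr ((real CARD('n) - 1) / 2)"
proof (induction xs rule: plen.induct)
  case (3 v w zs)
  have eq: "plen (map (\<lambda>v. v \<bullet> x) (v # w # zs)) = \<bar>(v - w) \<bullet> x\<bar> + plen (map (\<lambda>v. v \<bullet> x) (w # zs))" for x
    by (simp add: dist_real_def inner_diff_left)
  {
    case 1
    show ?case unfolding eq by (intro continuous_intros 3)
  next
    case 2
    have "\<bar>(v - w) \<bullet> (c *\<^sub>R x)\<bar> = c * \<bar>(v - w) \<bullet> x\<bar>" using 2 by (simp add: abs_mult)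
    then show ?case unfolding eq 3(2)[OF 2] by (simp only: distrib_left)
  next
    case 3
    have "\<bar>(v - w) \<bullet> x\<bar> \<le> dist v w * norm x" using Cauchy_Schwarz_ineq2[of "v - w" x] by (simp add: dist_norm)
    then show ?case unfolding eq using "3.IH"(3) by (simp add: distrib_right)
  next
    case 4
    have i: "integrable lborel (\<lambda>x. \<bar>(v - w) \<bullet> x\<bar> * exp (- (norm x)\<^sup>2))"
      by (rule integrable_norm_gauss[where M = "norm (v - w)"]) (auto simp: Cauchy_Schwarz_ineq2)
    show ?case unfolding eq distrib_right
      using i "3.IH"(4) integral_abs_inner_gauss[of "v - w"] by (simp add: dist_norm distrib_right)
  }
qed simp_all

lemma Max_norm_nonneg:
  assumes "finite F" "F \<noteq> {}"
  shows "0 \<le> Max (norm ` F)"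
proof -
  obtain y where "y \<in> F" using assms by blast
  then have "norm y \<le> Max (norm ` F)" using assms by (intro Max_ge) auto
  then show ?thesis using norm_ge_zero[of y] by linarith
qed

lemma hmax_properties:
  fixes F :: "'a::euclidean_space set"
  assumes F: "finite F" "F \<noteq> {}"
  shows "c > 0 \<Longrightarrow> hmax F (c *\<^sub>R x) = c * hmax F x"
    and "\<bar>hmax F x\<bar> \<le> Max (norm ` F) * norm x"
proof -
  assume c: "c > 0"
  show "hmax F (c *\<^sub>R x) = c * hmax F x"
  proof (rule antisym)
    show "hmax F (c *\<^sub>R x) \<le> c * hmax F x"
      unfolding hmax_le_iff[OF F] using hmax_ge[OF F(1)] c by (auto intro!: mult_left_mono)
    obtain y where "y \<in> F" "hmax F x = y \<bullet> x" using hmax_attained[OF F] by blast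
    then show "c * hmax F x \<le> hmax F (c *\<^sub>R x)" using hmax_ge[OF F(1), of y "c *\<^sub>R x"] by simp
  qed
next
  obtain y where y: "y \<in> F" "hmax F x = y \<bullet> x" using hmax_attained[OF F] by blast
  have "\<bar>y \<bullet> x\<bar> \<le> norm y * norm x" by (rule Cauchy_Schwarz_ineq2)
  also have "\<dots> \<le> Max (norm ` F) * norm x" using y F by (intro mult_right_mono Max_ge) auto
  finally show "\<bar>hmax F x\<bar> \<le> Max (norm ` F) * norm x" using y by simp
qed

text \<open>The coordinates with respect to \<open>a\<close> and \<open>b\<close> define a
  contraction \<open>L\<close> to the plane that is adjoint to the parametrisation of the great
  circle. The planar inequality holds for the images under \<open>L\<close>, and contraction does
  not enlarge the diameter.\<close>

lemma planar_projection_bound: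
  fixes a b :: "real^'n"
  assumes ab: "norm a = 1" "norm b = 1" "a \<bullet> b = 0"
    and F: "finite F" "F \<noteq> {}" and cov: "F \<subseteq> convex hull (set xs)"
  shows "(\<integral>u. hmax F (Re u *\<^sub>R a + Im u *\<^sub>R b) - plen (map (\<lambda>v. v \<bullet> (Re u *\<^sub>R a + Im u *\<^sub>R b)) xs) / 4 \<partial>circ) \<le> diameter F"
proof -
  define L where "L z = Complex (z \<bullet> a) (z \<bullet> b)" for z
  have lin: "linear L" by (rule linearI) (auto simp: L_def complex_eq_iff inner_add_left)
  have Lu: "L z \<bullet> u = z \<bullet> (Re u *\<^sub>R a + Im u *\<^sub>R b)" for z u
    by (simp add: L_def inner_complex_def inner_add_right)
  have Ldist: "dist (L x) (L y) \<le> dist x y" for x y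
  proof -
    define z where "z = x - y"
    define p where "p = (z \<bullet> a) *\<^sub>R a + (z \<bullet> b) *\<^sub>R b"
    have aa: "a \<bullet> a = 1" "b \<bullet> b = 1" "b \<bullet> a = 0" using ab by (auto simp: norm_eq_1 inner_commute)
    have zp: "z \<bullet> p = (z \<bullet> a)\<^sup>2 + (z \<bullet> b)\<^sup>2" by (simp add: p_def inner_add_right power2_eq_square)
    have pp: "p \<bullet> p = (z \<bullet> a)\<^sup>2 + (z \<bullet> b)\<^sup>2"
      by (simp add: p_def inner_add_right inner_add_left aa ab(3) power2_eq_square)
    have "0 \<le> (z - p) \<bullet> (z - p)" by simp
    also have "\<dots> = z \<bullet> z - 2 * (z \<bullet> p) + p \<bullet> p"
      by (simp add: inner_diff_left inner_diff_right inner_commute)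
    finally have "(z \<bullet> a)\<^sup>2 + (z \<bullet> b)\<^sup>2 \<le> (norm z)\<^sup>2" using zp pp by (simp add: power2_norm_eq_inner)
    then have "(cmod (L z))\<^sup>2 \<le> (norm z)\<^sup>2" by (simp add: L_def cmod_power2)
    then have "cmod (L z) \<le> norm z" by (rule power2_le_imp_le) simp
    then show ?thesis by (simp add: dist_norm z_def linear_diff[OF lin])
  qed
  have LF: "finite (L ` F)" "L ` F \<noteq> {}" using F by auto
  have Lcov: "L ` F \<subseteq> convex hull (set (map L xs))"
    using image_mono[OF cov, of L] convex_hull_linear_image[OF lin, of "set xs"] by simp
  have hm: "hmax (L ` F) u = hmax F (Re u *\<^sub>R a + Im u *\<^sub>R b)" for u
    by (simp add: hmax_def image_image Lu)
  have pm: "plen (map (\<lambda>v. v \<bullet> u) (map L xs)) = plen (map (\<lambda>v. v \<bullet> (Re u *\<^sub>R a + Im u *\<^sub>R b)) xs)" for u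
    by (simp add: o_def Lu)
  have "(\<integral>u. hmax (L ` F) u - plen (map (\<lambda>v. v \<bullet> u) (map L xs)) / 4 \<partial>circ)
      = (\<integral>u. hmax (L ` F) u \<partial>circ) - plen (map L xs)"
    using integrable_hmax_circ[OF LF] integral_circ_plen[of "map L xs"] by simp
  also have "\<dots> \<le> diameter (L ` F)"
    using perimeter_le_plen_plus_diameter[OF LF Lcov] by simp
  also have "\<dots> \<le> diameter F"
  proof (rule diameter_le)
    fix x y assume "x \<in> L ` F" "y \<in> L ` F"
    then obtain x' y' where "x' \<in> F" "y' \<in> F" "x = L x'" "y = L y'" by auto
    then show "norm (x - y) \<le> diameter F"
      using Ldist[of x' y'] diameter_bounded_bound[OF finite_imp_bounded[OF F(1)], of x' y'] by (simp add: dist_norm)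
  qed (use LF in simp)
  finally show ?thesis unfolding hm pm .
qed

text \<open>The projected path has a different length in each plane. Its length is therefore kept
  inside the integrand and evaluated only after averaging, since bounding it in each plane by
  \<open>plen xs\<close> would lose the constant.\<close>

lemma hmax_gauss_integral_le:
  fixes F :: "(real^'n) set"
  assumes n: "CARD('n) \<ge> 2" and F: "finite F" "F \<noteq> {}" and cov: "F \<subseteq> convex hull (set xs)"
  shows "(\<integral>x. hmax F x * exp (- (norm x)\<^sup>2) \<partial>lborel) \<le>
    plen xs * pi powr ((real CARD('n) - 1) / 2) / 4
    + diameter F / (2 * pi) * (\<integral>x. norm (x::real^'n) * exp (- (norm x)\<^sup>2) \<partial>lborel)"
proof -
  let ?p = "\<lambda>x. plen (map (\<lambda>v. v \<bullet> x) xs)"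
  let ?H = "\<lambda>x. hmax F x - ?p x / 4"
  define M where "M = Max (norm ` F) + plen xs"
  have MF: "0 \<le> Max (norm ` F)" using F by (rule Max_norm_nonneg)
  have "(\<integral>x. ?H x * exp (- (norm x)\<^sup>2) \<partial>lborel) \<le> diameter F / (2 * pi) * (\<integral>x. norm (x::real^'n) * exp (- (norm x)\<^sup>2) \<partial>lborel)"
  proof (rule great_circle_average[OF n, where M = M])
    show "continuous_on UNIV ?H" by (intro continuous_intros hmax_continuous F plen_inner_properties(1)) simp
    show "0 \<le> M" using MF plen_nonneg[of xs] by (simp add: M_def)
    show "?H (c *\<^sub>R x) = c * ?H x" if "c > 0" for c x
      using hmax_properties(1)[OF F that] plen_inner_properties(2)[OF that] by (simp add: right_diff_distrib)
    show "\<bar>?H x\<bar> \<le> M * norm x" for x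
    proof -
      have "\<bar>?H x\<bar> \<le> \<bar>hmax F x\<bar> + ?p x" using plen_nonneg[of "map (\<lambda>v. v \<bullet> x) xs"] by linarith
      also have "\<dots> \<le> M * norm x"
        using hmax_properties(2)[OF F, of x] plen_inner_properties(3)[of x xs] by (simp add: M_def distrib_right)
      finally show ?thesis .
    qed
  qed (rule planar_projection_bound[OF _ _ _ F cov])
  moreover have "integrable lborel (\<lambda>x. hmax F x * exp (- (norm x)\<^sup>2))"
    by (rule integrable_norm_gauss[OF _ MF]) (use F hmax_properties(2)[OF F] in auto)
  ultimately show ?thesis
    using plen_inner_properties(4)[of xs] by (simp add: left_diff_distrib)
qed

text \<open>By Caratheodory's theorem each point of \<open>F\<close> needs only finitely many points
  of the curve. Sorting all their parameters gives an inscribed polygon.\<close>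

lemma finite_cover_of_curve:
  fixes \<phi> :: "real \<Rightarrow> 'a::euclidean_space"
  assumes F: "finite F" "F \<subseteq> convex hull (\<phi> ` {a..b})" and ab: "a \<le> b"
  shows "\<exists>xs. F \<subseteq> convex hull (set xs) \<and> ereal (plen xs) \<le> curve_length \<phi> a b"
proof -
  have "\<forall>x\<in>F. \<exists>T. finite T \<and> T \<subseteq> {a..b} \<and> x \<in> convex hull (\<phi> ` T)"
  proof
    fix x assume "x \<in> F"
    then have "x \<in> {x. \<exists>S. finite S \<and> S \<subseteq> \<phi> ` {a..b} \<and> card S \<le> DIM('a) + 1 \<and> x \<in> convex hull S}"
      using F(2) caratheodory[of "\<phi> ` {a..b}"] by blast
    then obtain S where S: "finite S" "S \<subseteq> \<phi> ` {a..b}" "x \<in> convex hull S" by blast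
    then obtain T where "T \<subseteq> {a..b}" "finite T" "S = \<phi> ` T" using finite_subset_image by metis
    then show "\<exists>T. finite T \<and> T \<subseteq> {a..b} \<and> x \<in> convex hull (\<phi> ` T)" using S(3) by blast
  qed
  from bchoice[OF this] obtain T where T: "\<And>x. x \<in> F \<Longrightarrow> finite (T x) \<and> T x \<subseteq> {a..b} \<and> x \<in> convex hull (\<phi> ` T x)" by blast
  \<comment> \<open>Partitions in \<open>curve_length\<close> run from \<open>a\<close> to
    \<open>b\<close>, hence both are added. If \<open>a = b\<close>, the sorted list has one entry
    and \<open>m = 0\<close>.\<close>
  define S where "S = {a, b} \<union> (\<Union>x\<in>F. T x)"
  have S: "finite S" "S \<subseteq> {a..b}" "a \<in> S" "b \<in> S" using F(1) T ab by (auto simp: S_def)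
  define ts where "ts = sorted_list_of_set S"
  have ts: "set ts = S" "sorted ts" "distinct ts" "sorted_wrt (<) ts" using S(1) by (auto simp: ts_def)
  have ne: "ts \<noteq> []" using ts(1) S(3) by auto
  define xs where "xs = map \<phi> ts"
  have "F \<subseteq> convex hull (set xs)"
  proof
    fix x assume x: "x \<in> F"
    have "\<phi> ` T x \<subseteq> set xs" using x by (auto simp: xs_def ts(1) S_def)
    then show "x \<in> convex hull (set xs)" using T[OF x] hull_mono by blast
  qed
  moreover have "ereal (plen xs) \<le> curve_length \<phi> a b"
  proof -
    define m where "m = length ts - 1"
    have len: "length ts = Suc m" using ne by (cases ts) (auto simp: m_def)
    have t0: "ts ! 0 = a"
    proof -
      obtain i where i: "i < length ts" "ts ! i = a" using S(3) ts(1) by (metis in_set_conv_nth)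
      have "ts ! 0 \<le> ts ! i" using i by (intro sorted_nth_mono[OF ts(2)]) auto
      moreover have "ts ! 0 \<in> S" using ts(1) ne by (metis length_greater_0_conv nth_mem)
      ultimately show ?thesis using i S(2) by auto
    qed
    have tm: "ts ! m = b"
    proof -
      obtain i where i: "i < length ts" "ts ! i = b" using S(4) ts(1) by (metis in_set_conv_nth)
      have "ts ! i \<le> ts ! m" using i len by (intro sorted_nth_mono[OF ts(2)]) auto
      moreover have "ts ! m \<in> S" using ts(1) len by (metis lessI nth_mem)
      ultimately show ?thesis using i S(2) by auto
    qed
    have inc: "\<forall>i<m. ts ! i < ts ! Suc i"
      using ts(4) len by (auto simp: sorted_wrt_iff_nth_less)
    have "plen xs = (\<Sum>i<m. dist (\<phi> (ts ! i)) (\<phi> (ts ! Suc i)))"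
      unfolding plen_sum xs_def using len by (intro sum.cong) auto
    also have "\<dots> = (\<Sum>i=1..m. dist (\<phi> (ts ! (i - 1))) (\<phi> (ts ! i)))"
      by (rule sum.reindex_bij_witness[of _ "\<lambda>i. i - 1" Suc]) auto
    finally have "ereal (plen xs) = (case ((!) ts, m) of (t, m) \<Rightarrow> ereal (\<Sum>i=1..m. dist (\<phi> (t (i - 1))) (\<phi> (t i))))" by simp
    also have "\<dots> \<le> curve_length \<phi> a b"
      unfolding curve_length_def by (rule SUP_upper) (use t0 tm inc in auto)
    finally show ?thesis .
  qed
  ultimately show ?thesis by blast
qed

theorem theorem2:
  fixes K :: "(real ^ 'n) set" and \<phi> :: "real \<Rightarrow> real ^ 'n" and a b :: real
  assumes "CARD('n) \<ge> 2"
    and "convex_body K"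
    and "a \<le> b" and "continuous_on {a..b} \<phi>"
    and "K \<subseteq> convex hull (\<phi> ` {a..b})"
  shows "ereal (norm_body K) \<le>
     ereal (pi powr ((real CARD('n) - 1) / 2) / (2 * Gamma ((real CARD('n) + 1) / 2)))
       * curve_length \<phi> a b
     + ereal (pi powr (real CARD('n) / 2 - 1) / Gamma (real CARD('n) / 2) * diameter K)"
proof -
  let ?n = "real CARD('n)"
  let ?g = "Gamma ((?n + 1) / 2)"
  define A where "A = (\<integral>x. norm (x::real^'n) * exp (- (norm x)\<^sup>2) \<partial>lborel)"
  define c1 where "c1 = pi powr ((?n - 1) / 2) / (2 * ?g)"
  define c2 where "c2 = pi powr (?n / 2 - 1) / Gamma (?n / 2)"
  define d where "d = diameter K"
  have n0: "?n > 0" by simp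
  have g0: "?g > 0" by (rule Gamma_real_pos) simp
  have g1: "Gamma (?n / 2) > 0" by (rule Gamma_real_pos) simp
  have c10: "c1 > 0" using g0 by (simp add: c1_def)
  have cK: "compact K" "K \<noteq> {}" using assms(2) by (auto simp: convex_body_def)
  have d0: "0 \<le> d" unfolding d_def using cK by (intro diameter_ge_0 compact_imp_bounded)
  have A0: "0 \<le> A" unfolding A_def by (intro integral_nonneg_AE) auto
  have Aub: "2 * A / ?g \<le> 2 * pi * c2"
  proof -
    have "2 * A \<le> ?n * unit_ball_vol ?n * ?g" unfolding A_def by (rule integral_norm_gauss_le)
    then have "2 * A / ?g \<le> ?n * unit_ball_vol ?n" using g0 by (simp add: divide_le_eq)
    also have "\<dots> = 2 * pi * c2"
    proof -
      have G: "Gamma (?n / 2 + 1) = ?n / 2 * Gamma (?n / 2)" using n0 by (intro Gamma_plus1) (auto dest: nonpos_Ints_nonpos)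
      have P: "pi powr (?n / 2 - 1) = pi powr (?n / 2) / pi" by (simp add: powr_diff)
      show ?thesis unfolding unit_ball_vol_def c2_def G P using n0 g1 by (simp add: field_simps)
    qed
    finally show ?thesis .
  qed
  have c20: "0 \<le> c2" using g1 by (simp add: c2_def)
  have step: "\<exists>l. ereal l \<le> curve_length \<phi> a b \<and> norm_body K \<le> c1 * l + c2 * d + \<delta> * (2 * pi * c2)" if \<delta>: "\<delta> > 0" for \<delta>
  proof -
    obtain F where F: "finite F" "F \<noteq> {}" "F \<subseteq> K" "\<And>x. x \<in> K \<Longrightarrow> \<exists>y\<in>F. dist x y < \<delta>"
      using convex_body_polytope_approx[OF assms(2) \<delta>] by blast
    obtain xs where xs: "F \<subseteq> convex hull (set xs)" "ereal (plen xs) \<le> curve_length \<phi> a b"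
      using finite_cover_of_curve[OF F(1) _ assms(3), of \<phi>] F(3) assms(5) by blast
    have MF: "0 \<le> Max (norm ` F)" using F(1,2) by (rule Max_norm_nonneg)
    \<comment> \<open>A majorant of the support function of \<open>K\<close>, as every point of
      \<open>K\<close> is within \<delta> of \<open>F\<close>. The surplus contributes the error
      term proportional to \<delta>.\<close>
    let ?H = "\<lambda>x. hmax F x + \<delta> * norm x"
    have "norm_body K * ?g \<le> 2 * (\<integral>x. ?H x * exp (- (norm x)\<^sup>2) \<partial>lborel)"
    proof (rule norm_body_le_gauss_integral[OF assms(2), where M = "Max (norm ` F) + \<delta>"])
      show "continuous_on UNIV ?H" by (intro continuous_intros hmax_continuous F(1,2))
      show "?H (c *\<^sub>R x) = c * ?H x" if "c > 0" for c x
        using hmax_properties(1)[OF F(1,2) that] that by (simp add: algebra_simps)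
      show "0 \<le> Max (norm ` F) + \<delta>" using MF \<delta> by simp
      show "\<bar>?H x\<bar> \<le> (Max (norm ` F) + \<delta>) * norm x" for x
      proof -
        have "\<bar>?H x\<bar> \<le> \<bar>hmax F x\<bar> + \<bar>\<delta> * norm x\<bar>" by (rule abs_triangle_ineq)
        then show ?thesis using hmax_properties(2)[OF F(1,2), of x] \<delta> by (simp add: distrib_right abs_mult)
      qed
      show "k \<bullet> x \<le> ?H x" if k: "k \<in> K" for k x
      proof -
        obtain y where y: "y \<in> F" "dist k y < \<delta>" using F(4)[OF k] by blast
        have "k \<bullet> x = y \<bullet> x + (k - y) \<bullet> x" by (simp add: inner_diff_left)
        also have "\<dots> \<le> hmax F x + norm (k - y) * norm x"
          using hmax_ge[OF F(1) y(1)] norm_cauchy_schwarz by (intro add_mono)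
        also have "\<dots> \<le> ?H x" using y(2) by (intro add_left_mono mult_right_mono) (auto simp: dist_norm)
        finally show ?thesis .
      qed
    qed
    also have "(\<integral>x. ?H x * exp (- (norm x)\<^sup>2) \<partial>lborel) = (\<integral>x. hmax F x * exp (- (norm x)\<^sup>2) \<partial>lborel) + \<delta> * A"
    proof -
      have "integrable lborel (\<lambda>x. hmax F x * exp (- (norm x)\<^sup>2))"
        by (rule integrable_norm_gauss[OF _ MF]) (use F hmax_properties(2)[OF F(1,2)] in auto)
      moreover have "integrable lborel (\<lambda>x::real^'n. norm x * exp (- (norm x)\<^sup>2))"
        by (rule integrable_norm_gauss[where M = 1]) auto
      ultimately show ?thesis by (simp add: distrib_right mult.assoc A_def)
    qed
    also have "(\<integral>x. hmax F x * exp (- (norm x)\<^sup>2) \<partial>lborel) \<le> plen xs * pi powr ((?n - 1) / 2) / 4 + diameter F / (2 * pi) * A"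
      unfolding A_def by (rule hmax_gauss_integral_le[OF assms(1) F(1,2) xs(1)])
    also have "diameter F / (2 * pi) * A \<le> d / (2 * pi) * A"
      unfolding d_def using A0 F(3) cK by (intro mult_right_mono divide_right_mono diameter_subset compact_imp_bounded) auto
    finally have "norm_body K * ?g \<le> 2 * ((plen xs * pi powr ((?n - 1) / 2) / 4 + d / (2 * pi) * A) + \<delta> * A)" by simp
    then have "norm_body K \<le> 2 * ((plen xs * pi powr ((?n - 1) / 2) / 4 + d / (2 * pi) * A) + \<delta> * A) / ?g"
      using g0 by (simp add: le_divide_eq)
    \<comment> \<open>The factor 2 and the factor 1/4 of the path length combine to the 1/2 in
      \<open>c1\<close>.\<close>
    also have "\<dots> = c1 * plen xs + d / (2 * pi) * (2 * A / ?g) + \<delta> * (2 * A / ?g)"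
    proof -
      have "2 * ((l * p / 4 + d / (2 * pi) * A) + \<delta> * A) / g = p / (2 * g) * l + d / (2 * pi) * (2 * A / g) + \<delta> * (2 * A / g)"
        if "g > 0" for l p g :: real using that by (simp add: field_simps)
      from this[OF g0] show ?thesis unfolding c1_def .
    qed
    also have "\<dots> \<le> c1 * plen xs + d / (2 * pi) * (2 * pi * c2) + \<delta> * (2 * pi * c2)"
      using Aub d0 \<delta> by (intro add_mono mult_left_mono order_refl) auto
    also have "d / (2 * pi) * (2 * pi * c2) = c2 * d" by simp
    finally show ?thesis using xs(2) by blast
  qed
  show ?thesis
  proof (cases "curve_length \<phi> a b")
    case (real L)
    have "norm_body K \<le> c1 * L + c2 * d"
    proof (rule field_le_epsilon)
      fix e :: real assume e: "e > 0"
      define \<delta> where "\<delta> = e / (2 * pi * c2 + 1)"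
      have pos: "2 * pi * c2 + 1 > 0" using c20 by (simp add: add_nonneg_pos)
      have \<delta>: "\<delta> > 0" "\<delta> * (2 * pi * c2) \<le> e"
        using e pos c20 by (auto simp: \<delta>_def field_simps)
      obtain l where l: "ereal l \<le> curve_length \<phi> a b" "norm_body K \<le> c1 * l + c2 * d + \<delta> * (2 * pi * c2)"
        using step[OF \<delta>(1)] by blast
      have "c1 * l \<le> c1 * L" using l(1) real c10 by simp
      then show "norm_body K \<le> c1 * L + c2 * d + e" using l(2) \<delta>(2) by linarith
    qed
    then show ?thesis using real by (simp add: c1_def c2_def d_def)
  next
    case PInf
    have "ereal c1 * curve_length \<phi> a b = \<infinity>" using PInf c10 by simp
    then show ?thesis unfolding c1_def[symmetric] by (simp only: plus_ereal.simps ereal_less_eq)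
  next
    \<comment> \<open>Excluded, since \<open>step\<close> provides a real lower bound for the
      length.\<close>
    case MInf
    then show ?thesis using step[of 1] by auto
  qed
qed

end
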